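(* Let $P\colon(\mathcal X,F)\to(\mathcal M,G)$ be a fiberwise opfibration in $\mathbf{Fib}(\mathcal A)$ with $G$ a split fibration, and let $\bar{\mathcal X}$, $\bar F\colon\bar{\mathcal X}\to\mathcal A$ and $\bar P\colon\bar{\mathcal X}\to\mathcal M$ be the category and functors constructed from $P$ as described in the context. Then $\bar P\colon(\bar{\mathcal X},\bar F)\to(\mathcal M,G)$ is a discrete opfibration in $\mathbf{Fib}(\mathcal A)$.
   Context: (Op)cartesian arrows, (op)cartesian liftings and Grothendieck (op)fibrations are as usual; an arrow $f$ is $F$-vertical if $F(f)$ is an identity. All (op)fibrations are assumed to admit a cleavage. A fibration is split if it admits a functorial cleavage (chosen cartesian liftings compatible with composition and identities). $\mathbf{Fib}(\mathcal A)$ is the 2-category whose objects are fibrations $(\mathcal X,F)$, $F\colon\mathcal X\to\mathcal A$; 1-cells are functors over $\mathcal A$ preserving cartesian arrows; 2-cells are natural transformations with vertical components. $P$ is a fiberwise opfibration if for every object $a$ of $\mathcal A$ the restriction $P_a\colon\mathcal X_a\to\mathcal M_a$ to the fibers over $a$ is an opfibration. Construction. Fix a functorial cleavage of $G$. For $\alpha\colon a\to Fx$ in $\mathcal A$, an $F$-cartesian lifting $\hat\alpha^{x}\colon\alpha^*x\to x$ of $\alpha$ at $x$ is always chosen such that $P(\hat\alpha^x)$ is the chosen $G$-cartesian lifting of $\alpha$ at $Px$ (such a choice is always possible). For $\beta\colon Px\to m$ with $G\beta=1_{Fx}$, let $\hat\beta\colon x\to\beta_*x$ be an opcartesian lifting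 of $\beta$ at $x$ in the fiber over $Fx$. - Objects of $\bar{\mathcal X}$: equivalence classes $\bar x$ of objects of $\mathcal X$, where $x\sim x'$ iff there is a zig-zag of $P$-vertical arrows connecting $x$ to $x'$. - Morphisms $\mu\colon\bar x_1\to\bar x_2$: arrows $\mu\colon Px_1\to Px_2$ of $\mathcal M$ such that $\overline{\beta_*x_1}=\overline{\alpha^*x_2}$, where $\alpha=G\mu$ and $\beta$ is the unique arrow of $\mathcal M$ with $P(\hat\alpha^{x_2})\cdot\beta=\mu$ and $G\beta=1$ (this is independent of the representatives). Identities and composition are those of $\mathcal M$. - $\bar F(\mu\colon\bar x_1\to\bar x_2)=(G\mu\colon Fx_1\to Fx_2)$, and $\bar P(\mu\colon\bar x_1\to\bar x_2)=(\mu\colon Px_1\to Px_2)$. Discrete opfibration in a 2-category with comma objects: a 1-cell $p\colon E\to B$ such that the canonical 1-cell $r\colon E\downarrow E\to p\downarrow B$ between comma objects has a left adjoint with identity unit and identity counit (so $r$ is an isomorphism). In $\mathbf{Fib}(\mathcal A)$, for $P\colon(\mathcal X,F)\to(\mathcal M,G)$: the objects of $P\downarrow(\mathcal M,G)$ are triples $(x,\beta\colon Px\to m,m)$ with $G\beta=1_{Fx}$, with arrows pairs forming commutative squares. The objects of $(\mathcal X,F)\downarrow(\mathcal X,F)$ are triples $(x_0,\nu\colon x_0\to x_1,x_1)$ with $F\nu=1$, with arrows the commutative squares, and $r(x_0,\nu,x_1)=(x_0,P\nu,Px_1)$. *)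

theory Defs
  imports Main
begin

section \<open>Categories, functors, natural transformations\<close>

record ('o, 'a) category =
  Obj :: "'o set"
  Arr :: "'a set"
  Dom :: "'a \<Rightarrow> 'o"
  Cod :: "'a \<Rightarrow> 'o"
  Id :: "'o \<Rightarrow> 'a"
  Comp :: "'a \<Rightarrow> 'a \<Rightarrow> 'a" (infixr "\<cdot>\<index>" 70)

definition hom :: "('o, 'a) category \<Rightarrow> 'o \<Rightarrow> 'o \<Rightarrow> 'a set" where
  "hom C x y = {f \<in> Arr C. Dom C f = x \<and> Cod C f = y}"

text \<open>Composition is written in the classical order: \<open>g \<cdot>\<^bsub>C\<^esub> f\<close> is \<open>g\<close> after \<open>f\<close>.\<close>

locale category =
  fixes C :: "('o, 'a) category" (structure)
  assumes Dom_Obj: "f \<in> Arr C \<Longrightarrow> Dom C f \<in> Obj C"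
    and Cod_Obj: "f \<in> Arr C \<Longrightarrow> Cod C f \<in> Obj C"
    and Id_hom: "x \<in> Obj C \<Longrightarrow> Id C x \<in> hom C x x"
    and Comp_hom: "\<lbrakk>f \<in> hom C x y; g \<in> hom C y z\<rbrakk> \<Longrightarrow> g \<cdot> f \<in> hom C x z"
    and Id_left: "f \<in> hom C x y \<Longrightarrow> Id C y \<cdot> f = f"
    and Id_right: "f \<in> hom C x y \<Longrightarrow> f \<cdot> Id C x = f"
    and assoc: "\<lbrakk>f \<in> hom C w x; g \<in> hom C x y; h \<in> hom C y z\<rbrakk> \<Longrightarrow> h \<cdot> (g \<cdot> f) = (h \<cdot> g) \<cdot> f"

record ('o, 'a, 'p, 'b) func =
  ob :: "'o \<Rightarrow> 'p"
  ar :: "'a \<Rightarrow> 'b"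

locale is_functor = dom: category C + cod: category D
  for C :: "('o, 'a) category" and D :: "('p, 'b) category"
    and F :: "('o, 'a, 'p, 'b) func" +
  assumes ob_Obj: "x \<in> Obj C \<Longrightarrow> ob F x \<in> Obj D"
    and ar_hom: "f \<in> hom C x y \<Longrightarrow> ar F f \<in> hom D (ob F x) (ob F y)"
    and ar_Id: "x \<in> Obj C \<Longrightarrow> ar F (Id C x) = Id D (ob F x)"
    and ar_Comp: "\<lbrakk>f \<in> hom C x y; g \<in> hom C y z\<rbrakk>
        \<Longrightarrow> ar F (g \<cdot>\<^bsub>C\<^esub> f) = ar F g \<cdot>\<^bsub>D\<^esub> ar F f"

definition id_func :: "('o, 'a, 'o, 'a) func" where
  "id_func = \<lparr>ob = \<lambda>x. x, ar = \<lambda>f. f\<rparr>"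

definition comp_func ::
  "('p, 'b, 'q, 'c) func \<Rightarrow> ('o, 'a, 'p, 'b) func \<Rightarrow> ('o, 'a, 'q, 'c) func" where
  "comp_func S T = \<lparr>ob = \<lambda>x. ob S (ob T x), ar = \<lambda>f. ar S (ar T f)\<rparr>"

definition nat_trans :: "('o, 'a) category \<Rightarrow> ('p, 'b) category \<Rightarrow>
    ('o, 'a, 'p, 'b) func \<Rightarrow> ('o, 'a, 'p, 'b) func \<Rightarrow> ('o \<Rightarrow> 'b) \<Rightarrow> bool" where
  "nat_trans C D S T \<eta> \<longleftrightarrow> is_functor C D S \<and> is_functor C D T \<and>
     (\<forall>x\<in>Obj C. \<eta> x \<in> hom D (ob S x) (ob T x)) \<and>
     (\<forall>f\<in>Arr C. \<eta> (Cod C f) \<cdot>\<^bsub>D\<^esub> ar S f = ar T f \<cdot>\<^bsub>D\<^esub> \<eta> (Dom C f))"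

section \<open>Fibrations and opfibrations\<close>

definition cartesian ::
  "('o, 'a) category \<Rightarrow> ('p, 'b) category \<Rightarrow> ('o, 'a, 'p, 'b) func \<Rightarrow> 'a \<Rightarrow> bool" where
  "cartesian X A F f \<longleftrightarrow> f \<in> Arr X \<and>
     (\<forall>g\<in>Arr X. Cod X g = Cod X f \<longrightarrow>
       (\<forall>h\<in>hom A (ob F (Dom X g)) (ob F (Dom X f)). ar F f \<cdot>\<^bsub>A\<^esub> h = ar F g \<longrightarrow>
         (\<exists>!k. k \<in> hom X (Dom X g) (Dom X f) \<and> f \<cdot>\<^bsub>X\<^esub> k = g \<and> ar F k = h)))"

definition opcartesian ::
  "('o, 'a) category \<Rightarrow> ('p, 'b) category \<Rightarrow> ('o, 'a, 'p, 'b) func \<Rightarrow> 'a \<Rightarrow> bool" where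
  "opcartesian X A F f \<longleftrightarrow> f \<in> Arr X \<and>
     (\<forall>g\<in>Arr X. Dom X g = Dom X f \<longrightarrow>
       (\<forall>h\<in>hom A (ob F (Cod X f)) (ob F (Cod X g)). h \<cdot>\<^bsub>A\<^esub> ar F f = ar F g \<longrightarrow>
         (\<exists>!k. k \<in> hom X (Cod X f) (Cod X g) \<and> k \<cdot>\<^bsub>X\<^esub> f = g \<and> ar F k = h)))"

definition cartesian_lifting ::
  "('o, 'a) category \<Rightarrow> ('p, 'b) category \<Rightarrow> ('o, 'a, 'p, 'b) func \<Rightarrow> 'b \<Rightarrow> 'o \<Rightarrow> 'a \<Rightarrow> bool" where
  "cartesian_lifting X A F \<alpha> x f \<longleftrightarrow> cartesian X A F f \<and> Cod X f = x \<and> ar F f = \<alpha>"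

definition opcartesian_lifting ::
  "('o, 'a) category \<Rightarrow> ('p, 'b) category \<Rightarrow> ('o, 'a, 'p, 'b) func \<Rightarrow> 'b \<Rightarrow> 'o \<Rightarrow> 'a \<Rightarrow> bool" where
  "opcartesian_lifting X A F \<beta> x f \<longleftrightarrow> opcartesian X A F f \<and> Dom X f = x \<and> ar F f = \<beta>"

definition fibration ::
  "('o, 'a) category \<Rightarrow> ('p, 'b) category \<Rightarrow> ('o, 'a, 'p, 'b) func \<Rightarrow> bool" where
  "fibration X A F \<longleftrightarrow> is_functor X A F \<and>
     (\<forall>\<alpha>\<in>Arr A. \<forall>x\<in>Obj X. Cod A \<alpha> = ob F x \<longrightarrow> (\<exists>f. cartesian_lifting X A F \<alpha> x f))"

definition opfibration ::
  "('o, 'a) category \<Rightarrow> ('p, 'b) category \<Rightarrow> ('o, 'a, 'p, 'b) func \<Rightarrow> bool" where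
  "opfibration X A F \<longleftrightarrow> is_functor X A F \<and>
     (\<forall>\<beta>\<in>Arr A. \<forall>x\<in>Obj X. Dom A \<beta> = ob F x \<longrightarrow> (\<exists>f. opcartesian_lifting X A F \<beta> x f))"

text \<open>A cleavage sends \<open>\<alpha> : a \<rightarrow> F x\<close> and \<open>x\<close> to a cartesian lifting of \<open>\<alpha>\<close> at \<open>x\<close>;
  its values at other arguments are irrelevant.\<close>

definition cleavage :: "('o, 'a) category \<Rightarrow> ('p, 'b) category \<Rightarrow> ('o, 'a, 'p, 'b) func
    \<Rightarrow> ('b \<Rightarrow> 'o \<Rightarrow> 'a) \<Rightarrow> bool" where
  "cleavage X A F c \<longleftrightarrow>
     (\<forall>\<alpha>\<in>Arr A. \<forall>x\<in>Obj X. Cod A \<alpha> = ob F x \<longrightarrow> cartesian_lifting X A F \<alpha> x (c \<alpha> x))"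

definition functorial_cleavage :: "('o, 'a) category \<Rightarrow> ('p, 'b) category \<Rightarrow> ('o, 'a, 'p, 'b) func
    \<Rightarrow> ('b \<Rightarrow> 'o \<Rightarrow> 'a) \<Rightarrow> bool" where
  "functorial_cleavage X A F c \<longleftrightarrow> cleavage X A F c \<and>
     (\<forall>x\<in>Obj X. c (Id A (ob F x)) x = Id X x) \<and>
     (\<forall>x\<in>Obj X. \<forall>\<alpha>\<in>Arr A. \<forall>\<gamma>\<in>Arr A. Cod A \<alpha> = ob F x \<longrightarrow> Cod A \<gamma> = Dom A \<alpha> \<longrightarrow>
        c (\<alpha> \<cdot>\<^bsub>A\<^esub> \<gamma>) x = c \<alpha> x \<cdot>\<^bsub>X\<^esub> c \<gamma> (Dom X (c \<alpha> x)))"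

definition split_fibration ::
  "('o, 'a) category \<Rightarrow> ('p, 'b) category \<Rightarrow> ('o, 'a, 'p, 'b) func \<Rightarrow> bool" where
  "split_fibration X A F \<longleftrightarrow> fibration X A F \<and> (\<exists>c. functorial_cleavage X A F c)"

definition fiber :: "('o, 'a) category \<Rightarrow> ('p, 'b) category \<Rightarrow> ('o, 'a, 'p, 'b) func \<Rightarrow> 'p
    \<Rightarrow> ('o, 'a) category" where
  "fiber X A F a = X\<lparr>Obj := {x \<in> Obj X. ob F x = a},
     Arr := {f \<in> Arr X. ob F (Dom X f) = a \<and> ob F (Cod X f) = a \<and> ar F f = Id A a}\<rparr>"

section \<open>The 2-category of fibrations over a base\<close>

text \<open>In \<open>fib_1cell A X F Y G P\<close> the 1-cell is \<open>P : (X, F) \<rightarrow> (Y, G)\<close>.\<close>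

definition fib_1cell :: "('p, 'b) category \<Rightarrow> ('o, 'a) category \<Rightarrow> ('o, 'a, 'p, 'b) func
    \<Rightarrow> ('q, 'c) category \<Rightarrow> ('q, 'c, 'p, 'b) func \<Rightarrow> ('o, 'a, 'q, 'c) func \<Rightarrow> bool" where
  "fib_1cell A X F Y G P \<longleftrightarrow> fibration X A F \<and> fibration Y A G \<and> is_functor X Y P \<and>
     (\<forall>x\<in>Obj X. ob G (ob P x) = ob F x) \<and>
     (\<forall>f\<in>Arr X. ar G (ar P f) = ar F f) \<and>
     (\<forall>f. cartesian X A F f \<longrightarrow> cartesian Y A G (ar P f))"

definition fib_2cell :: "('p, 'b) category \<Rightarrow> ('o, 'a) category \<Rightarrow> ('o, 'a, 'p, 'b) func
    \<Rightarrow> ('q, 'c) category \<Rightarrow> ('q, 'c, 'p, 'b) func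
    \<Rightarrow> ('o, 'a, 'q, 'c) func \<Rightarrow> ('o, 'a, 'q, 'c) func \<Rightarrow> ('o \<Rightarrow> 'c) \<Rightarrow> bool" where
  "fib_2cell A X F Y G S T \<eta> \<longleftrightarrow> fib_1cell A X F Y G S \<and> fib_1cell A X F Y G T \<and>
     nat_trans X Y S T \<eta> \<and> (\<forall>x\<in>Obj X. ar G (\<eta> x) = Id A (ob F x))"

text \<open>\<open>L : (Y, G) \<rightarrow> (X, F)\<close> is left adjoint to \<open>R : (X, F) \<rightarrow> (Y, G)\<close> with unit \<open>\<eta>\<close>
  and counit \<open>\<epsilon>\<close>.\<close>

definition fib_adjunction :: "('p, 'b) category \<Rightarrow> ('o, 'a) category \<Rightarrow> ('o, 'a, 'p, 'b) func
    \<Rightarrow> ('q, 'c) category \<Rightarrow> ('q, 'c, 'p, 'b) func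
    \<Rightarrow> ('q, 'c, 'o, 'a) func \<Rightarrow> ('o, 'a, 'q, 'c) func \<Rightarrow> ('q \<Rightarrow> 'c) \<Rightarrow> ('o \<Rightarrow> 'a) \<Rightarrow> bool" where
  "fib_adjunction A X F Y G L R \<eta> \<epsilon> \<longleftrightarrow>
     fib_1cell A Y G X F L \<and> fib_1cell A X F Y G R \<and>
     fib_2cell A Y G Y G id_func (comp_func R L) \<eta> \<and>
     fib_2cell A X F X F (comp_func L R) id_func \<epsilon> \<and>
     (\<forall>y\<in>Obj Y. \<epsilon> (ob L y) \<cdot>\<^bsub>X\<^esub> ar L (\<eta> y) = Id X (ob L y)) \<and>
     (\<forall>x\<in>Obj X. ar R (\<epsilon> x) \<cdot>\<^bsub>Y\<^esub> \<eta> (ob R x) = Id Y (ob R x))"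

definition fiberwise_opfibration :: "('p, 'b) category \<Rightarrow> ('o, 'a) category
    \<Rightarrow> ('o, 'a, 'p, 'b) func \<Rightarrow> ('q, 'c) category \<Rightarrow> ('q, 'c, 'p, 'b) func
    \<Rightarrow> ('o, 'a, 'q, 'c) func \<Rightarrow> bool" where
  "fiberwise_opfibration A X F M G P \<longleftrightarrow>
     fib_1cell A X F M G P \<and> (\<forall>a\<in>Obj A. opfibration (fiber X A F a) (fiber M A G a) P)"

section \<open>Comma objects and discrete opfibrations\<close>

text \<open>The comma object in fibrations over \<open>A\<close> of \<open>S : (X, F) \<rightarrow> (Z, H)\<close> and
  \<open>T : (Y, K) \<rightarrow> (Z, H)\<close>. The universal 2-cell has to be vertical, hence the objects are the
  triples \<open>(x, \<nu> : S x \<rightarrow> T y, y)\<close> with \<open>H \<nu> = 1\<close>. An arrow is a commutative square \<open>(f, g)\<close>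
  together with its source and target; \<open>F f = K g\<close> then holds automatically. The triple lies over
  \<open>F x\<close>, and the square lies over \<open>F f\<close>.\<close>

definition comma :: "('p, 'b) category \<Rightarrow> ('o, 'a) category \<Rightarrow> ('o, 'a, 'p, 'b) func
    \<Rightarrow> ('q, 'c) category \<Rightarrow> ('r, 'd) category \<Rightarrow> ('r, 'd, 'p, 'b) func
    \<Rightarrow> ('o, 'a, 'r, 'd) func \<Rightarrow> ('q, 'c, 'r, 'd) func
    \<Rightarrow> ('o \<times> 'd \<times> 'q, ('o \<times> 'd \<times> 'q) \<times> ('a \<times> 'c) \<times> ('o \<times> 'd \<times> 'q)) category" where
  "comma A X F Y Z H S T = (let
     Ob = {(x, \<nu>, y). x \<in> Obj X \<and> y \<in> Obj Y \<and>
             \<nu> \<in> hom Z (ob S x) (ob T y) \<and> ar H \<nu> = Id A (ob F x)}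
   in \<lparr>Obj = Ob,
       Arr = {((x, \<nu>, y), (f, g), (x', \<nu>', y')) | x \<nu> y f g x' \<nu>' y'.
                (x, \<nu>, y) \<in> Ob \<and> (x', \<nu>', y') \<in> Ob \<and> f \<in> hom X x x' \<and> g \<in> hom Y y y' \<and>
                ar T g \<cdot>\<^bsub>Z\<^esub> \<nu> = \<nu>' \<cdot>\<^bsub>Z\<^esub> ar S f},
       Dom = \<lambda>(s, _, _). s,
       Cod = \<lambda>(_, _, t). t,
       Id = \<lambda>(x, \<nu>, y). ((x, \<nu>, y), (Id X x, Id Y y), (x, \<nu>, y)),
       Comp = \<lambda>(_, (f', g'), t) (s, (f, g), _). (s, (f' \<cdot>\<^bsub>X\<^esub> f, g' \<cdot>\<^bsub>Y\<^esub> g), t)\<rparr>)"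

definition comma_base :: "('o, 'a, 'p, 'b) func
    \<Rightarrow> ('o \<times> 'd \<times> 'q, ('o \<times> 'd \<times> 'q) \<times> ('a \<times> 'c) \<times> ('o \<times> 'd \<times> 'q), 'p, 'b) func" where
  "comma_base F = \<lparr>ob = \<lambda>(x, _, _). ob F x, ar = \<lambda>(_, (f, _), _). ar F f\<rparr>"

definition comma_r :: "('o, 'a, 'q, 'c) func
    \<Rightarrow> ('o \<times> 'a \<times> 'o, ('o \<times> 'a \<times> 'o) \<times> ('a \<times> 'a) \<times> ('o \<times> 'a \<times> 'o),
        'o \<times> 'c \<times> 'q, ('o \<times> 'c \<times> 'q) \<times> ('a \<times> 'c) \<times> ('o \<times> 'c \<times> 'q)) func" where
  "comma_r P = (let r = (\<lambda>(x, \<nu>, y). (x, ar P \<nu>, ob P y))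
     in \<lparr>ob = r, ar = \<lambda>(s, (f, g), t). (r s, (f, ar P g), r t)\<rparr>)"

text \<open>\<open>P : (X, F) \<rightarrow> (M, G)\<close> is a discrete opfibration in the 2-category of fibrations over \<open>A\<close>.
  The unit and the counit are the families of identities; the typing of their components forces
  \<open>r L = 1\<close> and \<open>L r = 1\<close>.\<close>

definition discrete_opfibration_in_Fib :: "('p, 'b) category \<Rightarrow> ('o, 'a) category
    \<Rightarrow> ('o, 'a, 'p, 'b) func \<Rightarrow> ('q, 'c) category \<Rightarrow> ('q, 'c, 'p, 'b) func
    \<Rightarrow> ('o, 'a, 'q, 'c) func \<Rightarrow> bool" where
  "discrete_opfibration_in_Fib A X F M G P \<longleftrightarrow> fib_1cell A X F M G P \<and>
     (let XX = comma A X F X X F id_func id_func;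
          PM = comma A X F M M G P id_func
      in \<exists>L. fib_adjunction A XX (comma_base F) PM (comma_base F) L (comma_r P) (Id PM) (Id XX))"

section \<open>The construction\<close>

definition vertical_step :: "('o, 'a) category \<Rightarrow> ('q, 'c) category \<Rightarrow> ('o, 'a, 'q, 'c) func
    \<Rightarrow> ('o \<times> 'o) set" where
  "vertical_step X M P = {(Dom X f, Cod X f) | f. f \<in> Arr X \<and> (\<exists>m\<in>Obj M. ar P f = Id M m)}"

definition zigzag :: "('o, 'a) category \<Rightarrow> ('q, 'c) category \<Rightarrow> ('o, 'a, 'q, 'c) func
    \<Rightarrow> ('o \<times> 'o) set" where
  "zigzag X M P = (vertical_step X M P \<union> (vertical_step X M P)\<inverse>)\<^sup>* \<inter> Obj X \<times> Obj X"

definition bar_class :: "('o, 'a) category \<Rightarrow> ('q, 'c) category \<Rightarrow> ('o, 'a, 'q, 'c) func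
    \<Rightarrow> 'o \<Rightarrow> 'o set" where
  "bar_class X M P x = zigzag X M P `` {x}"

definition compatible_cleavage :: "('p, 'b) category \<Rightarrow> ('o, 'a) category
    \<Rightarrow> ('o, 'a, 'p, 'b) func \<Rightarrow> ('o, 'a, 'q, 'c) func
    \<Rightarrow> ('b \<Rightarrow> 'q \<Rightarrow> 'c) \<Rightarrow> ('b \<Rightarrow> 'o \<Rightarrow> 'a) \<Rightarrow> bool" where
  "compatible_cleavage A X F P cG cF \<longleftrightarrow> cleavage X A F cF \<and>
     (\<forall>\<alpha>\<in>Arr A. \<forall>x\<in>Obj X. Cod A \<alpha> = ob F x \<longrightarrow> ar P (cF \<alpha> x) = cG \<alpha> (ob P x))"

text \<open>Compatible cleavages always exist.\<close>

lemma ex_compatible_lifting: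
  assumes P: "fiberwise_opfibration A X F M G P" and cG: "cleavage M A G cG"
    and \<alpha>: "\<alpha> \<in> Arr A" and x: "x \<in> Obj X" and \<alpha>x: "Cod A \<alpha> = ob F x"
  shows "\<exists>f. cartesian_lifting X A F \<alpha> x f \<and> ar P f = cG \<alpha> (ob P x)"
proof -
  have P1: "fib_1cell A X F M G P" using P by (simp add: fiberwise_opfibration_def)
  interpret F: is_functor X A F using P1 by (simp add: fib_1cell_def fibration_def)
  interpret G: is_functor M A G using P1 by (simp add: fib_1cell_def fibration_def)
  interpret P: is_functor X M P using P1 by (simp add: fib_1cell_def)
  have GPo: "ob G (ob P y) = ob F y" if "y \<in> Obj X" for y using P1 that by (simp add: fib_1cell_def)
  have GPa: "ar G (ar P f) = ar F f" if "f \<in> Arr X" for f using P1 that by (simp add: fib_1cell_def)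
  define a where "a = Dom A \<alpha>"
  have a: "a \<in> Obj A" by (simp add: a_def F.cod.Dom_Obj \<alpha>)
  have \<alpha>h: "\<alpha> \<in> hom A a (ob F x)" using \<alpha> \<alpha>x by (simp add: hom_def a_def)
  have Ia: "Id A a \<in> hom A a a" by (rule F.cod.Id_hom[OF a])
  have \<alpha>I: "\<alpha> \<cdot>\<^bsub>A\<^esub> Id A a = \<alpha>" by (rule F.cod.Id_right[OF \<alpha>h])
  obtain c where c: "cartesian X A F c" "Cod X c = x" "ar F c = \<alpha>"
    using P1 \<alpha> x \<alpha>x unfolding fib_1cell_def fibration_def cartesian_lifting_def by metis
  define y where "y = Dom X c"
  have cA: "c \<in> Arr X" using c by (simp add: cartesian_def)
  have ch: "c \<in> hom X y x" using cA c by (simp add: hom_def y_def)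
  have y: "y \<in> Obj X" by (simp add: y_def F.dom.Dom_Obj cA)
  have Fy: "ob F y = a" using F.ar_hom[OF ch] c \<alpha>h by (simp add: hom_def)
  define d where "d = ar P c"
  have dh: "d \<in> hom M (ob P y) (ob P x)" unfolding d_def by (rule P.ar_hom[OF ch])
  have dc: "cartesian M A G d" using P1 c by (simp add: fib_1cell_def d_def)
  have Gd: "ar G d = \<alpha>" using GPa[OF cA] c by (simp add: d_def)
  define k where "k = cG \<alpha> (ob P x)"
  have kl: "cartesian M A G k" "Cod M k = ob P x" "ar G k = \<alpha>"
    using cG \<alpha> \<alpha>x P.ob_Obj[OF x] GPo[OF x]
    unfolding cleavage_def cartesian_lifting_def k_def by metis+
  define m where "m = Dom M k"
  have kA: "k \<in> Arr M" using kl by (simp add: cartesian_def)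
  have kh: "k \<in> hom M m (ob P x)" using kA kl by (simp add: hom_def m_def)
  have m: "m \<in> Obj M" by (simp add: m_def G.dom.Dom_Obj kA)
  have Gm: "ob G m = a" using G.ar_hom[OF kh] kl \<alpha>h by (simp add: hom_def)
  have GPy: "ob G (ob P y) = a" using GPo[OF y] Fy by simp
  have fac: "\<exists>!l. l \<in> hom M (Dom M g) (Dom M f) \<and> f \<cdot>\<^bsub>M\<^esub> l = g \<and> ar G l = Id A a"
    if "cartesian M A G f" "g \<in> Arr M" "Cod M g = Cod M f" "ar G f = \<alpha>" "ar G g = \<alpha>"
       "ob G (Dom M f) = a" "ob G (Dom M g) = a" for f g
    using that Ia \<alpha>I unfolding cartesian_def by metis
  have dm: "Dom M d = ob P y" "Cod M d = ob P x" "d \<in> Arr M" using dh by (auto simp: hom_def)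
  obtain \<theta> where \<theta>: "\<theta> \<in> hom M m (ob P y)" "d \<cdot>\<^bsub>M\<^esub> \<theta> = k" "ar G \<theta> = Id A a"
    using fac[OF dc kA] dm kl Gd GPy Gm m_def by auto
  obtain \<phi> where \<phi>: "\<phi> \<in> hom M (ob P y) m" "k \<cdot>\<^bsub>M\<^esub> \<phi> = d" "ar G \<phi> = Id A a"
    using fac[OF kl(1) dm(3)] dm kl Gd GPy Gm m_def by auto
  have Iaa: "Id A a \<cdot>\<^bsub>A\<^esub> Id A a = Id A a" by (rule F.cod.Id_left[OF Ia])
  have "\<theta> \<cdot>\<^bsub>M\<^esub> \<phi> \<in> hom M (ob P y) (ob P y)" by (rule G.dom.Comp_hom[OF \<phi>(1) \<theta>(1)])
  moreover have "d \<cdot>\<^bsub>M\<^esub> (\<theta> \<cdot>\<^bsub>M\<^esub> \<phi>) = d" using G.dom.assoc[OF \<phi>(1) \<theta>(1) dh] \<theta> \<phi> by simp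
  moreover have "ar G (\<theta> \<cdot>\<^bsub>M\<^esub> \<phi>) = Id A a" using G.ar_Comp[OF \<phi>(1) \<theta>(1)] \<theta> \<phi> Iaa by simp
  moreover have "Id M (ob P y) \<in> hom M (ob P y) (ob P y)" using G.dom.Id_hom P.ob_Obj y by blast
  moreover have "d \<cdot>\<^bsub>M\<^esub> Id M (ob P y) = d" by (rule G.dom.Id_right[OF dh])
  moreover have "ar G (Id M (ob P y)) = Id A a" using G.ar_Id P.ob_Obj y GPy by metis
  ultimately have \<theta>\<phi>: "\<theta> \<cdot>\<^bsub>M\<^esub> \<phi> = Id M (ob P y)"
    using fac[OF dc dm(3)] dm Gd GPy by metis
  have "\<phi> \<cdot>\<^bsub>M\<^esub> \<theta> \<in> hom M m m" by (rule G.dom.Comp_hom[OF \<theta>(1) \<phi>(1)])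
  moreover have "k \<cdot>\<^bsub>M\<^esub> (\<phi> \<cdot>\<^bsub>M\<^esub> \<theta>) = k" using G.dom.assoc[OF \<theta>(1) \<phi>(1) kh] \<theta> \<phi> by simp
  moreover have "ar G (\<phi> \<cdot>\<^bsub>M\<^esub> \<theta>) = Id A a" using G.ar_Comp[OF \<theta>(1) \<phi>(1)] \<theta> \<phi> Iaa by simp
  moreover have "Id M m \<in> hom M m m" by (rule G.dom.Id_hom[OF m])
  moreover have "k \<cdot>\<^bsub>M\<^esub> Id M m = k" by (rule G.dom.Id_right[OF kh])
  moreover have "ar G (Id M m) = Id A a" using G.ar_Id[OF m] Gm by simp
  ultimately have \<phi>\<theta>: "\<phi> \<cdot>\<^bsub>M\<^esub> \<theta> = Id M m"
    using fac[OF kl(1) kA] kl Gm m_def by metis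
  let ?Xa = "fiber X A F a" and ?Ma = "fiber M A G a"
  have \<phi>a: "\<phi> \<in> Arr ?Ma" "Dom ?Ma \<phi> = ob P y" "y \<in> Obj ?Xa"
    using \<phi> GPy Gm y Fy by (auto simp: fiber_def hom_def)
  obtain e where e: "opcartesian ?Xa ?Ma P e" "Dom ?Xa e = y" "ar P e = \<phi>"
    using P a \<phi>a unfolding fiberwise_opfibration_def opfibration_def opcartesian_lifting_def by metis
  define z where "z = Cod X e"
  have eA: "e \<in> Arr ?Xa" using e(1) by (simp add: opcartesian_def)
  have eh: "e \<in> hom X y z" "ob F z = a" "ar F e = Id A a"
    using eA e(2) by (auto simp: fiber_def hom_def z_def)
  have z: "z \<in> Obj X" using eh F.dom.Cod_Obj by (force simp: hom_def)
  have Pz: "ob P z = m" using P.ar_hom[OF eh(1)] e \<phi> by (simp add: hom_def)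
  have fac2: "\<exists>!l. l \<in> hom ?Xa z (Cod X g) \<and> l \<cdot>\<^bsub>X\<^esub> e = g \<and> ar P l = h"
    if "g \<in> Arr ?Xa" "Dom X g = y" "h \<in> hom ?Ma m (ob P (Cod X g))" "h \<cdot>\<^bsub>M\<^esub> \<phi> = ar P g" for g h
    using e that Pz z_def unfolding opcartesian_def by (simp add: fiber_def)
  have Iy: "Id X y \<in> hom X y y" by (rule F.dom.Id_hom[OF y])
  have "Id X y \<in> Arr ?Xa" using Iy Fy F.ar_Id[OF y] by (simp add: fiber_def hom_def)
  moreover have "\<theta> \<in> hom ?Ma m (ob P y)" using \<theta> Gm GPy by (simp add: fiber_def hom_def)
  moreover have "Dom X (Id X y) = y" "Cod X (Id X y) = y" using Iy by (auto simp: hom_def)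
  ultimately obtain l where l: "l \<in> hom ?Xa z y" "l \<cdot>\<^bsub>X\<^esub> e = Id X y" "ar P l = \<theta>"
    using fac2[of "Id X y" \<theta>] \<theta>\<phi> P.ar_Id[OF y] by auto
  have lh: "l \<in> hom X z y" "ar F l = Id A a" using l by (auto simp: fiber_def hom_def)
  have elh: "e \<cdot>\<^bsub>X\<^esub> l \<in> hom X z z" by (rule F.dom.Comp_hom[OF lh(1) eh(1)])
  have "e \<cdot>\<^bsub>X\<^esub> l \<in> hom ?Xa z z"
    using elh eh lh F.ar_Comp[OF lh(1) eh(1)] Iaa by (simp add: fiber_def hom_def)
  moreover have "(e \<cdot>\<^bsub>X\<^esub> l) \<cdot>\<^bsub>X\<^esub> e = e"
    using F.dom.assoc[OF eh(1) lh(1) eh(1)] l F.dom.Id_right[OF eh(1)] by simp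
  moreover have "ar P (e \<cdot>\<^bsub>X\<^esub> l) = Id M m" using P.ar_Comp[OF lh(1) eh(1)] e l \<phi>\<theta> by simp
  moreover have Iz: "Id X z \<in> hom X z z" by (rule F.dom.Id_hom[OF z])
  moreover have "Id X z \<in> hom ?Xa z z"
    using Iz F.ar_Id[OF z] eh by (simp add: fiber_def hom_def)
  moreover have "Id X z \<cdot>\<^bsub>X\<^esub> e = e" by (rule F.dom.Id_left[OF eh(1)])
  moreover have "ar P (Id X z) = Id M m" using P.ar_Id[OF z] Pz by simp
  moreover have "Id M m \<in> hom ?Ma m m"
    using G.dom.Id_hom[OF m] G.ar_Id[OF m] Gm by (simp add: fiber_def hom_def)
  moreover have "Id M m \<cdot>\<^bsub>M\<^esub> \<phi> = ar P e" using G.dom.Id_left[OF \<phi>(1)] e by simp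
  moreover have "Dom X e = y" "Cod X e = z" using eh(1) by (auto simp: hom_def)
  ultimately have el: "e \<cdot>\<^bsub>X\<^esub> l = Id X z"
    using fac2[OF eA, of "Id M m"] Pz by metis
  define f where "f = c \<cdot>\<^bsub>X\<^esub> l"
  have fh: "f \<in> hom X z x" unfolding f_def by (rule F.dom.Comp_hom[OF lh(1) ch])
  have Ff: "ar F f = \<alpha>" using F.ar_Comp[OF lh(1) ch] c lh \<alpha>I by (simp add: f_def)
  have Pf: "ar P f = k" using P.ar_Comp[OF lh(1) ch] l \<theta> by (simp add: f_def d_def)
  have "cartesian X A F f"
    unfolding cartesian_def
  proof (intro conjI ballI impI)
    show "f \<in> Arr X" using fh by (simp add: hom_def)
    fix g h
    assume g: "g \<in> Arr X" "Cod X g = Cod X f"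
      and h: "h \<in> hom A (ob F (Dom X g)) (ob F (Dom X f))" "ar F f \<cdot>\<^bsub>A\<^esub> h = ar F g"
    define w where "w = Dom X g"
    have fz: "Dom X f = z" "Cod X f = x" using fh by (auto simp: hom_def)
    have hh: "h \<in> hom A (ob F w) a" using h fz eh by (simp add: w_def)
    have "\<exists>!q. q \<in> hom X w y \<and> c \<cdot>\<^bsub>X\<^esub> q = g \<and> ar F q = h"
      using c(1,2,3) g h(2) hh Fy Ff fz unfolding cartesian_def w_def y_def by metis
    then obtain q where q: "q \<in> hom X w y" "c \<cdot>\<^bsub>X\<^esub> q = g" "ar F q = h"
      and qu: "\<And>q'. q' \<in> hom X w y \<Longrightarrow> c \<cdot>\<^bsub>X\<^esub> q' = g \<Longrightarrow> ar F q' = h \<Longrightarrow> q' = q" by metis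
    have Ih: "Id A a \<cdot>\<^bsub>A\<^esub> h = h" by (rule F.cod.Id_left[OF hh])
    have "\<exists>!p. p \<in> hom X w z \<and> f \<cdot>\<^bsub>X\<^esub> p = g \<and> ar F p = h"
    proof (rule ex1I[of _ "e \<cdot>\<^bsub>X\<^esub> q"], intro conjI)
      show eq: "e \<cdot>\<^bsub>X\<^esub> q \<in> hom X w z" by (rule F.dom.Comp_hom[OF q(1) eh(1)])
      have "l \<cdot>\<^bsub>X\<^esub> (e \<cdot>\<^bsub>X\<^esub> q) = q"
        using F.dom.assoc[OF q(1) eh(1) lh(1)] l F.dom.Id_left[OF q(1)] by simp
      then show "f \<cdot>\<^bsub>X\<^esub> (e \<cdot>\<^bsub>X\<^esub> q) = g"
        using F.dom.assoc[OF eq lh(1) ch] q by (simp add: f_def)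
      show "ar F (e \<cdot>\<^bsub>X\<^esub> q) = h" using F.ar_Comp[OF q(1) eh(1)] eh q Ih by simp
    next
      fix p assume p: "p \<in> hom X w z \<and> f \<cdot>\<^bsub>X\<^esub> p = g \<and> ar F p = h"
      then have ph: "p \<in> hom X w z" by simp
      have "l \<cdot>\<^bsub>X\<^esub> p = q"
        by (rule qu)
          (use p F.dom.Comp_hom[OF ph lh(1)] F.dom.assoc[OF ph lh(1) ch]
             F.ar_Comp[OF ph lh(1)] lh Ih in \<open>auto simp: f_def\<close>)
      then show "p = e \<cdot>\<^bsub>X\<^esub> q"
        using F.dom.assoc[OF ph lh(1) eh(1)] el F.dom.Id_left[OF ph] by simp
    qed
    then show "\<exists>!p. p \<in> hom X (Dom X g) (Dom X f) \<and> f \<cdot>\<^bsub>X\<^esub> p = g \<and> ar F p = h"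
      using fz by (simp add: w_def)
  qed
  then show ?thesis using fh Ff Pf k_def by (auto simp: cartesian_lifting_def hom_def)
qed

lemma ex_compatible_cleavage:
  assumes "fiberwise_opfibration A X F M G P" and "cleavage M A G cG"
  shows "\<exists>cF. compatible_cleavage A X F P cG cF"
proof -
  have "\<forall>\<alpha> x. \<exists>f. \<alpha> \<in> Arr A \<longrightarrow> x \<in> Obj X \<longrightarrow> Cod A \<alpha> = ob F x \<longrightarrow>
      cartesian_lifting X A F \<alpha> x f \<and> ar P f = cG \<alpha> (ob P x)"
    using ex_compatible_lifting[OF assms] by blast
  then obtain cF where "\<forall>\<alpha> x. \<alpha> \<in> Arr A \<longrightarrow> x \<in> Obj X \<longrightarrow> Cod A \<alpha> = ob F x \<longrightarrow>
      cartesian_lifting X A F \<alpha> x (cF \<alpha> x) \<and> ar P (cF \<alpha> x) = cG \<alpha> (ob P x)"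
    by metis
  then show ?thesis by (auto simp: compatible_cleavage_def cleavage_def)
qed

definition fiberwise_opcleavage :: "('p, 'b) category \<Rightarrow> ('o, 'a) category
    \<Rightarrow> ('o, 'a, 'p, 'b) func \<Rightarrow> ('q, 'c) category \<Rightarrow> ('q, 'c, 'p, 'b) func
    \<Rightarrow> ('o, 'a, 'q, 'c) func \<Rightarrow> ('c \<Rightarrow> 'o \<Rightarrow> 'a) \<Rightarrow> bool" where
  "fiberwise_opcleavage A X F M G P cP \<longleftrightarrow>
     (\<forall>\<beta>\<in>Arr M. \<forall>x\<in>Obj X. Dom M \<beta> = ob P x \<longrightarrow> ar G \<beta> = Id A (ob F x) \<longrightarrow>
        opcartesian_lifting (fiber X A F (ob F x)) (fiber M A G (ob F x)) P \<beta> x (cP \<beta> x))"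

lemma ex_fiberwise_opcleavage:
  assumes P: "fiberwise_opfibration A X F M G P"
  shows "\<exists>cP. fiberwise_opcleavage A X F M G P cP"
proof -
  have P1: "fib_1cell A X F M G P" using P by (simp add: fiberwise_opfibration_def)
  interpret F: is_functor X A F using P1 by (simp add: fib_1cell_def fibration_def)
  interpret G: is_functor M A G using P1 by (simp add: fib_1cell_def fibration_def)
  have "\<exists>f. opcartesian_lifting (fiber X A F (ob F x)) (fiber M A G (ob F x)) P \<beta> x f"
    if \<beta>: "\<beta> \<in> Arr M" "Dom M \<beta> = ob P x" "ar G \<beta> = Id A (ob F x)" and x: "x \<in> Obj X" for \<beta> x
  proof -
    have Fx: "ob F x \<in> Obj A" by (rule F.ob_Obj[OF x])
    have "ar G \<beta> \<in> hom A (ob G (Dom M \<beta>)) (ob G (Cod M \<beta>))"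
      using \<beta> by (intro G.ar_hom) (simp add: hom_def)
    then have "\<beta> \<in> Arr (fiber M A G (ob F x))"
      using \<beta> F.cod.Id_hom[OF Fx] by (simp add: fiber_def hom_def)
    moreover have "x \<in> Obj (fiber X A F (ob F x))" "Dom (fiber M A G (ob F x)) \<beta> = ob P x"
      using x \<beta> by (auto simp: fiber_def)
    ultimately show ?thesis
      using P Fx unfolding fiberwise_opfibration_def opfibration_def by blast
  qed
  then have "\<forall>\<beta> x. \<exists>f. \<beta> \<in> Arr M \<longrightarrow> x \<in> Obj X \<longrightarrow> Dom M \<beta> = ob P x \<longrightarrow>
      ar G \<beta> = Id A (ob F x) \<longrightarrow>
      opcartesian_lifting (fiber X A F (ob F x)) (fiber M A G (ob F x)) P \<beta> x f"
    by blast
  then obtain cP where "\<forall>\<beta> x. \<beta> \<in> Arr M \<longrightarrow> x \<in> Obj X \<longrightarrow> Dom M \<beta> = ob P x \<longrightarrow>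
      ar G \<beta> = Id A (ob F x) \<longrightarrow>
      opcartesian_lifting (fiber X A F (ob F x)) (fiber M A G (ob F x)) P \<beta> x (cP \<beta> x)"
    by metis
  then show ?thesis unfolding fiberwise_opcleavage_def by auto
qed

text \<open>\<open>cF \<alpha> x : \<alpha>\<^sup>*x \<rightarrow> x\<close> and \<open>cP \<beta> x : x \<rightarrow> \<beta>\<^sub>*x\<close> are the chosen liftings.
  An arrow of the constructed category is recorded with its source and target classes. Since the
  defining condition does not depend on the representatives, they are quantified existentially.\<close>

definition bar_arr :: "('p, 'b) category \<Rightarrow> ('o, 'a) category
    \<Rightarrow> ('o, 'a, 'p, 'b) func \<Rightarrow> ('q, 'c) category \<Rightarrow> ('q, 'c, 'p, 'b) func
    \<Rightarrow> ('o, 'a, 'q, 'c) func \<Rightarrow> ('b \<Rightarrow> 'o \<Rightarrow> 'a) \<Rightarrow> ('c \<Rightarrow> 'o \<Rightarrow> 'a)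
    \<Rightarrow> 'o \<Rightarrow> 'c \<Rightarrow> 'o \<Rightarrow> bool" where
  "bar_arr A X F M G P cF cP x1 \<mu> x2 \<longleftrightarrow> \<mu> \<in> hom M (ob P x1) (ob P x2) \<and>
     (let \<alpha> = ar G \<mu>;
          \<beta> = (THE \<beta>. \<beta> \<in> hom M (ob P x1) (ob P (Dom X (cF \<alpha> x2))) \<and>
                  ar P (cF \<alpha> x2) \<cdot>\<^bsub>M\<^esub> \<beta> = \<mu> \<and> ar G \<beta> = Id A (ob F x1))
      in bar_class X M P (Cod X (cP \<beta> x1)) = bar_class X M P (Dom X (cF \<alpha> x2)))"

definition bar_cat :: "('p, 'b) category \<Rightarrow> ('o, 'a) category
    \<Rightarrow> ('o, 'a, 'p, 'b) func \<Rightarrow> ('q, 'c) category \<Rightarrow> ('q, 'c, 'p, 'b) func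
    \<Rightarrow> ('o, 'a, 'q, 'c) func \<Rightarrow> ('b \<Rightarrow> 'o \<Rightarrow> 'a) \<Rightarrow> ('c \<Rightarrow> 'o \<Rightarrow> 'a)
    \<Rightarrow> ('o set, 'o set \<times> 'c \<times> 'o set) category" where
  "bar_cat A X F M G P cF cP =
     \<lparr>Obj = Obj X // zigzag X M P,
      Arr = {(bar_class X M P x1, \<mu>, bar_class X M P x2) | x1 \<mu> x2.
               x1 \<in> Obj X \<and> x2 \<in> Obj X \<and> bar_arr A X F M G P cF cP x1 \<mu> x2},
      Dom = \<lambda>(s, _, _). s,
      Cod = \<lambda>(_, _, t). t,
      Id = \<lambda>s. (s, Id M (the_elem (ob P ` s)), s),
      Comp = \<lambda>(_, \<nu>, t) (s, \<mu>, _). (s, \<nu> \<cdot>\<^bsub>M\<^esub> \<mu>, t)\<rparr>"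

text \<open>\<open>F\<close> and \<open>P\<close> are constant on each class, so \<open>the_elem\<close> picks their common value.\<close>

definition bar_F :: "('o, 'a, 'p, 'b) func \<Rightarrow> ('q, 'c, 'p, 'b) func
    \<Rightarrow> ('o set, 'o set \<times> 'c \<times> 'o set, 'p, 'b) func" where
  "bar_F F G = \<lparr>ob = \<lambda>s. the_elem (ob F ` s), ar = \<lambda>(_, \<mu>, _). ar G \<mu>\<rparr>"

definition bar_P :: "('o, 'a, 'q, 'c) func
    \<Rightarrow> ('o set, 'o set \<times> 'c \<times> 'o set, 'q, 'c) func" where
  "bar_P P = \<lparr>ob = \<lambda>s. the_elem (ob P ` s), ar = \<lambda>(_, \<mu>, _). \<mu>\<rparr>"

end

theory Submission
  imports Defs
begin

text \<open>
  The chosen liftings need not act functorially on the objects of \<open>X\<close>, but they do so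
  on the classes modulo \<open>P\<close>-vertical zig-zags: a vertical \<open>\<beta> : P x \<rightarrow> m\<close> gives \<open>\<beta>\<^sub>*\<close> on classes, and
  \<open>\<alpha> : a \<rightarrow> F x\<close> gives \<open>\<alpha>\<^sup>*\<close>. The reason is that in the quotient \<open>\<beta>\<^sub>*x\<close> is represented by the target
  of any \<open>F\<close>-vertical arrow over \<open>\<beta>\<close> that starts at \<open>x\<close> (\<open>vertical_target_cls\<close>), and \<open>\<alpha>\<^sup>*x\<close> by the
  source of any arrow into \<open>x\<close> over the chosen \<open>G\<close>-lifting of \<open>\<alpha>\<close> (\<open>cartesian_source_cls\<close>). So a law
  for these actions is proved as soon as one arrow of the right shape is found. In particular the
  Beck--Chevalley equation \<open>\<alpha>\<^sup>*\<beta>\<^sub>* = (\<alpha>\<^sup>*\<beta>)\<^sub>*\<alpha>\<^sup>*\<close> holds on classes (\<open>pull_push_cls\<close>), even though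
  \<open>P\<close> is an opfibration only fiberwise and reindexing may destroy opcartesian arrows.

  The constructed category depends on these two actions alone: \<open>\<mu>\<close>, split as a chosen lifting of
  \<open>\<alpha> = G \<mu>\<close> after a vertical \<open>\<beta>\<close>, is an arrow \<open>s \<rightarrow> t\<close> iff \<open>\<beta>\<^sub>*s = \<alpha>\<^sup>*t\<close>. For any such family of sets
  (\<open>push_pull_family\<close>), Beck--Chevalley makes these arrows closed under composition, the chosen
  liftings of \<open>G\<close> become cartesian liftings, and a vertical \<open>\<beta>\<close> has exactly one lifting at \<open>s\<close>, with
  target \<open>\<beta>\<^sub>*s\<close> (\<open>el_arr_vertical_iff\<close>).

  It remains to pass from unique lifting of vertical arrows to the 2-categorical notion, and this
  works for every 1-cell \<open>P\<close> over \<open>A\<close> (\<open>fiberwise_discrete\<close>). Factoring through cartesian arrows, which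
  \<open>P\<close> preserves, one sees that \<open>P\<close> is faithful and that squares lift uniquely; hence the comparison
  \<open>r\<close> is bijective on objects and arrows. As both comma objects are fibrations over \<open>A\<close>, the inverse
  of \<open>r\<close> is a left adjoint with identity unit and counit.
\<close>

section \<open>Cartesian arrows\<close>

lemma homD:
  assumes "f \<in> hom C x y"
  shows "f \<in> Arr C" "Dom C f = x" "Cod C f = y"
  using assms by (auto simp: hom_def)

lemma Arr_hom: "f \<in> Arr C \<Longrightarrow> f \<in> hom C (Dom C f) (Cod C f)"
  by (simp add: hom_def)

lemma (in category) hom_Obj:
  assumes "f \<in> hom C x y"
  shows "x \<in> Obj C" "y \<in> Obj C"
  using assms Dom_Obj Cod_Obj by (auto simp: hom_def)

lemma cartesian_ex1:
  assumes "cartesian X A F f" "f \<in> hom X y x" "g \<in> hom X w x"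
    and "h \<in> hom A (ob F w) (ob F y)" "ar F f \<cdot>\<^bsub>A\<^esub> h = ar F g"
  shows "\<exists>!k. k \<in> hom X w y \<and> f \<cdot>\<^bsub>X\<^esub> k = g \<and> ar F k = h"
proof -
  have "g \<in> Arr X" "Cod X g = Cod X f" "h \<in> hom A (ob F (Dom X g)) (ob F (Dom X f))"
    using assms homD by metis+
  then have "\<exists>!k. k \<in> hom X (Dom X g) (Dom X f) \<and> f \<cdot>\<^bsub>X\<^esub> k = g \<and> ar F k = h"
    using assms(1,5) unfolding cartesian_def by blast
  then show ?thesis using homD[OF assms(2)] homD[OF assms(3)] by simp
qed

lemma cartesian_factor:
  assumes "cartesian X A F f" "f \<in> hom X y x" "g \<in> hom X w x"
    and "h \<in> hom A (ob F w) (ob F y)" "ar F f \<cdot>\<^bsub>A\<^esub> h = ar F g"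
  obtains k where "k \<in> hom X w y" "f \<cdot>\<^bsub>X\<^esub> k = g" "ar F k = h"
  using cartesian_ex1[OF assms] by blast

lemma (in is_functor) cartesian_cancel:
  assumes "cartesian C D F f" "f \<in> hom C y x" "k \<in> hom C w y" "k' \<in> hom C w y"
    and "f \<cdot>\<^bsub>C\<^esub> k = f \<cdot>\<^bsub>C\<^esub> k'" "ar F k = ar F k'"
  shows "k = k'"
  using cartesian_ex1[OF assms(1,2) dom.Comp_hom[OF assms(3,2)] ar_hom[OF assms(3)]]
    ar_Comp[OF assms(3,2)] assms(3-6)
  by metis

lemma cartesianI:
  assumes "f \<in> hom X y x"
    and "\<And>w g h. \<lbrakk>g \<in> hom X w x; h \<in> hom A (ob F w) (ob F y); ar F f \<cdot>\<^bsub>A\<^esub> h = ar F g\<rbrakk>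
      \<Longrightarrow> \<exists>k. k \<in> hom X w y \<and> f \<cdot>\<^bsub>X\<^esub> k = g \<and> ar F k = h"
    and "\<And>w k k'. \<lbrakk>k \<in> hom X w y; k' \<in> hom X w y; f \<cdot>\<^bsub>X\<^esub> k = f \<cdot>\<^bsub>X\<^esub> k'; ar F k = ar F k'\<rbrakk>
      \<Longrightarrow> k = k'"
  shows "cartesian X A F f"
  unfolding cartesian_def
proof (intro conjI ballI impI)
  show "f \<in> Arr X" using assms(1) by (simp add: hom_def)
  fix g h
  assume g: "g \<in> Arr X" "Cod X g = Cod X f"
    and h: "h \<in> hom A (ob F (Dom X g)) (ob F (Dom X f))" "ar F f \<cdot>\<^bsub>A\<^esub> h = ar F g"
  have f: "Dom X f = y" "Cod X f = x" using homD[OF assms(1)] by auto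
  have "g \<in> hom X (Dom X g) x" using g f by (simp add: hom_def)
  then have "\<exists>k. k \<in> hom X (Dom X g) y \<and> f \<cdot>\<^bsub>X\<^esub> k = g \<and> ar F k = h"
    using assms(2) h f by simp
  then show "\<exists>!k. k \<in> hom X (Dom X g) (Dom X f) \<and> f \<cdot>\<^bsub>X\<^esub> k = g \<and> ar F k = h"
    using assms(3) unfolding f by (intro ex_ex1I) auto
qed

lemma fibration_lift:
  assumes "fibration X A F" "\<alpha> \<in> Arr A" "x \<in> Obj X" "Cod A \<alpha> = ob F x"
  obtains f y where "cartesian X A F f" "ar F f = \<alpha>" "f \<in> hom X y x"
proof -
  obtain f where f: "cartesian_lifting X A F \<alpha> x f"
    using assms unfolding fibration_def by blast
  then have "f \<in> hom X (Dom X f) x"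
    by (simp add: cartesian_lifting_def cartesian_def hom_def)
  then show ?thesis using f that unfolding cartesian_lifting_def by blast
qed

text \<open>Cartesian liftings of the same arrow at the same object differ by an isomorphism, so
  it is enough to know about one of them that a functor over the base sends it to a cartesian
  arrow.\<close>

lemma cartesian_image_transfer:
  assumes F: "is_functor X A F" and G: "is_functor M A G" and P: "is_functor X M P"
    and GPo: "\<And>x. x \<in> Obj X \<Longrightarrow> ob G (ob P x) = ob F x"
    and GPa: "\<And>f. f \<in> Arr X \<Longrightarrow> ar G (ar P f) = ar F f"
    and f: "cartesian X A F f" "f \<in> hom X y x"
    and c: "cartesian X A F c" "c \<in> hom X z x" "ar F c = ar F f"
    and Pc: "cartesian M A G (ar P c)"
  shows "cartesian M A G (ar P f)"
proof -
  interpret F: is_functor X A F by fact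
  interpret G: is_functor M A G by fact
  interpret P: is_functor X M P by fact
  have Xo: "y \<in> Obj X" "x \<in> Obj X" "z \<in> Obj X" using f c F.dom.hom_Obj by auto
  have Ff: "ar F f \<in> hom A (ob F y) (ob F x)" by (rule F.ar_hom[OF f(2)])
  have yz: "ob F z = ob F y" using F.ar_hom[OF c(2)] Ff c(3) by (simp add: hom_def)
  let ?I = "Id A (ob F y)"
  have I: "?I \<in> hom A (ob F y) (ob F y)" "ar F f \<cdot>\<^bsub>A\<^esub> ?I = ar F f"
    using F.cod.Id_hom F.ob_Obj Xo(1) F.cod.Id_right[OF Ff] by auto
  obtain u where u: "u \<in> hom X y z" "c \<cdot>\<^bsub>X\<^esub> u = f" "ar F u = ?I"
    using cartesian_factor[OF c(1,2) f(2), of ?I] I c(3) yz by auto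
  obtain v where v: "v \<in> hom X z y" "f \<cdot>\<^bsub>X\<^esub> v = c" "ar F v = ?I"
    using cartesian_factor[OF f(1,2) c(2), of ?I] I c(3) yz by auto
  have uv: "u \<cdot>\<^bsub>X\<^esub> v \<in> hom X z z" by (rule F.dom.Comp_hom[OF v(1) u(1)])
  have "u \<cdot>\<^bsub>X\<^esub> v = Id X z"
  proof (rule F.cartesian_cancel[OF c(1,2) uv F.dom.Id_hom[OF Xo(3)]])
    show "c \<cdot>\<^bsub>X\<^esub> (u \<cdot>\<^bsub>X\<^esub> v) = c \<cdot>\<^bsub>X\<^esub> Id X z"
      using F.dom.assoc[OF v(1) u(1) c(2)] u v F.dom.Id_right[OF c(2)] by simp
    show "ar F (u \<cdot>\<^bsub>X\<^esub> v) = ar F (Id X z)"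
      using F.ar_Comp[OF v(1) u(1)] u v F.cod.Id_left[OF I(1)] F.ar_Id[OF Xo(3)] yz by simp
  qed
  then have Puv: "ar P u \<cdot>\<^bsub>M\<^esub> ar P v = Id M (ob P z)"
    using P.ar_Comp[OF v(1) u(1)] P.ar_Id[OF Xo(3)] by simp
  have vu: "v \<cdot>\<^bsub>X\<^esub> u \<in> hom X y y" by (rule F.dom.Comp_hom[OF u(1) v(1)])
  have "v \<cdot>\<^bsub>X\<^esub> u = Id X y"
  proof (rule F.cartesian_cancel[OF f vu F.dom.Id_hom[OF Xo(1)]])
    show "f \<cdot>\<^bsub>X\<^esub> (v \<cdot>\<^bsub>X\<^esub> u) = f \<cdot>\<^bsub>X\<^esub> Id X y"
      using F.dom.assoc[OF u(1) v(1) f(2)] u v F.dom.Id_right[OF f(2)] by simp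
    show "ar F (v \<cdot>\<^bsub>X\<^esub> u) = ar F (Id X y)"
      using F.ar_Comp[OF u(1) v(1)] u v F.cod.Id_left[OF I(1)] F.ar_Id[OF Xo(1)] by simp
  qed
  then have Pvu: "ar P v \<cdot>\<^bsub>M\<^esub> ar P u = Id M (ob P y)"
    using P.ar_Comp[OF u(1) v(1)] P.ar_Id[OF Xo(1)] by simp
  note Pf = P.ar_hom[OF f(2)] and Pch = P.ar_hom[OF c(2)]
    and Pu = P.ar_hom[OF u(1)] and Pv = P.ar_hom[OF v(1)]
  have GPuv: "ar G (ar P u) = ?I" "ar G (ar P v) = ?I" "ar G (ar P f) = ar F f"
    "ar G (ar P c) = ar F f"
    using GPa u v f c homD(1) by metis+
  have GPyz: "ob G (ob P y) = ob F y" "ob G (ob P z) = ob F y" using GPo Xo yz by auto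
  have Pcu: "ar P c \<cdot>\<^bsub>M\<^esub> ar P u = ar P f" using P.ar_Comp[OF u(1) c(2)] u by simp
  have Pfv: "ar P f \<cdot>\<^bsub>M\<^esub> ar P v = ar P c" using P.ar_Comp[OF v(1) f(2)] v by simp
  show ?thesis
  proof (rule cartesianI[OF Pf])
    fix w g h
    assume g: "g \<in> hom M w (ob P x)" and h: "h \<in> hom A (ob G w) (ob G (ob P y))"
      and gh: "ar G (ar P f) \<cdot>\<^bsub>A\<^esub> h = ar G g"
    obtain k where k: "k \<in> hom M w (ob P z)" "ar P c \<cdot>\<^bsub>M\<^esub> k = g" "ar G k = h"
      using cartesian_factor[OF Pc Pch g, of h] h gh GPuv GPyz by auto
    have "ar P f \<cdot>\<^bsub>M\<^esub> (ar P v \<cdot>\<^bsub>M\<^esub> k) = g"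
      using G.dom.assoc[OF k(1) Pv Pf] Pfv k by simp
    moreover have "ar G (ar P v \<cdot>\<^bsub>M\<^esub> k) = h"
      using G.ar_Comp[OF k(1) Pv] GPuv k F.cod.Id_left h GPyz by simp
    ultimately show "\<exists>k. k \<in> hom M w (ob P y) \<and> ar P f \<cdot>\<^bsub>M\<^esub> k = g \<and> ar G k = h"
      using G.dom.Comp_hom[OF k(1) Pv] by blast
  next
    fix w k k'
    assume k: "k \<in> hom M w (ob P y)" "k' \<in> hom M w (ob P y)"
      and fk: "ar P f \<cdot>\<^bsub>M\<^esub> k = ar P f \<cdot>\<^bsub>M\<^esub> k'" and Gk: "ar G k = ar G k'"
    have "ar P u \<cdot>\<^bsub>M\<^esub> k = ar P u \<cdot>\<^bsub>M\<^esub> k'"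
    proof (rule G.cartesian_cancel[OF Pc Pch])
      show "ar P u \<cdot>\<^bsub>M\<^esub> k \<in> hom M w (ob P z)" "ar P u \<cdot>\<^bsub>M\<^esub> k' \<in> hom M w (ob P z)"
        using G.dom.Comp_hom k Pu by blast+
      show "ar P c \<cdot>\<^bsub>M\<^esub> (ar P u \<cdot>\<^bsub>M\<^esub> k) = ar P c \<cdot>\<^bsub>M\<^esub> (ar P u \<cdot>\<^bsub>M\<^esub> k')"
        using G.dom.assoc[OF k(1) Pu Pch] G.dom.assoc[OF k(2) Pu Pch] Pcu fk by simp
      show "ar G (ar P u \<cdot>\<^bsub>M\<^esub> k) = ar G (ar P u \<cdot>\<^bsub>M\<^esub> k')"
        using G.ar_Comp[OF k(1) Pu] G.ar_Comp[OF k(2) Pu] Gk by simp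
    qed
    then have "(ar P v \<cdot>\<^bsub>M\<^esub> ar P u) \<cdot>\<^bsub>M\<^esub> k = (ar P v \<cdot>\<^bsub>M\<^esub> ar P u) \<cdot>\<^bsub>M\<^esub> k'"
      using G.dom.assoc[OF k(1) Pu Pv] G.dom.assoc[OF k(2) Pu Pv] by simp
    then show "k = k'" using Pvu G.dom.Id_left[OF k(1)] G.dom.Id_left[OF k(2)] by simp
  qed
qed

section \<open>Comma objects are fibrations\<close>

locale comma_cospan =
  fixes A :: "('p, 'b) category" and X :: "('o, 'a) category" and F :: "('o, 'a, 'p, 'b) func"
    and Y :: "('q, 'c) category" and K :: "('q, 'c, 'p, 'b) func"
    and Z :: "('r, 'd) category" and H :: "('r, 'd, 'p, 'b) func"
    and S :: "('o, 'a, 'r, 'd) func" and T :: "('q, 'c, 'r, 'd) func"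
  assumes S_1cell: "fib_1cell A X F Z H S" and T_1cell: "fib_1cell A Y K Z H T"

sublocale comma_cospan \<subseteq> F: is_functor X A F
  using S_1cell by (simp add: fib_1cell_def fibration_def)
sublocale comma_cospan \<subseteq> K: is_functor Y A K
  using T_1cell by (simp add: fib_1cell_def fibration_def)
sublocale comma_cospan \<subseteq> H: is_functor Z A H
  using S_1cell by (simp add: fib_1cell_def fibration_def)
sublocale comma_cospan \<subseteq> S: is_functor X Z S
  using S_1cell by (simp add: fib_1cell_def)
sublocale comma_cospan \<subseteq> T: is_functor Y Z T
  using T_1cell by (simp add: fib_1cell_def)

context comma_cospan
begin

abbreviation "CC \<equiv> comma A X F Y Z H S T"

lemma HS: "x \<in> Obj X \<Longrightarrow> ob H (ob S x) = ob F x" "f \<in> Arr X \<Longrightarrow> ar H (ar S f) = ar F f"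
  using S_1cell by (auto simp: fib_1cell_def)

lemma HT: "y \<in> Obj Y \<Longrightarrow> ob H (ob T y) = ob K y" "g \<in> Arr Y \<Longrightarrow> ar H (ar T g) = ar K g"
  using T_1cell by (auto simp: fib_1cell_def)

lemma comma_Obj:
  "(x, \<nu>, y) \<in> Obj CC \<longleftrightarrow> x \<in> Obj X \<and> y \<in> Obj Y \<and>
     \<nu> \<in> hom Z (ob S x) (ob T y) \<and> ar H \<nu> = Id A (ob F x)"
  by (simp add: comma_def Let_def)

lemma comma_hom:
  "u \<in> hom CC (x, \<nu>, y) (x', \<nu>', y') \<longleftrightarrow>
     (x, \<nu>, y) \<in> Obj CC \<and> (x', \<nu>', y') \<in> Obj CC \<and>
     (\<exists>f g. u = ((x, \<nu>, y), (f, g), (x', \<nu>', y')) \<and> f \<in> hom X x x' \<and> g \<in> hom Y y y' \<and>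
        ar T g \<cdot>\<^bsub>Z\<^esub> \<nu> = \<nu>' \<cdot>\<^bsub>Z\<^esub> ar S f)"
  by (auto simp: comma_def Let_def hom_def)

lemma comma_Arr:
  "u \<in> Arr CC \<longleftrightarrow> (\<exists>x \<nu> y x' \<nu>' y'. u \<in> hom CC (x, \<nu>, y) (x', \<nu>', y'))"
  unfolding hom_def by (auto simp: comma_def Let_def)

lemma comma_Dom [simp]: "Dom CC (s, fg, t) = s"
  and comma_Cod [simp]: "Cod CC (s, fg, t) = t"
  and comma_Id [simp]: "Id CC (x, \<nu>, y) = ((x, \<nu>, y), (Id X x, Id Y y), (x, \<nu>, y))"
  and comma_Comp [simp]: "(t', (f', g'), t) \<cdot>\<^bsub>CC\<^esub> (s, (f, g), s') =
    (s, (f' \<cdot>\<^bsub>X\<^esub> f, g' \<cdot>\<^bsub>Y\<^esub> g), t)"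
  by (simp_all add: comma_def Let_def)

lemma comma_category: "category CC"
proof
  fix u assume "u \<in> Arr CC"
  then show "Dom CC u \<in> Obj CC" "Cod CC u \<in> Obj CC" by (auto simp: comma_Arr comma_hom)
next
  fix s assume "s \<in> Obj CC"
  then obtain x \<nu> y where s: "s = (x, \<nu>, y)" "(x, \<nu>, y) \<in> Obj CC" by (cases s) auto
  then have o: "x \<in> Obj X" "y \<in> Obj Y" and \<nu>: "\<nu> \<in> hom Z (ob S x) (ob T y)"
    by (auto simp: comma_Obj)
  have "ar T (Id Y y) \<cdot>\<^bsub>Z\<^esub> \<nu> = \<nu> \<cdot>\<^bsub>Z\<^esub> ar S (Id X x)"
    using S.ar_Id[OF o(1)] T.ar_Id[OF o(2)] H.dom.Id_left[OF \<nu>] H.dom.Id_right[OF \<nu>] by simp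
  then show "Id CC s \<in> hom CC s s"
    using s o F.dom.Id_hom K.dom.Id_hom by (auto simp: comma_hom)
next
  fix u v s t r assume uv: "u \<in> hom CC s t" "v \<in> hom CC t r"
  obtain x \<nu> y where s: "s = (x, \<nu>, y)" by (cases s)
  obtain x' \<nu>' y' where t: "t = (x', \<nu>', y')" by (cases t)
  obtain x'' \<nu>'' y'' where r: "r = (x'', \<nu>'', y'')" by (cases r)
  note str = s t r
  obtain f g where u: "u = (s, (f, g), t)" "s \<in> Obj CC" "t \<in> Obj CC"
    "f \<in> hom X x x'" "g \<in> hom Y y y'" "ar T g \<cdot>\<^bsub>Z\<^esub> \<nu> = \<nu>' \<cdot>\<^bsub>Z\<^esub> ar S f"
    using uv(1) unfolding str comma_hom by auto
  obtain f' g' where v: "v = (t, (f', g'), r)" "r \<in> Obj CC"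
    "f' \<in> hom X x' x''" "g' \<in> hom Y y' y''" "ar T g' \<cdot>\<^bsub>Z\<^esub> \<nu>' = \<nu>'' \<cdot>\<^bsub>Z\<^esub> ar S f'"
    using uv(2) unfolding str comma_hom by auto
  have \<nu>: "\<nu> \<in> hom Z (ob S x) (ob T y)" "\<nu>' \<in> hom Z (ob S x') (ob T y')"
    "\<nu>'' \<in> hom Z (ob S x'') (ob T y'')"
    using u v unfolding str comma_Obj by auto
  note hS = S.ar_hom[OF u(4)] S.ar_hom[OF v(3)] and hT = T.ar_hom[OF u(5)] T.ar_hom[OF v(4)]
  have "ar T (g' \<cdot>\<^bsub>Y\<^esub> g) \<cdot>\<^bsub>Z\<^esub> \<nu> = ar T g' \<cdot>\<^bsub>Z\<^esub> (\<nu>' \<cdot>\<^bsub>Z\<^esub> ar S f)"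
    using T.ar_Comp[OF u(5) v(4)] H.dom.assoc[OF \<nu>(1) hT] u(6) by simp
  also have "\<dots> = (\<nu>'' \<cdot>\<^bsub>Z\<^esub> ar S f') \<cdot>\<^bsub>Z\<^esub> ar S f"
    using H.dom.assoc[OF hS(1) \<nu>(2) hT(2)] v(5) by simp
  also have "\<dots> = \<nu>'' \<cdot>\<^bsub>Z\<^esub> ar S (f' \<cdot>\<^bsub>X\<^esub> f)"
    using S.ar_Comp[OF u(4) v(3)] H.dom.assoc[OF hS \<nu>(3)] by simp
  finally have "(s, (f' \<cdot>\<^bsub>X\<^esub> f, g' \<cdot>\<^bsub>Y\<^esub> g), r) \<in> hom CC s r"
    using u(2) v(2) F.dom.Comp_hom[OF u(4) v(3)] K.dom.Comp_hom[OF u(5) v(4)]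
    unfolding str comma_hom by blast
  then show "v \<cdot>\<^bsub>CC\<^esub> u \<in> hom CC s r" unfolding u(1) v(1) comma_Comp .
next
  fix u s t assume u: "u \<in> hom CC s t"
  obtain x \<nu> y where s: "s = (x, \<nu>, y)" by (cases s)
  obtain x' \<nu>' y' where t: "t = (x', \<nu>', y')" by (cases t)
  note st = s t
  obtain f g where fg: "u = (s, (f, g), t)" "f \<in> hom X x x'" "g \<in> hom Y y y'"
    using u unfolding st comma_hom by auto
  show "Id CC t \<cdot>\<^bsub>CC\<^esub> u = u"
    using F.dom.Id_left[OF fg(2)] K.dom.Id_left[OF fg(3)] by (simp add: fg(1) st)
  show "u \<cdot>\<^bsub>CC\<^esub> Id CC s = u"
    using F.dom.Id_right[OF fg(2)] K.dom.Id_right[OF fg(3)] by (simp add: fg(1) st)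
next
  fix u v w r s t q assume "u \<in> hom CC q r" "v \<in> hom CC r s" "w \<in> hom CC s t"
  then show "w \<cdot>\<^bsub>CC\<^esub> (v \<cdot>\<^bsub>CC\<^esub> u) = (w \<cdot>\<^bsub>CC\<^esub> v) \<cdot>\<^bsub>CC\<^esub> u"
    by (cases q; cases r; cases s; cases t) (auto simp: comma_hom F.dom.assoc K.dom.assoc)
qed

lemma comma_base_functor: "is_functor CC A (comma_base F)"
proof -
  interpret CC: category CC by (rule comma_category)
  show ?thesis
  proof
    fix s assume "s \<in> Obj CC"
    then show "ob (comma_base F) s \<in> Obj A"
      "ar (comma_base F) (Id CC s) = Id A (ob (comma_base F) s)"
      by (cases s; auto simp: comma_Obj comma_base_def F.ob_Obj F.ar_Id)+
  next
    fix u s t assume "u \<in> hom CC s t"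
    then show "ar (comma_base F) u \<in> hom A (ob (comma_base F) s) (ob (comma_base F) t)"
      by (cases s; cases t; auto simp: comma_hom comma_base_def F.ar_hom)
  next
    fix u v s t r assume "u \<in> hom CC s t" "v \<in> hom CC t r"
    then show "ar (comma_base F) (v \<cdot>\<^bsub>CC\<^esub> u) = ar (comma_base F) v \<cdot>\<^bsub>A\<^esub> ar (comma_base F) u"
      by (cases s; cases t; cases r; auto simp: comma_hom comma_base_def F.ar_Comp)
  qed
qed

lemma comma_legs_same_object:
  assumes "(x, \<nu>, y) \<in> Obj CC"
  shows "ob K y = ob F x"
proof -
  have o: "x \<in> Obj X" "y \<in> Obj Y" "\<nu> \<in> hom Z (ob S x) (ob T y)" "ar H \<nu> = Id A (ob F x)"
    using assms by (auto simp: comma_Obj)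
  then show ?thesis
    using H.ar_hom[OF o(3)] HS HT F.cod.Id_hom[OF F.ob_Obj[OF o(1)]] by (auto simp: hom_def)
qed

lemma comma_legs_same_arrow:
  assumes u: "((x, \<nu>, y), (f, g), (x', \<nu>', y')) \<in> hom CC (x, \<nu>, y) (x', \<nu>', y')"
  shows "ar K g = ar F f"
proof -
  have o: "(x, \<nu>, y) \<in> Obj CC" "(x', \<nu>', y') \<in> Obj CC" "f \<in> hom X x x'" "g \<in> hom Y y y'"
    and sq: "ar T g \<cdot>\<^bsub>Z\<^esub> \<nu> = \<nu>' \<cdot>\<^bsub>Z\<^esub> ar S f"
    using u by (auto simp: comma_hom)
  have \<nu>: "\<nu> \<in> hom Z (ob S x) (ob T y)" "\<nu>' \<in> hom Z (ob S x') (ob T y')"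
    and H\<nu>: "ar H \<nu> = Id A (ob F x)" "ar H \<nu>' = Id A (ob F x')"
    using o by (auto simp: comma_Obj)
  have K: "ar K g \<in> hom A (ob F x) (ob F x')"
    using K.ar_hom[OF o(4)] comma_legs_same_object o by auto
  have "ar H (ar T g \<cdot>\<^bsub>Z\<^esub> \<nu>) = ar K g"
    using H.ar_Comp[OF \<nu>(1) T.ar_hom[OF o(4)]] H\<nu> HT homD(1)[OF o(4)] F.cod.Id_right[OF K] by simp
  moreover have "ar H (\<nu>' \<cdot>\<^bsub>Z\<^esub> ar S f) = ar F f"
    using H.ar_Comp[OF S.ar_hom[OF o(3)] \<nu>(2)] H\<nu> HS homD(1)[OF o(3)]
      F.cod.Id_left[OF F.ar_hom[OF o(3)]] by simp
  ultimately show ?thesis using sq by simp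
qed

text \<open>Cartesian liftings are computed on both legs. That \<open>T\<close> preserves cartesian arrows gives
  the connecting arrow \<open>\<nu>'\<close> of the lifted triple, and it also makes the induced squares commute,
  since they do so after composing with a cartesian arrow.\<close>

lemma comma_fibration: "fibration CC A (comma_base F)"
  unfolding fibration_def
proof (intro conjI ballI impI)
  show "is_functor CC A (comma_base F)" by (rule comma_base_functor)
  fix \<alpha> s assume \<alpha>: "\<alpha> \<in> Arr A" and s: "s \<in> Obj CC" and \<alpha>s: "Cod A \<alpha> = ob (comma_base F) s"
  obtain x \<nu> y where xy: "s = (x, \<nu>, y)" by (cases s)
  have o: "x \<in> Obj X" "y \<in> Obj Y" "\<nu> \<in> hom Z (ob S x) (ob T y)" "ar H \<nu> = Id A (ob F x)"
    using s by (auto simp: xy comma_Obj)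
  have Ky: "ob K y = ob F x" using s comma_legs_same_object by (simp add: xy)
  have \<alpha>x: "Cod A \<alpha> = ob F x" using \<alpha>s by (simp add: xy comma_base_def)
  obtain f x' where f: "cartesian X A F f" "ar F f = \<alpha>" and fh: "f \<in> hom X x' x"
    by (rule fibration_lift[OF _ \<alpha> o(1) \<alpha>x]) (use S_1cell in \<open>auto simp: fib_1cell_def\<close>)
  obtain g y' where g: "cartesian Y A K g" "ar K g = \<alpha>" and gh: "g \<in> hom Y y' y"
    by (rule fibration_lift[OF _ \<alpha> o(2)]) (use T_1cell \<alpha>x Ky in \<open>auto simp: fib_1cell_def\<close>)
  have o': "x' \<in> Obj X" "y' \<in> Obj Y" using fh gh F.dom.hom_Obj K.dom.hom_Obj by auto
  have Fx': "ob F x' = Dom A \<alpha>" "ob K y' = Dom A \<alpha>"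
    using F.ar_hom[OF fh] K.ar_hom[OF gh] f g by (auto simp: hom_def)
  have Tg: "cartesian Z A H (ar T g)" using T_1cell g by (simp add: fib_1cell_def)
  note Sfh = S.ar_hom[OF fh] and Tgh = T.ar_hom[OF gh]
  have \<nu>f: "\<nu> \<cdot>\<^bsub>Z\<^esub> ar S f \<in> hom Z (ob S x') (ob T y)" by (rule H.dom.Comp_hom[OF Sfh o(3)])
  have \<alpha>h: "\<alpha> \<in> hom A (ob F x') (ob F x)" using F.ar_hom[OF fh] f by simp
  have H\<nu>f: "ar H (\<nu> \<cdot>\<^bsub>Z\<^esub> ar S f) = \<alpha>"
    using H.ar_Comp[OF Sfh o(3)] o HS f homD(1)[OF fh] F.cod.Id_left[OF \<alpha>h] by simp
  have Ix': "Id A (ob F x') \<in> hom A (ob H (ob S x')) (ob H (ob T y'))"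
    using F.cod.Id_hom[OF F.ob_Obj[OF o'(1)]] HS(1)[OF o'(1)] HT(1)[OF o'(2)] Fx' by simp
  have HTg: "ar H (ar T g) = \<alpha>" using HT g homD(1)[OF gh] by simp
  obtain \<nu>' where \<nu>': "\<nu>' \<in> hom Z (ob S x') (ob T y')" "ar T g \<cdot>\<^bsub>Z\<^esub> \<nu>' = \<nu> \<cdot>\<^bsub>Z\<^esub> ar S f"
    "ar H \<nu>' = Id A (ob F x')"
    using cartesian_factor[OF Tg Tgh \<nu>f Ix'] H\<nu>f HTg F.cod.Id_right[OF \<alpha>h] by auto
  define s' where "s' = (x', \<nu>', y')"
  define c where "c = (s', (f, g), s)"
  have s': "s' \<in> Obj CC" using o' \<nu>' by (simp add: s'_def comma_Obj)
  have ch: "c \<in> hom CC s' s"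
    using s s' fh gh \<nu>' by (simp add: c_def s'_def xy comma_hom)
  have "cartesian CC A (comma_base F) c"
  proof (rule cartesianI[OF ch])
    fix r u h
    assume u: "u \<in> hom CC r s" and h: "h \<in> hom A (ob (comma_base F) r) (ob (comma_base F) s')"
      and uh: "ar (comma_base F) c \<cdot>\<^bsub>A\<^esub> h = ar (comma_base F) u"
    obtain x1 \<nu>1 y1 where r: "r = (x1, \<nu>1, y1)" by (cases r)
    obtain f1 g1 where fg1: "u = (r, (f1, g1), s)" "f1 \<in> hom X x1 x" "g1 \<in> hom Y y1 y"
      "ar T g1 \<cdot>\<^bsub>Z\<^esub> \<nu>1 = \<nu> \<cdot>\<^bsub>Z\<^esub> ar S f1" and rO: "r \<in> Obj CC"
      using u unfolding r xy comma_hom by auto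
    have o1: "x1 \<in> Obj X" "y1 \<in> Obj Y" "\<nu>1 \<in> hom Z (ob S x1) (ob T y1)"
      "ar H \<nu>1 = Id A (ob F x1)"
      using rO by (auto simp: r comma_Obj)
    have Ky1: "ob K y1 = ob F x1" using rO comma_legs_same_object by (simp add: r)
    have Kg1: "ar K g1 = ar F f1" using u comma_legs_same_arrow by (simp add: r xy fg1)
    have hh: "h \<in> hom A (ob F x1) (ob F x')" using h by (simp add: r s'_def comma_base_def)
    have \<alpha>hh: "\<alpha> \<cdot>\<^bsub>A\<^esub> h = ar F f1" using uh f by (simp add: c_def fg1 comma_base_def)
    obtain k where k: "k \<in> hom X x1 x'" "f \<cdot>\<^bsub>X\<^esub> k = f1" "ar F k = h"
      using cartesian_factor[OF f(1) fh fg1(2) hh] \<alpha>hh f by auto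
    obtain l where l: "l \<in> hom Y y1 y'" "g \<cdot>\<^bsub>Y\<^esub> l = g1" "ar K l = h"
      using cartesian_factor[OF g(1) gh fg1(3), of h] hh \<alpha>hh g Ky1 Kg1 Fx' by auto
    note Skh = S.ar_hom[OF k(1)] and Tlh = T.ar_hom[OF l(1)]
    have "ar T l \<cdot>\<^bsub>Z\<^esub> \<nu>1 = \<nu>' \<cdot>\<^bsub>Z\<^esub> ar S k"
    proof (rule H.cartesian_cancel[OF Tg Tgh])
      show "ar T l \<cdot>\<^bsub>Z\<^esub> \<nu>1 \<in> hom Z (ob S x1) (ob T y')" by (rule H.dom.Comp_hom[OF o1(3) Tlh])
      show "\<nu>' \<cdot>\<^bsub>Z\<^esub> ar S k \<in> hom Z (ob S x1) (ob T y')" by (rule H.dom.Comp_hom[OF Skh \<nu>'(1)])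
      have "ar T g \<cdot>\<^bsub>Z\<^esub> (ar T l \<cdot>\<^bsub>Z\<^esub> \<nu>1) = \<nu> \<cdot>\<^bsub>Z\<^esub> ar S f1"
        using H.dom.assoc[OF o1(3) Tlh Tgh] T.ar_Comp[OF l(1) gh] l fg1 by simp
      also have "\<dots> = ar T g \<cdot>\<^bsub>Z\<^esub> (\<nu>' \<cdot>\<^bsub>Z\<^esub> ar S k)"
        using H.dom.assoc[OF Skh \<nu>'(1) Tgh] H.dom.assoc[OF Skh Sfh o(3)] S.ar_Comp[OF k(1) fh]
          k \<nu>' by simp
      finally show "ar T g \<cdot>\<^bsub>Z\<^esub> (ar T l \<cdot>\<^bsub>Z\<^esub> \<nu>1) = ar T g \<cdot>\<^bsub>Z\<^esub> (\<nu>' \<cdot>\<^bsub>Z\<^esub> ar S k)" .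
      have "ar H (ar T l \<cdot>\<^bsub>Z\<^esub> \<nu>1) = h"
        using H.ar_Comp[OF o1(3) Tlh] o1 HT homD(1)[OF l(1)] l F.cod.Id_right[OF hh] by simp
      moreover have "ar H (\<nu>' \<cdot>\<^bsub>Z\<^esub> ar S k) = h"
        using H.ar_Comp[OF Skh \<nu>'(1)] \<nu>' HS homD(1)[OF k(1)] k F.cod.Id_left[OF hh] by simp
      ultimately show "ar H (ar T l \<cdot>\<^bsub>Z\<^esub> \<nu>1) = ar H (\<nu>' \<cdot>\<^bsub>Z\<^esub> ar S k)" by simp
    qed
    then have "(r, (k, l), s') \<in> hom CC r s'"
      using rO s' k l by (simp add: r s'_def comma_hom)
    moreover have "c \<cdot>\<^bsub>CC\<^esub> (r, (k, l), s') = u" using k l by (simp add: c_def fg1)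
    moreover have "ar (comma_base F) (r, (k, l), s') = h" using k by (simp add: comma_base_def)
    ultimately show "\<exists>k. k \<in> hom CC r s' \<and> c \<cdot>\<^bsub>CC\<^esub> k = u \<and> ar (comma_base F) k = h" by blast
  next
    fix r u v
    assume uv: "u \<in> hom CC r s'" "v \<in> hom CC r s'" "c \<cdot>\<^bsub>CC\<^esub> u = c \<cdot>\<^bsub>CC\<^esub> v"
      and eq: "ar (comma_base F) u = ar (comma_base F) v"
    obtain x1 \<nu>1 y1 where r: "r = (x1, \<nu>1, y1)" by (cases r)
    obtain k l where u: "u = (r, (k, l), s')" "k \<in> hom X x1 x'" "l \<in> hom Y y1 y'"
      using uv(1) unfolding r s'_def comma_hom by auto
    obtain k' l' where v: "v = (r, (k', l'), s')" "k' \<in> hom X x1 x'" "l' \<in> hom Y y1 y'"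
      using uv(2) unfolding r s'_def comma_hom by auto
    have "ar K l = ar F k" "ar K l' = ar F k'"
      using uv u v comma_legs_same_arrow unfolding r s'_def by auto
    moreover have "ar F k = ar F k'" using eq by (simp add: u v comma_base_def)
    moreover have "f \<cdot>\<^bsub>X\<^esub> k = f \<cdot>\<^bsub>X\<^esub> k'" "g \<cdot>\<^bsub>Y\<^esub> l = g \<cdot>\<^bsub>Y\<^esub> l'" using uv(3) by (auto simp: u v c_def)
    ultimately show "u = v"
      using F.cartesian_cancel[OF f(1) fh u(2) v(2)] K.cartesian_cancel[OF g(1) gh u(3) v(3)]
      by (simp add: u v)
  qed
  moreover have "ar (comma_base F) c = \<alpha>" using f by (simp add: c_def comma_base_def)
  ultimately show "\<exists>c. cartesian_lifting CC A (comma_base F) \<alpha> s c"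
    using homD(3)[OF ch] unfolding cartesian_lifting_def by blast
qed

end

section \<open>Bijective functors over the base are adjoint equivalences with trivial unit and counit\<close>

lemma (in is_functor) inverse_functor:
  assumes bo: "bij_betw (ob F) (Obj C) (Obj D)" and ba: "bij_betw (ar F) (Arr C) (Arr D)"
  defines "L \<equiv> \<lparr>ob = inv_into (Obj C) (ob F), ar = inv_into (Arr C) (ar F)\<rparr>"
  shows "is_functor D C L"
    and "\<And>x. x \<in> Obj C \<Longrightarrow> ob L (ob F x) = x" and "\<And>y. y \<in> Obj D \<Longrightarrow> ob F (ob L y) = y"
    and "\<And>f. f \<in> Arr C \<Longrightarrow> ar L (ar F f) = f" and "\<And>g. g \<in> Arr D \<Longrightarrow> ar F (ar L g) = g"
proof -
  show LF: "ob L (ob F x) = x" if "x \<in> Obj C" for x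
    using bij_betw_inv_into_left[OF bo that] by (simp add: L_def)
  show FL: "ob F (ob L y) = y" if "y \<in> Obj D" for y
    using bij_betw_inv_into_right[OF bo that] by (simp add: L_def)
  show LFa: "ar L (ar F f) = f" if "f \<in> Arr C" for f
    using bij_betw_inv_into_left[OF ba that] by (simp add: L_def)
  show FLa: "ar F (ar L g) = g" if "g \<in> Arr D" for g
    using bij_betw_inv_into_right[OF ba that] by (simp add: L_def)
  have Lo: "ob L y \<in> Obj C" if "y \<in> Obj D" for y
    using inv_into_into[of y "ob F" "Obj C"] bo that by (simp add: L_def bij_betw_def)
  have La: "ar L g \<in> Arr C" if "g \<in> Arr D" for g
    using inv_into_into[of g "ar F" "Arr C"] ba that by (simp add: L_def bij_betw_def)
  have Lh: "ar L g \<in> hom C (ob L x) (ob L y)" if g: "g \<in> hom D x y" for g x y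
  proof -
    have gA: "g \<in> Arr D" using homD[OF g] by simp
    note h = Arr_hom[OF La[OF gA]]
    have "g \<in> hom D (ob F (Dom C (ar L g))) (ob F (Cod C (ar L g)))"
      using ar_hom[OF h] FLa[OF gA] by simp
    then have "x = ob F (Dom C (ar L g))" "y = ob F (Cod C (ar L g))" using g by (auto simp: hom_def)
    then have "ob L x = Dom C (ar L g)" "ob L y = Cod C (ar L g)"
      using LF dom.hom_Obj[OF h] by auto
    then show ?thesis using h by simp
  qed
  show "is_functor D C L"
  proof
    fix x assume x: "x \<in> Obj D"
    show "ob L x \<in> Obj C" by (rule Lo[OF x])
    have "ar F (Id C (ob L x)) = Id D x" using ar_Id[OF Lo[OF x]] FL[OF x] by simp
    then show "ar L (Id D x) = Id C (ob L x)"
      using LFa homD(1)[OF dom.Id_hom[OF Lo[OF x]]] by metis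
  next
    fix g x y assume "g \<in> hom D x y"
    then show "ar L g \<in> hom C (ob L x) (ob L y)" by (rule Lh)
  next
    fix g h x y z assume g: "g \<in> hom D x y" and h: "h \<in> hom D y z"
    have "ar F (ar L h \<cdot>\<^bsub>C\<^esub> ar L g) = h \<cdot>\<^bsub>D\<^esub> g"
      using ar_Comp[OF Lh[OF g] Lh[OF h]] FLa homD(1)[OF g] homD(1)[OF h] by simp
    then show "ar L (h \<cdot>\<^bsub>D\<^esub> g) = ar L h \<cdot>\<^bsub>C\<^esub> ar L g"
      using LFa homD(1)[OF dom.Comp_hom[OF Lh[OF g] Lh[OF h]]] by metis
  qed
qed

text \<open>An isomorphism of categories over the base transports every factorization problem back and
  forth, hence it preserves cartesian arrows.\<close>

lemma cartesian_of_inverse: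
  assumes F: "is_functor X A F" and R: "is_functor X Y R" and L: "is_functor Y X L"
    and LR: "\<And>x. x \<in> Obj X \<Longrightarrow> ob L (ob R x) = x" "\<And>f. f \<in> Arr X \<Longrightarrow> ar L (ar R f) = f"
    and RL: "\<And>y. y \<in> Obj Y \<Longrightarrow> ob R (ob L y) = y" "\<And>g. g \<in> Arr Y \<Longrightarrow> ar R (ar L g) = g"
    and Fo: "\<And>y. y \<in> Obj Y \<Longrightarrow> ob F (ob L y) = ob G y"
    and Fa: "\<And>g. g \<in> Arr Y \<Longrightarrow> ar F (ar L g) = ar G g"
    and f: "cartesian X A F f"
  shows "cartesian Y A G (ar R f)"
proof -
  interpret F: is_functor X A F by fact
  interpret R: is_functor X Y R by fact
  interpret L: is_functor Y X L by fact
  have fA: "f \<in> Arr X" using f by (simp add: cartesian_def)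
  note fh = Arr_hom[OF fA]
  have do: "Dom X f \<in> Obj X" "Cod X f \<in> Obj X" using F.dom.hom_Obj[OF fh] by auto
  note Rf = R.ar_hom[OF fh]
  have Gf: "ar G (ar R f) = ar F f" using Fa[OF homD(1)[OF Rf]] LR(2)[OF fA] by simp
  have Gd: "ob G (ob R (Dom X f)) = ob F (Dom X f)" using Fo[of "ob R (Dom X f)"] R.ob_Obj LR do by simp
  show ?thesis
  proof (rule cartesianI[OF Rf])
    fix w g h
    assume g: "g \<in> hom Y w (ob R (Cod X f))" and h: "h \<in> hom A (ob G w) (ob G (ob R (Dom X f)))"
      and gh: "ar G (ar R f) \<cdot>\<^bsub>A\<^esub> h = ar G g"
    have w: "w \<in> Obj Y" using R.cod.hom_Obj[OF g] by simp
    have Lg: "ar L g \<in> hom X (ob L w) (Cod X f)" using L.ar_hom[OF g] LR do by simp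
    have "h \<in> hom A (ob F (ob L w)) (ob F (Dom X f))" using h Fo[OF w] Gd by simp
    moreover have "ar F f \<cdot>\<^bsub>A\<^esub> h = ar F (ar L g)" using gh Gf Fa[OF homD(1)[OF g]] by simp
    ultimately obtain k where k: "k \<in> hom X (ob L w) (Dom X f)" "f \<cdot>\<^bsub>X\<^esub> k = ar L g" "ar F k = h"
      using cartesian_factor[OF f fh Lg] by blast
    have kR: "ar R k \<in> hom Y w (ob R (Dom X f))" using R.ar_hom[OF k(1)] RL w by simp
    moreover have "ar R f \<cdot>\<^bsub>Y\<^esub> ar R k = g"
      using R.ar_Comp[OF k(1) fh] k RL homD(1)[OF g] by simp
    moreover have "ar G (ar R k) = h"
      using Fa[OF homD(1)[OF kR]] LR(2)[OF homD(1)[OF k(1)]] k by simp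
    ultimately show "\<exists>k. k \<in> hom Y w (ob R (Dom X f)) \<and> ar R f \<cdot>\<^bsub>Y\<^esub> k = g \<and> ar G k = h" by blast
  next
    fix w k k'
    assume k: "k \<in> hom Y w (ob R (Dom X f))" and k': "k' \<in> hom Y w (ob R (Dom X f))"
      and fk: "ar R f \<cdot>\<^bsub>Y\<^esub> k = ar R f \<cdot>\<^bsub>Y\<^esub> k'" and Gk: "ar G k = ar G k'"
    have w: "w \<in> Obj Y" using R.cod.hom_Obj[OF k] by simp
    have Lk: "ar L k \<in> hom X (ob L w) (Dom X f)" "ar L k' \<in> hom X (ob L w) (Dom X f)"
      using L.ar_hom[OF k] L.ar_hom[OF k'] LR do by auto
    have e: "f \<cdot>\<^bsub>X\<^esub> ar L k = ar L (ar R f \<cdot>\<^bsub>Y\<^esub> k)" "f \<cdot>\<^bsub>X\<^esub> ar L k' = ar L (ar R f \<cdot>\<^bsub>Y\<^esub> k')"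
      using L.ar_Comp[OF k Rf] L.ar_Comp[OF k' Rf] LR fA by auto
    have Fk: "ar F (ar L k) = ar G k" "ar F (ar L k') = ar G k"
      using Fa homD(1)[OF k] homD(1)[OF k'] Gk by auto
    have "ar L k = ar L k'"
      using F.cartesian_cancel[OF f fh Lk] e fk Fk by simp
    then show "k = k'" using RL(2) homD(1)[OF k] homD(1)[OF k'] by metis
  qed
qed

lemma id_func_simps [simp]: "ob id_func x = x" "ar id_func f = f"
  by (simp_all add: id_func_def)

lemma fib_1cell_id:
  assumes "fibration X A F"
  shows "fib_1cell A X F X F id_func"
proof -
  interpret is_functor X A F using assms by (simp add: fibration_def)
  show ?thesis
    using assms dom.category_axioms
    unfolding fib_1cell_def is_functor_def is_functor_axioms_def by (auto simp: id_func_def)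
qed

lemma fib_1cell_comp:
  assumes S: "fib_1cell A X F Y G S" and T: "fib_1cell A Y G Z H T"
  shows "fib_1cell A X F Z H (comp_func T S)"
proof -
  interpret S: is_functor X Y S using S by (simp add: fib_1cell_def)
  interpret T: is_functor Y Z T using T by (simp add: fib_1cell_def)
  have "is_functor X Z (comp_func T S)"
  proof
    fix x assume "x \<in> Obj X"
    then show "ob (comp_func T S) x \<in> Obj Z"
      "ar (comp_func T S) (Id X x) = Id Z (ob (comp_func T S) x)"
      by (simp_all add: comp_func_def S.ob_Obj T.ob_Obj S.ar_Id T.ar_Id)
  next
    fix f x y assume f: "f \<in> hom X x y"
    show "ar (comp_func T S) f \<in> hom Z (ob (comp_func T S) x) (ob (comp_func T S) y)"
      using T.ar_hom[OF S.ar_hom[OF f]] by (simp add: comp_func_def)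
  next
    fix f g x y z assume f: "f \<in> hom X x y" and g: "g \<in> hom X y z"
    show "ar (comp_func T S) (g \<cdot>\<^bsub>X\<^esub> f) = ar (comp_func T S) g \<cdot>\<^bsub>Z\<^esub> ar (comp_func T S) f"
      using S.ar_Comp[OF f g] T.ar_Comp[OF S.ar_hom[OF f] S.ar_hom[OF g]]
      by (simp add: comp_func_def)
  qed
  moreover have "ob H (ob T (ob S x)) = ob F x" if "x \<in> Obj X" for x
    using S T S.ob_Obj[OF that] that by (simp add: fib_1cell_def)
  moreover have "ar H (ar T (ar S f)) = ar F f" if "f \<in> Arr X" for f
    using S T homD(1)[OF S.ar_hom[OF Arr_hom[OF that]]] that by (simp add: fib_1cell_def)
  ultimately show ?thesis
    using S T unfolding fib_1cell_def by (simp add: comp_func_def)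
qed

lemma fib_2cell_identity:
  assumes S: "fib_1cell A X F Y G S" and T: "fib_1cell A X F Y G T"
    and ob: "\<And>x. x \<in> Obj X \<Longrightarrow> ob T x = ob S x" and ar: "\<And>f. f \<in> Arr X \<Longrightarrow> ar T f = ar S f"
    and \<eta>: "\<And>x. x \<in> Obj X \<Longrightarrow> \<eta> x = Id Y (ob S x)"
  shows "fib_2cell A X F Y G S T \<eta>"
proof -
  interpret S: is_functor X Y S using S by (simp add: fib_1cell_def)
  interpret G: is_functor Y A G using S by (simp add: fib_1cell_def fibration_def)
  have "\<eta> x \<in> hom Y (ob S x) (ob T x)" if "x \<in> Obj X" for x
    using S.cod.Id_hom[OF S.ob_Obj[OF that]] ob \<eta> that by simp
  moreover have "\<eta> (Cod X f) \<cdot>\<^bsub>Y\<^esub> ar S f = ar T f \<cdot>\<^bsub>Y\<^esub> \<eta> (Dom X f)" if f: "f \<in> Arr X" for f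
    using \<eta>[OF S.dom.Cod_Obj[OF f]] \<eta>[OF S.dom.Dom_Obj[OF f]] ar[OF f]
      S.cod.Id_left[OF S.ar_hom[OF Arr_hom[OF f]]] S.cod.Id_right[OF S.ar_hom[OF Arr_hom[OF f]]]
    by simp
  moreover have "ar G (\<eta> x) = Id A (ob F x)" if "x \<in> Obj X" for x
    using \<eta>[OF that] G.ar_Id[OF S.ob_Obj[OF that]] S that by (simp add: fib_1cell_def)
  moreover have "is_functor X Y T" using T by (simp add: fib_1cell_def)
  ultimately show ?thesis
    using S T S.is_functor_axioms unfolding fib_2cell_def nat_trans_def by blast
qed

text \<open>The form in which an adjunction with identity unit and counit is produced: the left adjoint
  is the inverse functor, and then both triangle identities and both 2-cells are trivial.\<close>

lemma fib_adjunction_of_bijective: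
  assumes F: "fibration X A F" and G: "fibration Y A G" and R: "is_functor X Y R"
    and GRo: "\<And>x. x \<in> Obj X \<Longrightarrow> ob G (ob R x) = ob F x"
    and GRa: "\<And>f. f \<in> Arr X \<Longrightarrow> ar G (ar R f) = ar F f"
    and bo: "bij_betw (ob R) (Obj X) (Obj Y)" and ba: "bij_betw (ar R) (Arr X) (Arr Y)"
  shows "\<exists>L. fib_adjunction A X F Y G L R (Id Y) (Id X)"
proof -
  interpret F: is_functor X A F using F by (simp add: fibration_def)
  interpret G: is_functor Y A G using G by (simp add: fibration_def)
  interpret R: is_functor X Y R by fact
  define L where "L = \<lparr>ob = inv_into (Obj X) (ob R), ar = inv_into (Arr X) (ar R)\<rparr>"
  note inv = R.inverse_functor[OF bo ba, folded L_def]
  note LR = inv(2,4) and RL = inv(3,5)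
  interpret L: is_functor Y X L by (rule inv(1))
  have FLo: "ob F (ob L y) = ob G y" if "y \<in> Obj Y" for y
    using GRo[OF L.ob_Obj[OF that]] RL(1)[OF that] by simp
  have FLa: "ar F (ar L g) = ar G g" if "g \<in> Arr Y" for g
    using GRa[OF homD(1)[OF L.ar_hom[OF Arr_hom[OF that]]]] RL(2)[OF that] by simp
  have R1: "fib_1cell A X F Y G R"
    unfolding fib_1cell_def
    using F G R GRo GRa
      cartesian_of_inverse[OF F.is_functor_axioms R inv(1) LR RL FLo FLa] by blast
  have L1: "fib_1cell A Y G X F L"
    unfolding fib_1cell_def
    using F G inv(1) FLo FLa
      cartesian_of_inverse[OF G.is_functor_axioms inv(1) R RL LR GRo GRa] by blast
  have "fib_2cell A Y G Y G id_func (comp_func R L) (Id Y)"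
    by (rule fib_2cell_identity[OF fib_1cell_id[OF G] fib_1cell_comp[OF L1 R1]])
      (auto simp: id_func_def comp_func_def RL)
  moreover have "fib_2cell A X F X F (comp_func L R) id_func (Id X)"
    by (rule fib_2cell_identity[OF fib_1cell_comp[OF R1 L1] fib_1cell_id[OF F]])
      (auto simp: id_func_def comp_func_def LR)
  moreover have "Id X (ob L y) \<cdot>\<^bsub>X\<^esub> ar L (Id Y y) = Id X (ob L y)" if y: "y \<in> Obj Y" for y
    using F.dom.Id_left[OF F.dom.Id_hom[OF L.ob_Obj[OF y]]] L.ar_Id[OF y] by simp
  moreover have "ar R (Id X x) \<cdot>\<^bsub>Y\<^esub> Id Y (ob R x) = Id Y (ob R x)" if x: "x \<in> Obj X" for x
    using G.dom.Id_left[OF G.dom.Id_hom[OF R.ob_Obj[OF x]]] R.ar_Id[OF x] by simp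
  ultimately have "fib_adjunction A X F Y G L R (Id Y) (Id X)"
    unfolding fib_adjunction_def using R1 L1 by blast
  then show ?thesis by blast
qed

section \<open>Fiberwise discrete opfibrations\<close>

text \<open>A discrete opfibration between the fibers. Cartesian arrows reduce everything else to the
  fibers, so that this condition already makes \<open>r\<close> an isomorphism of the full comma categories.\<close>

locale fiberwise_discrete =
  fixes A :: "('p, 'b) category" and X :: "('o, 'a) category" and F :: "('o, 'a, 'p, 'b) func"
    and M :: "('q, 'c) category" and G :: "('q, 'c, 'p, 'b) func" and P :: "('o, 'a, 'q, 'c) func"
  assumes P_1cell: "fib_1cell A X F M G P"
    and ex1_lift: "\<lbrakk>x \<in> Obj X; \<beta> \<in> hom M (ob P x) m; ar G \<beta> = Id A (ob F x)\<rbrakk> \<Longrightarrow>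
      \<exists>!\<nu>. \<nu> \<in> Arr X \<and> Dom X \<nu> = x \<and> ar F \<nu> = Id A (ob F x) \<and> ar P \<nu> = \<beta>"

sublocale fiberwise_discrete \<subseteq> F: is_functor X A F
  using P_1cell by (simp add: fib_1cell_def fibration_def)
sublocale fiberwise_discrete \<subseteq> G: is_functor M A G
  using P_1cell by (simp add: fib_1cell_def fibration_def)
sublocale fiberwise_discrete \<subseteq> P: is_functor X M P
  using P_1cell by (simp add: fib_1cell_def)

context fiberwise_discrete
begin

lemma GPo: "x \<in> Obj X \<Longrightarrow> ob G (ob P x) = ob F x"
  and GPa: "f \<in> Arr X \<Longrightarrow> ar G (ar P f) = ar F f"
  and P_cartesian: "cartesian X A F f \<Longrightarrow> cartesian M A G (ar P f)"
  and F_fibration: "fibration X A F"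
  using P_1cell by (auto simp: fib_1cell_def)

lemma lift_unique:
  assumes "k \<in> hom X x y" "k' \<in> hom X x y'" "ar P k = ar P k'"
    "ar F k = Id A (ob F x)" "ar F k' = Id A (ob F x)"
  shows "k = k'"
proof -
  have "ar G (ar P k) = Id A (ob F x)" using GPa[OF homD(1)[OF assms(1)]] assms(4) by simp
  then show ?thesis
    using ex1_lift[OF F.dom.hom_Obj(1)[OF assms(1)] P.ar_hom[OF assms(1)]] assms
      homD[OF assms(1)] homD[OF assms(2)] by metis
qed

lemma vertical_same_object:
  assumes "k \<in> hom X x y" "ar F k = Id A (ob F x)"
  shows "ob F y = ob F x"
  using F.ar_hom[OF assms(1)] assms(2) F.cod.Id_hom[OF F.ob_Obj[OF F.dom.hom_Obj(1)[OF assms(1)]]]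
  by (simp add: hom_def)

text \<open>Two parallel arrows with the same image factor through one cartesian arrow. Since \<open>P\<close> preserves
  it, their vertical parts have the same image, hence are equal as liftings of the same arrow.\<close>

lemma P_faithful:
  assumes h: "h \<in> hom X y z" "h' \<in> hom X y z" and P: "ar P h = ar P h'"
  shows "h = h'"
proof -
  have Fh: "ar F h' = ar F h" using P GPa homD(1)[OF h(1)] homD(1)[OF h(2)] by metis
  note o = F.dom.hom_Obj[OF h(1)] and Fhh = F.ar_hom[OF h(1)]
  obtain c w where c: "cartesian X A F c" "ar F c = ar F h" and ch: "c \<in> hom X w z"
    by (rule fibration_lift[OF F_fibration homD(1)[OF Fhh] o(2) homD(3)[OF Fhh]])
  have w: "ob F w = ob F y" using F.ar_hom[OF ch] Fhh c by (simp add: hom_def)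
  have I: "Id A (ob F y) \<in> hom A (ob F y) (ob F w)" "ar F h \<cdot>\<^bsub>A\<^esub> Id A (ob F y) = ar F h"
    using F.cod.Id_hom[OF F.ob_Obj[OF o(1)]] F.cod.Id_right[OF Fhh] w by auto
  obtain k where k: "k \<in> hom X y w" "c \<cdot>\<^bsub>X\<^esub> k = h" "ar F k = Id A (ob F y)"
    using cartesian_factor[OF c(1) ch h(1) I(1)] I c by auto
  obtain k' where k': "k' \<in> hom X y w" "c \<cdot>\<^bsub>X\<^esub> k' = h'" "ar F k' = Id A (ob F y)"
    using cartesian_factor[OF c(1) ch h(2) I(1)] I c Fh by auto
  have "ar P k = ar P k'"
    using G.cartesian_cancel[OF P_cartesian[OF c(1)] P.ar_hom[OF ch] P.ar_hom[OF k(1)]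
        P.ar_hom[OF k'(1)]] P.ar_Comp[OF k(1) ch] P.ar_Comp[OF k'(1) ch] k k' P
      GPa homD(1)[OF k(1)] homD(1)[OF k'(1)] by simp
  then have "k = k'" using lift_unique k k' by blast
  then show ?thesis using k k' by simp
qed

text \<open>This makes \<open>r\<close> full. A cartesian lifting \<open>c : w \<rightarrow> y'\<close> of the common image of the square reduces
  \<open>g\<close> to its vertical part \<open>\<gamma>\<close>, which lifts to some \<open>\<nu>'' : y \<rightarrow> z\<close>. The point is that \<open>z = w\<close>: both
  \<open>\<nu>'' \<cdot> \<nu>\<close> and the vertical part of \<open>\<nu>' \<cdot> f\<close> lift the same arrow at \<open>x\<close>, so they coincide. Then
  \<open>c \<cdot> \<nu>''\<close> is the required arrow.\<close>

lemma lift_square: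
  assumes \<nu>: "\<nu> \<in> hom X x y" "ar F \<nu> = Id A (ob F x)"
    and \<nu>': "\<nu>' \<in> hom X x' y'" "ar F \<nu>' = Id A (ob F x')"
    and f: "f \<in> hom X x x'" and g: "g \<in> hom M (ob P y) (ob P y')"
    and sq: "g \<cdot>\<^bsub>M\<^esub> ar P \<nu> = ar P \<nu>' \<cdot>\<^bsub>M\<^esub> ar P f"
  obtains h where "h \<in> hom X y y'" "ar P h = g" "h \<cdot>\<^bsub>X\<^esub> \<nu> = \<nu>' \<cdot>\<^bsub>X\<^esub> f"
proof -
  note o = F.dom.hom_Obj[OF \<nu>(1)] and o' = F.dom.hom_Obj[OF \<nu>'(1)]
  have y: "ob F y = ob F x" and y': "ob F y' = ob F x'"
    using vertical_same_object \<nu> \<nu>' by auto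
  note Ff = F.ar_hom[OF f] and P\<nu> = P.ar_hom[OF \<nu>(1)] and P\<nu>' = P.ar_hom[OF \<nu>'(1)]
  have Gg: "ar G g \<in> hom A (ob F x) (ob F x')" using G.ar_hom[OF g] GPo o o' y y' by simp
  have "ar G (g \<cdot>\<^bsub>M\<^esub> ar P \<nu>) = ar G g"
    using G.ar_Comp[OF P\<nu> g] GPa[OF homD(1)[OF \<nu>(1)]] \<nu> F.cod.Id_right[OF Gg] by simp
  moreover have "ar G (ar P \<nu>' \<cdot>\<^bsub>M\<^esub> ar P f) = ar F f"
    using G.ar_Comp[OF P.ar_hom[OF f] P\<nu>'] GPa[OF homD(1)[OF \<nu>'(1)]] GPa[OF homD(1)[OF f]] \<nu>'
      F.cod.Id_left[OF Ff] by simp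
  ultimately have Ggf: "ar G g = ar F f" using sq by simp
  have \<nu>f: "\<nu>' \<cdot>\<^bsub>X\<^esub> f \<in> hom X x y'" "ar F (\<nu>' \<cdot>\<^bsub>X\<^esub> f) = ar F f"
    using F.dom.Comp_hom[OF f \<nu>'(1)] F.ar_Comp[OF f \<nu>'(1)] \<nu>' F.cod.Id_left[OF Ff] by auto
  have cod: "Cod A (ar F f) = ob F y'" using homD(3)[OF Ff] y' by simp
  obtain c w where c: "cartesian X A F c" "ar F c = ar F f" and ch: "c \<in> hom X w y'"
    by (rule fibration_lift[OF F_fibration homD(1)[OF Ff] o'(2) cod])
  have w: "ob F w = ob F x" using F.ar_hom[OF ch] Ff c by (simp add: hom_def)
  have wO: "w \<in> Obj X" using F.dom.hom_Obj[OF ch] by simp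
  note Pc = P_cartesian[OF c(1)] P.ar_hom[OF ch]
  have GPc: "ar G (ar P c) = ar F f" using GPa[OF homD(1)[OF ch]] c by simp
  have I: "Id A (ob F x) \<in> hom A (ob F x) (ob F x)" "ar F f \<cdot>\<^bsub>A\<^esub> Id A (ob F x) = ar F f"
    using F.cod.Id_hom[OF F.ob_Obj[OF o(1)]] F.cod.Id_right[OF Ff] by auto
  obtain k where k: "k \<in> hom X x w" "c \<cdot>\<^bsub>X\<^esub> k = \<nu>' \<cdot>\<^bsub>X\<^esub> f" "ar F k = Id A (ob F x)"
    using cartesian_factor[OF c(1) ch \<nu>f(1), of "Id A (ob F x)"] I c \<nu>f w by auto
  obtain \<gamma> where \<gamma>: "\<gamma> \<in> hom M (ob P y) (ob P w)" "ar P c \<cdot>\<^bsub>M\<^esub> \<gamma> = g"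
    "ar G \<gamma> = Id A (ob F x)"
    using cartesian_factor[OF Pc g, of "Id A (ob F x)"] I GPc Ggf w y GPo o wO by auto
  note Pk = P.ar_hom[OF k(1)] and \<gamma>\<nu> = G.dom.Comp_hom[OF P\<nu> \<gamma>(1)]
  have "ar P k = \<gamma> \<cdot>\<^bsub>M\<^esub> ar P \<nu>"
  proof (rule G.cartesian_cancel[OF Pc Pk \<gamma>\<nu>])
    show "ar P c \<cdot>\<^bsub>M\<^esub> ar P k = ar P c \<cdot>\<^bsub>M\<^esub> (\<gamma> \<cdot>\<^bsub>M\<^esub> ar P \<nu>)"
      using P.ar_Comp[OF k(1) ch] P.ar_Comp[OF f \<nu>'(1)] k sq \<gamma>(2) G.dom.assoc[OF P\<nu> \<gamma>(1) Pc(2)]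
      by simp
    show "ar G (ar P k) = ar G (\<gamma> \<cdot>\<^bsub>M\<^esub> ar P \<nu>)"
      using GPa[OF homD(1)[OF k(1)]] GPa[OF homD(1)[OF \<nu>(1)]] k \<nu> \<gamma> G.ar_Comp[OF P\<nu> \<gamma>(1)]
        F.cod.Id_left[OF I(1)] by simp
  qed
  have "\<exists>\<nu>''. \<nu>'' \<in> Arr X \<and> Dom X \<nu>'' = y \<and> ar F \<nu>'' = Id A (ob F y) \<and> ar P \<nu>'' = \<gamma>"
    using ex1_lift[OF o(2) \<gamma>(1)] \<gamma>(3) y by auto
  then obtain \<nu>'' z where l: "\<nu>'' \<in> hom X y z" "ar F \<nu>'' = Id A (ob F x)" "ar P \<nu>'' = \<gamma>"
    using y by (auto simp: hom_def)
  note l\<nu> = F.dom.Comp_hom[OF \<nu>(1) l(1)]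
  have "\<nu>'' \<cdot>\<^bsub>X\<^esub> \<nu> = k"
  proof (rule lift_unique[OF l\<nu> k(1)])
    show "ar P (\<nu>'' \<cdot>\<^bsub>X\<^esub> \<nu>) = ar P k" using P.ar_Comp[OF \<nu>(1) l(1)] l \<open>ar P k = _\<close> by simp
    show "ar F (\<nu>'' \<cdot>\<^bsub>X\<^esub> \<nu>) = Id A (ob F x)"
      using F.ar_Comp[OF \<nu>(1) l(1)] l \<nu> F.cod.Id_left[OF I(1)] by simp
  qed (rule k(3))
  moreover from this have "z = w" using homD(3)[OF l\<nu>] homD(3)[OF k(1)] by simp
  ultimately have l': "\<nu>'' \<in> hom X y w" "\<nu>'' \<cdot>\<^bsub>X\<^esub> \<nu> = k" using l by auto
  show ?thesis
  proof (rule that)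
    show "c \<cdot>\<^bsub>X\<^esub> \<nu>'' \<in> hom X y y'" by (rule F.dom.Comp_hom[OF l'(1) ch])
    show "ar P (c \<cdot>\<^bsub>X\<^esub> \<nu>'') = g" using P.ar_Comp[OF l'(1) ch] l \<gamma> by simp
    show "(c \<cdot>\<^bsub>X\<^esub> \<nu>'') \<cdot>\<^bsub>X\<^esub> \<nu> = \<nu>' \<cdot>\<^bsub>X\<^esub> f"
      using F.dom.assoc[OF \<nu>(1) l'(1) ch] l' k by simp
  qed
qed


abbreviation "XX \<equiv> comma A X F X X F id_func id_func"
abbreviation "PM \<equiv> comma A X F M M G P id_func"

lemma G_fibration: "fibration M A G"
  using P_1cell by (simp add: fib_1cell_def)

sublocale XX: comma_cospan A X F X F X F id_func id_func
  by unfold_locales (rule fib_1cell_id[OF F_fibration])+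

sublocale PM: comma_cospan A X F M G M G P id_func
  by unfold_locales (rule P_1cell fib_1cell_id[OF G_fibration])+

lemma XX_Obj: "(x, \<nu>, y) \<in> Obj XX \<longleftrightarrow> \<nu> \<in> hom X x y \<and> ar F \<nu> = Id A (ob F x)"
  using F.dom.hom_Obj by (auto simp: XX.comma_Obj)

lemma PM_Obj: "(x, \<beta>, m) \<in> Obj PM \<longleftrightarrow>
    x \<in> Obj X \<and> \<beta> \<in> hom M (ob P x) m \<and> ar G \<beta> = Id A (ob F x)"
  using G.dom.hom_Obj by (auto simp: PM.comma_Obj)

lemma XX_hom:
  "u \<in> hom XX (x, \<nu>, y) (x', \<nu>', y') \<longleftrightarrow>
     (x, \<nu>, y) \<in> Obj XX \<and> (x', \<nu>', y') \<in> Obj XX \<and>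
     (\<exists>f g. u = ((x, \<nu>, y), (f, g), (x', \<nu>', y')) \<and> f \<in> hom X x x' \<and> g \<in> hom X y y' \<and>
        g \<cdot>\<^bsub>X\<^esub> \<nu> = \<nu>' \<cdot>\<^bsub>X\<^esub> f)"
  unfolding XX.comma_hom by simp

lemma PM_hom:
  "u \<in> hom PM (x, \<beta>, m) (x', \<beta>', m') \<longleftrightarrow>
     (x, \<beta>, m) \<in> Obj PM \<and> (x', \<beta>', m') \<in> Obj PM \<and>
     (\<exists>f g. u = ((x, \<beta>, m), (f, g), (x', \<beta>', m')) \<and> f \<in> hom X x x' \<and> g \<in> hom M m m' \<and>
        g \<cdot>\<^bsub>M\<^esub> \<beta> = \<beta>' \<cdot>\<^bsub>M\<^esub> ar P f)"
  unfolding PM.comma_hom by simp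

lemma r_ob [simp]: "ob (comma_r P) (x, \<nu>, y) = (x, ar P \<nu>, ob P y)"
  and r_ar [simp]: "ar (comma_r P) (s, (f, g), t) =
    (ob (comma_r P) s, (f, ar P g), ob (comma_r P) t)"
  by (simp_all add: comma_r_def Let_def)

lemma r_Obj:
  assumes "(x, \<nu>, y) \<in> Obj XX"
  shows "(x, ar P \<nu>, ob P y) \<in> Obj PM"
proof -
  have \<nu>: "\<nu> \<in> hom X x y" "ar F \<nu> = Id A (ob F x)" using assms by (auto simp: XX_Obj)
  then show ?thesis
    using F.dom.hom_Obj(1)[OF \<nu>(1)] P.ar_hom[OF \<nu>(1)] GPa[OF homD(1)[OF \<nu>(1)]]
    unfolding PM_Obj by simp
qed

lemma r_hom:
  assumes u: "u \<in> hom XX s t"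
  shows "ar (comma_r P) u \<in> hom PM (ob (comma_r P) s) (ob (comma_r P) t)"
proof -
  obtain x \<nu> y where s: "s = (x, \<nu>, y)" by (cases s)
  obtain x' \<nu>' y' where t: "t = (x', \<nu>', y')" by (cases t)
  obtain f g where fg: "u = (s, (f, g), t)" "f \<in> hom X x x'" "g \<in> hom X y y'"
      "g \<cdot>\<^bsub>X\<^esub> \<nu> = \<nu>' \<cdot>\<^bsub>X\<^esub> f"
    and o: "(x, \<nu>, y) \<in> Obj XX" "(x', \<nu>', y') \<in> Obj XX"
    using u unfolding s t XX_hom by blast
  have \<nu>: "\<nu> \<in> hom X x y" "\<nu>' \<in> hom X x' y'" using o by (auto simp: XX_Obj)
  have "ar P g \<cdot>\<^bsub>M\<^esub> ar P \<nu> = ar P \<nu>' \<cdot>\<^bsub>M\<^esub> ar P f"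
    using P.ar_Comp[OF \<nu>(1) fg(3)] P.ar_Comp[OF fg(2) \<nu>(2)] fg(4) by simp
  then show ?thesis
    using r_Obj[OF o(1)] r_Obj[OF o(2)] fg(2) P.ar_hom[OF fg(3)]
    unfolding fg(1) s t r_ar r_ob PM_hom by blast
qed

lemma r_functor: "is_functor XX PM (comma_r P)"
proof -
  interpret XXc: category XX by (rule XX.comma_category)
  interpret PMc: category PM by (rule PM.comma_category)
  show ?thesis
  proof
    fix s assume s: "s \<in> Obj XX"
    obtain x \<nu> y where xy: "s = (x, \<nu>, y)" by (cases s)
    have y: "y \<in> Obj X" using s F.dom.hom_Obj unfolding xy XX_Obj by blast
    show "ob (comma_r P) s \<in> Obj PM" using r_Obj s by (simp add: xy)
    show "ar (comma_r P) (Id XX s) = Id PM (ob (comma_r P) s)"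
      by (simp add: xy P.ar_Id[OF y])
  next
    fix u s t assume "u \<in> hom XX s t"
    then show "ar (comma_r P) u \<in> hom PM (ob (comma_r P) s) (ob (comma_r P) t)" by (rule r_hom)
  next
    fix u v s t r assume u: "u \<in> hom XX s t" and v: "v \<in> hom XX t r"
    obtain x \<nu> y where s: "s = (x, \<nu>, y)" by (cases s)
    obtain x' \<nu>' y' where t: "t = (x', \<nu>', y')" by (cases t)
    obtain x'' \<nu>'' y'' where r: "r = (x'', \<nu>'', y'')" by (cases r)
    obtain f g where fg: "u = (s, (f, g), t)" "g \<in> hom X y y'"
      using u unfolding s t XX_hom by blast
    obtain f' g' where fg': "v = (t, (f', g'), r)" "g' \<in> hom X y' y''"
      using v unfolding r t XX_hom by blast
    show "ar (comma_r P) (v \<cdot>\<^bsub>XX\<^esub> u) = ar (comma_r P) v \<cdot>\<^bsub>PM\<^esub> ar (comma_r P) u"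
      using P.ar_Comp[OF fg(2) fg'(2)] by (simp add: fg(1) fg'(1))
  qed
qed

lemma r_bij_ob: "bij_betw (ob (comma_r P)) (Obj XX) (Obj PM)"
  unfolding bij_betw_def
proof
  show inj: "inj_on (ob (comma_r P)) (Obj XX)"
  proof (rule inj_onI)
    fix s t assume st: "s \<in> Obj XX" "t \<in> Obj XX" and e: "ob (comma_r P) s = ob (comma_r P) t"
    obtain x \<nu> y where s: "s = (x, \<nu>, y)" by (cases s)
    obtain x' \<nu>' y' where t: "t = (x', \<nu>', y')" by (cases t)
    have x': "x' = x" and P: "ar P \<nu> = ar P \<nu>'" using e by (auto simp: s t)
    have \<nu>: "\<nu> \<in> hom X x y" "\<nu>' \<in> hom X x y'" "ar F \<nu> = Id A (ob F x)" "ar F \<nu>' = Id A (ob F x)"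
      using st by (auto simp: s t x' XX_Obj)
    have "\<nu> = \<nu>'" using lift_unique \<nu> P by blast
    then show "s = t" using homD(3)[OF \<nu>(1)] homD(3)[OF \<nu>(2)] by (simp add: s t x')
  qed
  show "ob (comma_r P) ` Obj XX = Obj PM"
  proof
    show "ob (comma_r P) ` Obj XX \<subseteq> Obj PM" using r_Obj by auto
    show "Obj PM \<subseteq> ob (comma_r P) ` Obj XX"
    proof
      fix s assume sO: "s \<in> Obj PM"
      obtain x \<beta> m where s: "s = (x, \<beta>, m)" by (cases s)
      have x: "x \<in> Obj X" and \<beta>: "\<beta> \<in> hom M (ob P x) m" "ar G \<beta> = Id A (ob F x)"
        using sO unfolding s PM_Obj by auto
      obtain \<nu> where \<nu>: "\<nu> \<in> Arr X" "Dom X \<nu> = x" "ar F \<nu> = Id A (ob F x)" "ar P \<nu> = \<beta>"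
        using ex1_lift[OF x \<beta>] by blast
      have h: "\<nu> \<in> hom X x (Cod X \<nu>)" using \<nu> by (simp add: hom_def)
      have "ob P (Cod X \<nu>) = m" using P.ar_hom[OF h] \<beta> \<nu> by (simp add: hom_def)
      then have "s = ob (comma_r P) (x, \<nu>, Cod X \<nu>)" using \<nu> by (simp add: s)
      moreover have "(x, \<nu>, Cod X \<nu>) \<in> Obj XX" using h \<nu> by (simp add: XX_Obj)
      ultimately show "s \<in> ob (comma_r P) ` Obj XX" by blast
    qed
  qed
qed

lemma r_bij_ar: "bij_betw (ar (comma_r P)) (Arr XX) (Arr PM)"
  unfolding bij_betw_def
proof
  show "inj_on (ar (comma_r P)) (Arr XX)"
  proof (rule inj_onI)
    fix u v assume uv: "u \<in> Arr XX" "v \<in> Arr XX" and e: "ar (comma_r P) u = ar (comma_r P) v"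
    obtain x \<nu> y x' \<nu>' y' where u: "u \<in> hom XX (x, \<nu>, y) (x', \<nu>', y')"
      using uv unfolding XX.comma_Arr by blast
    obtain z \<mu> w z' \<mu>' w' where v: "v \<in> hom XX (z, \<mu>, w) (z', \<mu>', w')"
      using uv unfolding XX.comma_Arr by blast
    obtain f g where fg: "u = ((x, \<nu>, y), (f, g), (x', \<nu>', y'))" "g \<in> hom X y y'"
      and o: "(x, \<nu>, y) \<in> Obj XX" "(x', \<nu>', y') \<in> Obj XX"
      using u unfolding XX_hom by blast
    obtain f' g' where fg': "v = ((z, \<mu>, w), (f', g'), (z', \<mu>', w'))" "g' \<in> hom X w w'"
      and o': "(z, \<mu>, w) \<in> Obj XX" "(z', \<mu>', w') \<in> Obj XX"
      using v unfolding XX_hom by blast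
    have "ob (comma_r P) (x, \<nu>, y) = ob (comma_r P) (z, \<mu>, w)"
      "ob (comma_r P) (x', \<nu>', y') = ob (comma_r P) (z', \<mu>', w')"
      and ff: "f = f'" and Pg: "ar P g = ar P g'"
      using e by (simp_all add: fg(1) fg'(1))
    then have st: "(x, \<nu>, y) = (z, \<mu>, w)" "(x', \<nu>', y') = (z', \<mu>', w')"
      using r_bij_ob o o' unfolding bij_betw_def inj_on_def by blast+
    then have "g' \<in> hom X y y'" using fg' by simp
    then have "g = g'" by (rule P_faithful[OF fg(2) _ Pg])
    then show "u = v" using st ff by (simp add: fg(1) fg'(1))
  qed
  show "ar (comma_r P) ` Arr XX = Arr PM"
  proof
    show "ar (comma_r P) ` Arr XX \<subseteq> Arr PM"
    proof
      fix v assume "v \<in> ar (comma_r P) ` Arr XX"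
      then obtain u where u: "u \<in> Arr XX" "v = ar (comma_r P) u" by (rule imageE)
      show "v \<in> Arr PM" unfolding u(2) by (rule homD(1)[OF r_hom[OF Arr_hom[OF u(1)]]])
    qed
    show "Arr PM \<subseteq> ar (comma_r P) ` Arr XX"
    proof
      fix u assume "u \<in> Arr PM"
      then obtain x \<beta> m x' \<beta>' m' where u: "u \<in> hom PM (x, \<beta>, m) (x', \<beta>', m')"
        unfolding PM.comma_Arr by blast
      obtain f g where fg: "u = ((x, \<beta>, m), (f, g), (x', \<beta>', m'))" "f \<in> hom X x x'"
          "g \<in> hom M m m'" "g \<cdot>\<^bsub>M\<^esub> \<beta> = \<beta>' \<cdot>\<^bsub>M\<^esub> ar P f"
        and o: "(x, \<beta>, m) \<in> Obj PM" "(x', \<beta>', m') \<in> Obj PM"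
        using u unfolding PM_hom by blast
      have im: "(x, \<beta>, m) \<in> ob (comma_r P) ` Obj XX" "(x', \<beta>', m') \<in> ob (comma_r P) ` Obj XX"
        unfolding bij_betw_imp_surj_on[OF r_bij_ob] by (rule o)+
      obtain s where s: "(x, \<beta>, m) = ob (comma_r P) s" "s \<in> Obj XX" using im(1) by (rule imageE)
      obtain t where t: "(x', \<beta>', m') = ob (comma_r P) t" "t \<in> Obj XX" using im(2) by (rule imageE)
      obtain \<nu> y where sxy: "s = (x, \<nu>, y)" "ar P \<nu> = \<beta>" "ob P y = m"
        using s(1) by (cases s) auto
      obtain \<nu>' y' where txy: "t = (x', \<nu>', y')" "ar P \<nu>' = \<beta>'" "ob P y' = m'"
        using t(1) by (cases t) auto
      have \<nu>: "\<nu> \<in> hom X x y" "ar F \<nu> = Id A (ob F x)" and \<nu>': "\<nu>' \<in> hom X x' y'" "ar F \<nu>' = Id A (ob F x')"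
        using s(2) t(2) by (auto simp: sxy(1) txy(1) XX_Obj)
      have gh: "g \<in> hom M (ob P y) (ob P y')" and sq: "g \<cdot>\<^bsub>M\<^esub> ar P \<nu> = ar P \<nu>' \<cdot>\<^bsub>M\<^esub> ar P f"
        using fg sxy txy by auto
      obtain h where h: "h \<in> hom X y y'" "ar P h = g" "h \<cdot>\<^bsub>X\<^esub> \<nu> = \<nu>' \<cdot>\<^bsub>X\<^esub> f"
        by (rule lift_square[OF \<nu> \<nu>' fg(2) gh sq])
      have v: "(s, (f, h), t) \<in> hom XX s t"
        using s(2) t(2) fg(2) h unfolding sxy(1) txy(1) XX_hom by blast
      have "u = ar (comma_r P) (s, (f, h), t)" by (simp add: fg(1) h(2) s(1)[symmetric] t(1)[symmetric])
      then show "u \<in> ar (comma_r P) ` Arr XX" using homD(1)[OF v] by (rule image_eqI)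
    qed
  qed
qed

text \<open>Unique lifting makes \<open>r\<close> bijective on objects; faithfulness and the lifting of squares make it
  bijective on arrows. Both comma objects are fibrations over \<open>A\<close>, so the inverse of \<open>r\<close> is the
  left adjoint asked for.\<close>

theorem discrete_opfibration: "discrete_opfibration_in_Fib A X F M G P"
proof -
  have "\<exists>L. fib_adjunction A XX (comma_base F) PM (comma_base F) L (comma_r P) (Id PM) (Id XX)"
  proof (rule fib_adjunction_of_bijective[OF XX.comma_fibration PM.comma_fibration r_functor
        _ _ r_bij_ob r_bij_ar])
    fix s assume "s \<in> Obj XX"
    show "ob (comma_base F) (ob (comma_r P) s) = ob (comma_base F) s"
      by (cases s) (simp add: comma_base_def)
  next
    fix u assume "u \<in> Arr XX"
    show "ar (comma_base F) (ar (comma_r P) u) = ar (comma_base F) u"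
      by (cases u) (auto simp: comma_base_def)
  qed
  then show ?thesis
    using P_1cell unfolding discrete_opfibration_in_Fib_def Let_def by blast
qed

end

section \<open>Families with pushforward and pullback over a split fibration\<close>

locale split_base =
  fixes A :: "('p, 'b) category" and M :: "('q, 'c) category" and G :: "('q, 'c, 'p, 'b) func"
    and c :: "'b \<Rightarrow> 'q \<Rightarrow> 'c"
  assumes G_fib: "fibration M A G" and c_functorial: "functorial_cleavage M A G c"

sublocale split_base \<subseteq> G: is_functor M A G
  using G_fib by (simp add: fibration_def)

context split_base
begin

definition src :: "'b \<Rightarrow> 'q \<Rightarrow> 'q" where
  "src \<alpha> m = Dom M (c \<alpha> m)"

text \<open>The \<open>G\<close>-vertical arrows. They are described through their domain only, because the codomain
  then lies over the same object of \<open>A\<close>.\<close>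

definition vhom :: "'q \<Rightarrow> 'q \<Rightarrow> 'c set" where
  "vhom m n = {\<beta> \<in> hom M m n. ar G \<beta> = Id A (ob G m)}"

lemma vhom_hom: "\<beta> \<in> vhom m n \<Longrightarrow> \<beta> \<in> hom M m n"
  and vhom_G: "\<beta> \<in> vhom m n \<Longrightarrow> ar G \<beta> = Id A (ob G m)"
  by (auto simp: vhom_def)

lemma G_Id_hom:
  assumes "m \<in> Obj M"
  shows "Id A (ob G m) \<in> hom A (ob G m) (ob G m)"
  by (rule G.cod.Id_hom[OF G.ob_Obj[OF assms]])

lemma vhom_same_object:
  assumes "\<beta> \<in> vhom m n"
  shows "ob G n = ob G m"
  using G.ar_hom[OF vhom_hom[OF assms]] vhom_G[OF assms]
    G_Id_hom[OF G.dom.hom_Obj(1)[OF vhom_hom[OF assms]]] by (simp add: hom_def)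

lemma vhom_Id:
  assumes "m \<in> Obj M"
  shows "Id M m \<in> vhom m m"
  using G.dom.Id_hom[OF assms] G.ar_Id[OF assms] by (simp add: vhom_def)

lemma vhom_Comp:
  assumes "\<beta> \<in> vhom l m" "\<beta>' \<in> vhom m n"
  shows "\<beta>' \<cdot>\<^bsub>M\<^esub> \<beta> \<in> vhom l n"
  using G.dom.Comp_hom[OF vhom_hom[OF assms(1)] vhom_hom[OF assms(2)]]
    G.ar_Comp[OF vhom_hom[OF assms(1)] vhom_hom[OF assms(2)]]
    vhom_G[OF assms(1)] vhom_G[OF assms(2)] vhom_same_object[OF assms(1)]
    G.cod.Id_left[OF G_Id_hom[OF G.dom.hom_Obj(1)[OF vhom_hom[OF assms(1)]]]]
  by (simp add: vhom_def)

lemma c_lift: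
  assumes "m \<in> Obj M" "\<alpha> \<in> hom A a (ob G m)"
  shows "cartesian M A G (c \<alpha> m)" "c \<alpha> m \<in> hom M (src \<alpha> m) m" "ar G (c \<alpha> m) = \<alpha>"
    "src \<alpha> m \<in> Obj M" "ob G (src \<alpha> m) = a"
proof -
  have "cartesian_lifting M A G \<alpha> m (c \<alpha> m)"
    using c_functorial assms homD[OF assms(2)]
    unfolding functorial_cleavage_def cleavage_def by blast
  then show 1: "cartesian M A G (c \<alpha> m)" "ar G (c \<alpha> m) = \<alpha>" and 2: "c \<alpha> m \<in> hom M (src \<alpha> m) m"
    by (auto simp: cartesian_lifting_def cartesian_def hom_def src_def)
  show "src \<alpha> m \<in> Obj M" using G.dom.hom_Obj[OF 2] by blast
  show "ob G (src \<alpha> m) = a" using G.ar_hom[OF 2] 1(2) assms(2) by (simp add: hom_def)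
qed

lemma c_Id:
  assumes "m \<in> Obj M"
  shows "c (Id A (ob G m)) m = Id M m" "src (Id A (ob G m)) m = m"
proof -
  show "c (Id A (ob G m)) m = Id M m"
    using c_functorial assms unfolding functorial_cleavage_def by blast
  then show "src (Id A (ob G m)) m = m"
    using homD(2)[OF G.dom.Id_hom[OF assms]] by (simp add: src_def)
qed

lemma c_Comp:
  assumes "m \<in> Obj M" "\<alpha> \<in> hom A a (ob G m)" "\<gamma> \<in> hom A b a"
  shows "c (\<alpha> \<cdot>\<^bsub>A\<^esub> \<gamma>) m = c \<alpha> m \<cdot>\<^bsub>M\<^esub> c \<gamma> (src \<alpha> m)" "src (\<alpha> \<cdot>\<^bsub>A\<^esub> \<gamma>) m = src \<gamma> (src \<alpha> m)"
proof -
  have "Cod A \<gamma> = Dom A \<alpha>" using homD(3)[OF assms(3)] homD(2)[OF assms(2)] by simp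
  then show e: "c (\<alpha> \<cdot>\<^bsub>A\<^esub> \<gamma>) m = c \<alpha> m \<cdot>\<^bsub>M\<^esub> c \<gamma> (src \<alpha> m)"
    using c_functorial assms(1) homD[OF assms(2)] homD(1)[OF assms(3)]
    unfolding functorial_cleavage_def src_def by blast
  note l = c_lift[OF assms(1,2)]
  have "c \<gamma> (src \<alpha> m) \<in> hom M (src \<gamma> (src \<alpha> m)) (src \<alpha> m)"
    using c_lift(2)[OF l(4)] assms(3) l(5) by blast
  from homD(2)[OF G.dom.Comp_hom[OF this l(2)]] show "src (\<alpha> \<cdot>\<^bsub>A\<^esub> \<gamma>) m = src \<gamma> (src \<alpha> m)"
    by (simp add: src_def[of "\<alpha> \<cdot>\<^bsub>A\<^esub> \<gamma>"] e)
qed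

lemma vertical_part:
  assumes "\<mu> \<in> hom M l m" "m \<in> Obj M"
  obtains \<beta> where "\<beta> \<in> vhom l (src (ar G \<mu>) m)" "c (ar G \<mu>) m \<cdot>\<^bsub>M\<^esub> \<beta> = \<mu>"
proof -
  note h = G.ar_hom[OF assms(1)]
  note l = c_lift[OF assms(2) h]
  have I: "Id A (ob G l) \<in> hom A (ob G l) (ob G (src (ar G \<mu>) m))"
    using G_Id_hom[OF G.dom.hom_Obj(1)[OF assms(1)]] l(5) by simp
  have e: "ar G (c (ar G \<mu>) m) \<cdot>\<^bsub>A\<^esub> Id A (ob G l) = ar G \<mu>"
    using G.cod.Id_right[OF h] l(3) by simp
  show ?thesis
    by (rule cartesian_factor[OF l(1,2) assms(1) I e]) (rule that, simp_all add: vhom_def)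
qed

lemma vertical_part_unique:
  assumes "m \<in> Obj M" "\<alpha> \<in> hom A a (ob G m)" "\<beta> \<in> vhom l (src \<alpha> m)" "\<beta>' \<in> vhom l (src \<alpha> m)"
    and "c \<alpha> m \<cdot>\<^bsub>M\<^esub> \<beta> = c \<alpha> m \<cdot>\<^bsub>M\<^esub> \<beta>'"
  shows "\<beta> = \<beta>'"
  by (rule G.cartesian_cancel[OF c_lift(1,2)[OF assms(1,2)] vhom_hom[OF assms(3)]
        vhom_hom[OF assms(4)] assms(5)])
    (simp add: vhom_G[OF assms(3)] vhom_G[OF assms(4)])

text \<open>The arrow \<open>\<gamma>\<close> is the reindexing \<open>\<alpha>\<^sup>*\<beta>\<close> of the vertical arrow \<open>\<beta>\<close> along \<open>\<alpha>\<close>.\<close>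

lemma base_change:
  assumes \<beta>: "\<beta> \<in> vhom m n" and \<alpha>: "\<alpha> \<in> hom A a (ob G m)"
  obtains \<gamma> where "\<gamma> \<in> vhom (src \<alpha> m) (src \<alpha> n)" "c \<alpha> n \<cdot>\<^bsub>M\<^esub> \<gamma> = \<beta> \<cdot>\<^bsub>M\<^esub> c \<alpha> m"
proof -
  note h = vhom_hom[OF \<beta>]
  note mn = G.dom.hom_Obj[OF h]
  note l = c_lift[OF mn(1) \<alpha>]
  have \<mu>: "\<beta> \<cdot>\<^bsub>M\<^esub> c \<alpha> m \<in> hom M (src \<alpha> m) n" by (rule G.dom.Comp_hom[OF l(2) h])
  have "ar G (\<beta> \<cdot>\<^bsub>M\<^esub> c \<alpha> m) = \<alpha>"
    using G.ar_Comp[OF l(2) h] vhom_G[OF \<beta>] l(3) G.cod.Id_left[OF \<alpha>] by simp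
  with vertical_part[OF \<mu> mn(2)] that show ?thesis by metis
qed

end

text \<open>A family of sets over the objects of \<open>M\<close>, with \<open>Q\<close> as the disjoint union of its members and
  \<open>p\<close> as the projection. Vertical arrows act covariantly by \<open>push\<close>, and arrows of \<open>A\<close> act
  contravariantly by \<open>pull\<close>, compatibly with the chosen liftings \<open>c\<close>. Both actions are strictly
  functorial. The last axiom is the Beck--Chevalley condition \<open>\<alpha>\<^sup>*(\<beta>\<^sub>* s) = (\<alpha>\<^sup>*\<beta>)\<^sub>*(\<alpha>\<^sup>* s)\<close>. The map
  \<open>q\<close> is \<open>G \<circ> p\<close> on \<open>Q\<close>; it is a separate parameter because its values outside \<open>Q\<close> may differ.\<close>

locale push_pull_family = split_base A M G c
  for A :: "('p, 'b) category" and M :: "('q, 'c) category" and G :: "('q, 'c, 'p, 'b) func"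
    and c :: "'b \<Rightarrow> 'q \<Rightarrow> 'c" +
  fixes Q :: "'s set" and p :: "'s \<Rightarrow> 'q" and q :: "'s \<Rightarrow> 'p"
    and push :: "'c \<Rightarrow> 's \<Rightarrow> 's" and pull :: "'b \<Rightarrow> 's \<Rightarrow> 's"
  assumes p_Obj: "s \<in> Q \<Longrightarrow> p s \<in> Obj M"
    and q_eq: "s \<in> Q \<Longrightarrow> q s = ob G (p s)"
    and push_Q: "\<lbrakk>s \<in> Q; \<beta> \<in> vhom (p s) m\<rbrakk> \<Longrightarrow> push \<beta> s \<in> Q"
    and p_push: "\<lbrakk>s \<in> Q; \<beta> \<in> vhom (p s) m\<rbrakk> \<Longrightarrow> p (push \<beta> s) = m"
    and push_Id: "s \<in> Q \<Longrightarrow> push (Id M (p s)) s = s"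
    and push_Comp: "\<lbrakk>s \<in> Q; \<beta> \<in> vhom (p s) m; \<beta>' \<in> vhom m n\<rbrakk> \<Longrightarrow>
      push (\<beta>' \<cdot>\<^bsub>M\<^esub> \<beta>) s = push \<beta>' (push \<beta> s)"
    and pull_Q: "\<lbrakk>s \<in> Q; \<alpha> \<in> hom A a (ob G (p s))\<rbrakk> \<Longrightarrow> pull \<alpha> s \<in> Q"
    and p_pull: "\<lbrakk>s \<in> Q; \<alpha> \<in> hom A a (ob G (p s))\<rbrakk> \<Longrightarrow> p (pull \<alpha> s) = src \<alpha> (p s)"
    and pull_Id: "s \<in> Q \<Longrightarrow> pull (Id A (ob G (p s))) s = s"
    and pull_Comp: "\<lbrakk>s \<in> Q; \<alpha> \<in> hom A a (ob G (p s)); \<alpha>' \<in> hom A b a\<rbrakk> \<Longrightarrow>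
      pull (\<alpha> \<cdot>\<^bsub>A\<^esub> \<alpha>') s = pull \<alpha>' (pull \<alpha> s)"
    and pull_push: "\<lbrakk>s \<in> Q; \<beta> \<in> vhom (p s) m; \<alpha> \<in> hom A a (ob G (p s));
        \<gamma> \<in> vhom (src \<alpha> (p s)) (src \<alpha> m); c \<alpha> m \<cdot>\<^bsub>M\<^esub> \<gamma> = \<beta> \<cdot>\<^bsub>M\<^esub> c \<alpha> (p s)\<rbrakk> \<Longrightarrow>
      pull \<alpha> (push \<beta> s) = push \<gamma> (pull \<alpha> s)"
begin

text \<open>Writing \<open>\<mu> = c \<cdot> \<beta>\<close> with \<open>c\<close> a chosen lifting of \<open>\<alpha> = G \<mu>\<close> and \<open>\<beta>\<close> vertical, \<open>\<mu>\<close> is an arrow from \<open>s\<close> to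
  \<open>t\<close> iff \<open>\<beta>\<^sub>* s = \<alpha>\<^sup>* t\<close>. This is a category of elements in which one part of an arrow acts
  covariantly and the other part contravariantly.\<close>

definition el_arr :: "'s \<Rightarrow> 'c \<Rightarrow> 's \<Rightarrow> bool" where
  "el_arr s \<mu> t \<longleftrightarrow> s \<in> Q \<and> t \<in> Q \<and> \<mu> \<in> hom M (p s) (p t) \<and>
     (\<exists>\<beta>. \<beta> \<in> vhom (p s) (src (ar G \<mu>) (p t)) \<and> c (ar G \<mu>) (p t) \<cdot>\<^bsub>M\<^esub> \<beta> = \<mu> \<and>
       push \<beta> s = pull (ar G \<mu>) t)"

lemma el_arrI:
  assumes s: "s \<in> Q" and t: "t \<in> Q" and \<alpha>: "\<alpha> \<in> hom A a (ob G (p t))"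
    and \<beta>: "\<beta> \<in> vhom (p s) (src \<alpha> (p t))" and e: "push \<beta> s = pull \<alpha> t"
  shows "el_arr s (c \<alpha> (p t) \<cdot>\<^bsub>M\<^esub> \<beta>) t"
proof -
  note l = c_lift[OF p_Obj[OF t] \<alpha>]
  have a: "ob G (p s) = a" using vhom_same_object[OF \<beta>] l(5) by simp
  have "ar G (c \<alpha> (p t) \<cdot>\<^bsub>M\<^esub> \<beta>) = \<alpha>"
    using G.ar_Comp[OF vhom_hom[OF \<beta>] l(2)] vhom_G[OF \<beta>] l(3) G.cod.Id_right[OF \<alpha>] a by simp
  then show ?thesis
    using s t \<beta> e G.dom.Comp_hom[OF vhom_hom[OF \<beta>] l(2)] unfolding el_arr_def by auto
qed

lemma el_arrE:
  assumes "el_arr s \<mu> t"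
  obtains \<alpha> \<beta> where "\<alpha> \<in> hom A (ob G (p s)) (ob G (p t))" "ar G \<mu> = \<alpha>"
    "\<beta> \<in> vhom (p s) (src \<alpha> (p t))" "c \<alpha> (p t) \<cdot>\<^bsub>M\<^esub> \<beta> = \<mu>" "push \<beta> s = pull \<alpha> t"
  using assms G.ar_hom unfolding el_arr_def by blast

lemma el_arrD:
  assumes "el_arr s \<mu> t"
  shows "s \<in> Q" "t \<in> Q" "\<mu> \<in> hom M (p s) (p t)"
  using assms by (auto simp: el_arr_def)

text \<open>Here Beck--Chevalley is used. Interchanging the middle factors of
  \<open>\<nu> \<cdot> \<mu> = c\<^sub>2 \<cdot> \<beta>\<^sub>2 \<cdot> c\<^sub>1 \<cdot> \<beta>\<^sub>1\<close> turns the composite into a chosen lifting of \<open>\<alpha>\<^sub>2 \<cdot> \<alpha>\<^sub>1\<close> after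
  \<open>\<alpha>\<^sub>1\<^sup>*\<beta>\<^sub>2 \<cdot> \<beta>\<^sub>1\<close>, and
  \<open>(\<alpha>\<^sub>1\<^sup>*\<beta>\<^sub>2 \<cdot> \<beta>\<^sub>1)\<^sub>* s = (\<alpha>\<^sub>1\<^sup>*\<beta>\<^sub>2)\<^sub>* \<alpha>\<^sub>1\<^sup>* t = \<alpha>\<^sub>1\<^sup>* \<beta>\<^sub>2\<^sub>* t = \<alpha>\<^sub>1\<^sup>* \<alpha>\<^sub>2\<^sup>* r\<close>.\<close>

lemma el_arr_Comp:
  assumes \<mu>: "el_arr s \<mu> t" and \<nu>: "el_arr t \<nu> r"
  shows "el_arr s (\<nu> \<cdot>\<^bsub>M\<^esub> \<mu>) r"
proof -
  note Q = el_arrD(1,2)[OF \<mu>] el_arrD(2)[OF \<nu>]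
  obtain \<alpha>\<^sub>1 \<beta>\<^sub>1 where 1: "\<alpha>\<^sub>1 \<in> hom A (ob G (p s)) (ob G (p t))"
    "\<beta>\<^sub>1 \<in> vhom (p s) (src \<alpha>\<^sub>1 (p t))" "c \<alpha>\<^sub>1 (p t) \<cdot>\<^bsub>M\<^esub> \<beta>\<^sub>1 = \<mu>" "push \<beta>\<^sub>1 s = pull \<alpha>\<^sub>1 t"
    using \<mu> by (rule el_arrE)
  obtain \<alpha>\<^sub>2 \<beta>\<^sub>2 where 2: "\<alpha>\<^sub>2 \<in> hom A (ob G (p t)) (ob G (p r))"
    "\<beta>\<^sub>2 \<in> vhom (p t) (src \<alpha>\<^sub>2 (p r))" "c \<alpha>\<^sub>2 (p r) \<cdot>\<^bsub>M\<^esub> \<beta>\<^sub>2 = \<nu>" "push \<beta>\<^sub>2 t = pull \<alpha>\<^sub>2 r"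
    using \<nu> by (rule el_arrE)
  note pt = p_Obj[OF Q(2)] and pr = p_Obj[OF Q(3)]
  define n where "n = src \<alpha>\<^sub>2 (p r)"
  note l1 = c_lift[OF pt 1(1)] and l2 = c_lift[OF pr 2(1), folded n_def]
  note l12 = c_lift[OF l2(4), unfolded l2(5), OF 1(1)]
  note \<beta>\<^sub>2 = 2(2)[folded n_def]
  obtain \<gamma> where \<gamma>: "\<gamma> \<in> vhom (src \<alpha>\<^sub>1 (p t)) (src \<alpha>\<^sub>1 n)" "c \<alpha>\<^sub>1 n \<cdot>\<^bsub>M\<^esub> \<gamma> = \<beta>\<^sub>2 \<cdot>\<^bsub>M\<^esub> c \<alpha>\<^sub>1 (p t)"
    using \<beta>\<^sub>2 1(1) by (rule base_change)
  note c12 = c_Comp[OF pr 2(1) 1(1), folded n_def]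
  note \<gamma>\<beta> = vhom_Comp[OF 1(2) \<gamma>(1)]
  note h1 = vhom_hom[OF 1(2)] and h2 = vhom_hom[OF \<beta>\<^sub>2] and h\<gamma> = vhom_hom[OF \<gamma>(1)]
  have "\<nu> \<cdot>\<^bsub>M\<^esub> \<mu> = c \<alpha>\<^sub>2 (p r) \<cdot>\<^bsub>M\<^esub> (\<beta>\<^sub>2 \<cdot>\<^bsub>M\<^esub> \<mu>)"
    using G.dom.assoc[OF el_arrD(3)[OF \<mu>] h2 l2(2)] 2(3) by simp
  also have "\<beta>\<^sub>2 \<cdot>\<^bsub>M\<^esub> \<mu> = c \<alpha>\<^sub>1 n \<cdot>\<^bsub>M\<^esub> (\<gamma> \<cdot>\<^bsub>M\<^esub> \<beta>\<^sub>1)"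
    using G.dom.assoc[OF h1 l1(2) h2] G.dom.assoc[OF h1 h\<gamma> l12(2)] 1(3) \<gamma>(2) by simp
  also have "c \<alpha>\<^sub>2 (p r) \<cdot>\<^bsub>M\<^esub> (c \<alpha>\<^sub>1 n \<cdot>\<^bsub>M\<^esub> (\<gamma> \<cdot>\<^bsub>M\<^esub> \<beta>\<^sub>1)) = c (\<alpha>\<^sub>2 \<cdot>\<^bsub>A\<^esub> \<alpha>\<^sub>1) (p r) \<cdot>\<^bsub>M\<^esub> (\<gamma> \<cdot>\<^bsub>M\<^esub> \<beta>\<^sub>1)"
    using G.dom.assoc[OF vhom_hom[OF \<gamma>\<beta>] l12(2) l2(2)] c12(1) by simp
  finally have e: "\<nu> \<cdot>\<^bsub>M\<^esub> \<mu> = c (\<alpha>\<^sub>2 \<cdot>\<^bsub>A\<^esub> \<alpha>\<^sub>1) (p r) \<cdot>\<^bsub>M\<^esub> (\<gamma> \<cdot>\<^bsub>M\<^esub> \<beta>\<^sub>1)" .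
  have "push (\<gamma> \<cdot>\<^bsub>M\<^esub> \<beta>\<^sub>1) s = push \<gamma> (pull \<alpha>\<^sub>1 t)"
    using push_Comp[OF Q(1) 1(2) \<gamma>(1)] 1(4) by simp
  also have "\<dots> = pull \<alpha>\<^sub>1 (pull \<alpha>\<^sub>2 r)"
    using pull_push[OF Q(2) \<beta>\<^sub>2 1(1) \<gamma>] 2(4) by simp
  also have "\<dots> = pull (\<alpha>\<^sub>2 \<cdot>\<^bsub>A\<^esub> \<alpha>\<^sub>1) r"
    using pull_Comp[OF Q(3) 2(1) 1(1)] by simp
  finally show ?thesis
    unfolding e
    by (intro el_arrI[OF Q(1,3) G.cod.Comp_hom[OF 1(1) 2(1)]]) (use \<gamma>\<beta> c12(2) in simp_all)
qed

text \<open>A vertical arrow is its own vertical part, because the chosen lifting of an identity is an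
  identity. This gives the existence and the uniqueness of liftings of vertical arrows at once.\<close>

lemma el_arr_vertical_iff:
  assumes s: "s \<in> Q" and \<beta>: "\<beta> \<in> vhom (p s) m"
  shows "el_arr s \<beta> t \<longleftrightarrow> t = push \<beta> s"
proof
  note h = vhom_hom[OF \<beta>] and G\<beta> = vhom_G[OF \<beta>] and Gm = vhom_same_object[OF \<beta>]
  note m = G.dom.hom_Obj(2)[OF h]
  note cI = c_Id[OF m, unfolded Gm]
  have \<beta>l: "c (Id A (ob G (p s))) m \<cdot>\<^bsub>M\<^esub> \<beta> = \<beta>" using G.dom.Id_left[OF h] cI by simp
  {
    assume a: "el_arr s \<beta> t"
    obtain \<alpha> \<beta>' where 1: "ar G \<beta> = \<alpha>" "\<beta>' \<in> vhom (p s) (src \<alpha> (p t))"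
      "c \<alpha> (p t) \<cdot>\<^bsub>M\<^esub> \<beta>' = \<beta>" "push \<beta>' s = pull \<alpha> t"
      using a by (rule el_arrE)
    have pt: "p t = m" using homD(3)[OF el_arrD(3)[OF a]] homD(3)[OF h] by simp
    have \<alpha>: "\<alpha> = Id A (ob G (p s))" using 1(1) G\<beta> by simp
    have "\<beta>' = \<beta>" using 1(2,3) G.dom.Id_left[OF vhom_hom] cI by (simp add: \<alpha> pt)
    then show "t = push \<beta> s" using 1(4) pull_Id[OF el_arrD(2)[OF a]] Gm by (simp add: \<alpha> pt)
  next
    assume t: "t = push \<beta> s"
    note pp = p_push[OF s \<beta>] and PQ = push_Q[OF s \<beta>]
    have "el_arr s (c (Id A (ob G (p s))) (p t) \<cdot>\<^bsub>M\<^esub> \<beta>) t"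
    proof (rule el_arrI[OF s])
      show "t \<in> Q" using PQ t by simp
      show "Id A (ob G (p s)) \<in> hom A (ob G (p s)) (ob G (p t))"
        using G_Id_hom[OF p_Obj[OF s]] pp Gm t by simp
      show "\<beta> \<in> vhom (p s) (src (Id A (ob G (p s))) (p t))" using \<beta> pp cI t by simp
      show "push \<beta> s = pull (Id A (ob G (p s))) t" using pull_Id[OF PQ] pp Gm t by simp
    qed
    then show "el_arr s \<beta> t" using \<beta>l pp t by simp
  }
qed

lemma el_arr_Id: "s \<in> Q \<Longrightarrow> el_arr s (Id M (p s)) s"
  using el_arr_vertical_iff[OF _ vhom_Id[OF p_Obj]] push_Id by simp

lemma el_arr_pull:
  assumes t: "t \<in> Q" and \<alpha>: "\<alpha> \<in> hom A a (ob G (p t))"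
  shows "el_arr (pull \<alpha> t) (c \<alpha> (p t)) t"
proof -
  note l = c_lift[OF p_Obj[OF t] \<alpha>] and pQ = pull_Q[OF t \<alpha>] and pp = p_pull[OF t \<alpha>]
  have "el_arr (pull \<alpha> t) (c \<alpha> (p t) \<cdot>\<^bsub>M\<^esub> Id M (p (pull \<alpha> t))) t"
    by (rule el_arrI[OF pQ t \<alpha>]) (use vhom_Id[OF p_Obj[OF pQ]] pp push_Id[OF pQ] in simp_all)
  then show ?thesis using G.dom.Id_right[OF l(2)] pp by simp
qed

definition elements :: "('s, 's \<times> 'c \<times> 's) category" where
  "elements =
     \<lparr>Obj = Q,
      Arr = {(s, \<mu>, t) | s \<mu> t. el_arr s \<mu> t},
      Dom = \<lambda>(s, _, _). s,
      Cod = \<lambda>(_, _, t). t,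
      Id = \<lambda>s. (s, Id M (p s), s),
      Comp = \<lambda>(_, \<nu>, t) (s, \<mu>, _). (s, \<nu> \<cdot>\<^bsub>M\<^esub> \<mu>, t)\<rparr>"

definition el_proj :: "('s, 's \<times> 'c \<times> 's, 'q, 'c) func" where
  "el_proj = \<lparr>ob = p, ar = \<lambda>(_, \<mu>, _). \<mu>\<rparr>"

definition el_base :: "('s, 's \<times> 'c \<times> 's, 'p, 'b) func" where
  "el_base = \<lparr>ob = q, ar = \<lambda>(_, \<mu>, _). ar G \<mu>\<rparr>"

lemma el_hom: "u \<in> hom elements s t \<longleftrightarrow> (\<exists>\<mu>. u = (s, \<mu>, t) \<and> el_arr s \<mu> t)"
  by (auto simp: elements_def hom_def)

lemma el_hom_triple [simp]: "(s', \<mu>, t') \<in> hom elements s t \<longleftrightarrow> s' = s \<and> t' = t \<and> el_arr s \<mu> t"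
  by (auto simp: el_hom)

lemma el_simps [simp]:
  "Obj elements = Q"
  "(t', \<nu>, r) \<cdot>\<^bsub>elements\<^esub> (s, \<mu>, t) = (s, \<nu> \<cdot>\<^bsub>M\<^esub> \<mu>, r)"
  "Id elements s = (s, Id M (p s), s)"
  "Dom elements (s, \<mu>, t) = s" "Cod elements (s, \<mu>, t) = t"
  "(s, \<mu>, t) \<in> Arr elements \<longleftrightarrow> el_arr s \<mu> t"
  "ob el_proj s = p s" "ar el_proj (s, \<mu>, t) = \<mu>"
  "ob el_base s = q s" "ar el_base (s, \<mu>, t) = ar G \<mu>"
  by (simp_all add: elements_def el_proj_def el_base_def)

lemma elements_category: "category elements"
proof
  fix u assume "u \<in> Arr elements"
  then show "Dom elements u \<in> Obj elements" "Cod elements u \<in> Obj elements"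
    by (cases u; simp add: el_arrD)+
next
  fix s assume "s \<in> Obj elements"
  then show "Id elements s \<in> hom elements s s" by (simp add: el_arr_Id)
next
  fix u v s t r assume "u \<in> hom elements s t" "v \<in> hom elements t r"
  then show "v \<cdot>\<^bsub>elements\<^esub> u \<in> hom elements s r"
    unfolding el_hom by (auto intro: el_arr_Comp)
next
  fix u s t assume "u \<in> hom elements s t"
  then obtain \<mu> where \<mu>: "u = (s, \<mu>, t)" "el_arr s \<mu> t" unfolding el_hom by blast
  note h = el_arrD(3)[OF \<mu>(2)]
  show "Id elements t \<cdot>\<^bsub>elements\<^esub> u = u" "u \<cdot>\<^bsub>elements\<^esub> Id elements s = u"
    using G.dom.Id_left[OF h] G.dom.Id_right[OF h] by (simp_all add: \<mu>(1))
next
  fix u v w r s t z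
  assume "u \<in> hom elements r s" "v \<in> hom elements s t" "w \<in> hom elements t z"
  then obtain \<kappa> \<mu> \<nu> where e: "u = (r, \<kappa>, s)" "v = (s, \<mu>, t)" "w = (t, \<nu>, z)"
    and a: "el_arr r \<kappa> s" "el_arr s \<mu> t" "el_arr t \<nu> z"
    unfolding el_hom by blast
  show "w \<cdot>\<^bsub>elements\<^esub> (v \<cdot>\<^bsub>elements\<^esub> u) = (w \<cdot>\<^bsub>elements\<^esub> v) \<cdot>\<^bsub>elements\<^esub> u"
    using G.dom.assoc[OF el_arrD(3)[OF a(1)] el_arrD(3)[OF a(2)] el_arrD(3)[OF a(3)]]
    by (simp add: e)
qed

sublocale E: category elements
  by (rule elements_category)

sublocale el_proj: is_functor elements M el_proj
proof
  fix s assume "s \<in> Obj elements"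
  then show "ob el_proj s \<in> Obj M" "ar el_proj (Id elements s) = Id M (ob el_proj s)"
    by (simp_all add: p_Obj)
next
  fix u s t assume "u \<in> hom elements s t"
  then show "ar el_proj u \<in> hom M (ob el_proj s) (ob el_proj t)"
    unfolding el_hom by (auto dest: el_arrD)
next
  fix u v s t r assume "u \<in> hom elements s t" "v \<in> hom elements t r"
  then show "ar el_proj (v \<cdot>\<^bsub>elements\<^esub> u) = ar el_proj v \<cdot>\<^bsub>M\<^esub> ar el_proj u"
    unfolding el_hom by auto
qed

sublocale el_base: is_functor elements A el_base
proof
  fix s assume "s \<in> Obj elements"
  then show "ob el_base s \<in> Obj A" "ar el_base (Id elements s) = Id A (ob el_base s)"
    using G.ob_Obj[OF p_Obj] G.ar_Id[OF p_Obj] by (simp_all add: q_eq)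
next
  fix u s t assume "u \<in> hom elements s t"
  then obtain \<mu> where \<mu>: "u = (s, \<mu>, t)" "el_arr s \<mu> t" unfolding el_hom by blast
  show "ar el_base u \<in> hom A (ob el_base s) (ob el_base t)"
    using G.ar_hom[OF el_arrD(3)[OF \<mu>(2)]] el_arrD(1,2)[OF \<mu>(2)] by (simp add: \<mu>(1) q_eq)
next
  fix u v s t r assume "u \<in> hom elements s t" "v \<in> hom elements t r"
  then obtain \<mu> \<nu> where e: "u = (s, \<mu>, t)" "v = (t, \<nu>, r)" and a: "el_arr s \<mu> t" "el_arr t \<nu> r"
    unfolding el_hom by blast
  show "ar el_base (v \<cdot>\<^bsub>elements\<^esub> u) = ar el_base v \<cdot>\<^bsub>A\<^esub> ar el_base u"
    using G.ar_Comp[OF el_arrD(3)[OF a(1)] el_arrD(3)[OF a(2)]] by (simp add: e)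
qed

text \<open>Functoriality of the cleavage and of \<open>pull\<close> shows that the factorization in \<open>M\<close> through a chosen
  lifting is again an arrow between the given elements; its uniqueness is that in \<open>M\<close>.\<close>

lemma el_lift_cartesian:
  assumes t: "t \<in> Q" and \<alpha>: "\<alpha> \<in> hom A a (ob G (p t))"
  shows "cartesian elements A el_base (pull \<alpha> t, c \<alpha> (p t), t)"
proof -
  note l = c_lift[OF p_Obj[OF t] \<alpha>] and pQ = pull_Q[OF t \<alpha>] and pp = p_pull[OF t \<alpha>]
  let ?n = "src \<alpha> (p t)"
  show ?thesis
  proof (rule cartesianI[where y = "pull \<alpha> t" and x = t])
    show "(pull \<alpha> t, c \<alpha> (p t), t) \<in> hom elements (pull \<alpha> t) t"
      using el_arr_pull[OF t \<alpha>] by simp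
  next
    fix r u h
    assume u: "u \<in> hom elements r t" and h: "h \<in> hom A (ob el_base r) (ob el_base (pull \<alpha> t))"
      and uh: "ar el_base (pull \<alpha> t, c \<alpha> (p t), t) \<cdot>\<^bsub>A\<^esub> h = ar el_base u"
    obtain \<mu> where \<mu>: "u = (r, \<mu>, t)" "el_arr r \<mu> t" using u unfolding el_hom by blast
    note r = el_arrD(1)[OF \<mu>(2)]
    have h: "h \<in> hom A (ob G (p r)) a" using h q_eq[OF r] q_eq[OF pQ] pp l(5) by simp
    have e: "ar G \<mu> = \<alpha> \<cdot>\<^bsub>A\<^esub> h" using uh l(3) by (simp add: \<mu>(1))
    obtain \<alpha>' \<beta> where 1: "ar G \<mu> = \<alpha>'" "\<beta> \<in> vhom (p r) (src \<alpha>' (p t))"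
      "c \<alpha>' (p t) \<cdot>\<^bsub>M\<^esub> \<beta> = \<mu>" "push \<beta> r = pull \<alpha>' t"
      using \<mu>(2) by (rule el_arrE)
    have \<alpha>': "\<alpha>' = \<alpha> \<cdot>\<^bsub>A\<^esub> h" using 1(1) e by simp
    note cc = c_Comp[OF p_Obj[OF t] \<alpha> h]
    have hn: "h \<in> hom A (ob G (p r)) (ob G ?n)" using h l(5) by simp
    note lh = c_lift[OF l(4) hn]
    have \<beta>: "\<beta> \<in> vhom (p r) (src h ?n)" using 1(2) cc(2) \<alpha>' by simp
    have "el_arr r (c h (p (pull \<alpha> t)) \<cdot>\<^bsub>M\<^esub> \<beta>) (pull \<alpha> t)"
    proof (rule el_arrI[OF r pQ])
      show "push \<beta> r = pull h (pull \<alpha> t)" using 1(4) pull_Comp[OF t \<alpha> h] \<alpha>' by simp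
    qed (use hn pp \<beta> in simp_all)
    then have k: "el_arr r (c h ?n \<cdot>\<^bsub>M\<^esub> \<beta>) (pull \<alpha> t)" using pp by simp
    have "c \<alpha> (p t) \<cdot>\<^bsub>M\<^esub> (c h ?n \<cdot>\<^bsub>M\<^esub> \<beta>) = \<mu>"
      using G.dom.assoc[OF vhom_hom[OF \<beta>] lh(2) l(2)] cc(1) 1(3) \<alpha>' by simp
    moreover have "ar G (c h ?n \<cdot>\<^bsub>M\<^esub> \<beta>) = h"
      using G.ar_Comp[OF vhom_hom[OF \<beta>] lh(2)] lh(3) vhom_G[OF \<beta>] G.cod.Id_right[OF h] by simp
    ultimately show "\<exists>k. k \<in> hom elements r (pull \<alpha> t) \<and>
        (pull \<alpha> t, c \<alpha> (p t), t) \<cdot>\<^bsub>elements\<^esub> k = u \<and> ar el_base k = h"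
      using k by (intro exI[of _ "(r, c h ?n \<cdot>\<^bsub>M\<^esub> \<beta>, pull \<alpha> t)"]) (simp add: \<mu>(1))
  next
    fix r u v
    assume "u \<in> hom elements r (pull \<alpha> t)" "v \<in> hom elements r (pull \<alpha> t)"
      and e: "(pull \<alpha> t, c \<alpha> (p t), t) \<cdot>\<^bsub>elements\<^esub> u = (pull \<alpha> t, c \<alpha> (p t), t) \<cdot>\<^bsub>elements\<^esub> v"
      "ar el_base u = ar el_base v"
    then obtain \<mu> \<nu> where uv: "u = (r, \<mu>, pull \<alpha> t)" "v = (r, \<nu>, pull \<alpha> t)"
      and a: "el_arr r \<mu> (pull \<alpha> t)" "el_arr r \<nu> (pull \<alpha> t)"
      unfolding el_hom by blast
    have "\<mu> = \<nu>"
      using G.cartesian_cancel[OF l(1,2)] el_arrD(3)[OF a(1)] el_arrD(3)[OF a(2)] e pp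
      by (simp add: uv)
    then show "u = v" by (simp add: uv)
  qed
qed

lemma el_base_fibration: "fibration elements A el_base"
  unfolding fibration_def
proof (intro conjI ballI impI)
  show "is_functor elements A el_base" by (rule el_base.is_functor_axioms)
  fix \<alpha> t assume \<alpha>: "\<alpha> \<in> Arr A" and t: "t \<in> Obj elements" and e: "Cod A \<alpha> = ob el_base t"
  have tQ: "t \<in> Q" using t by simp
  have \<alpha>h: "\<alpha> \<in> hom A (Dom A \<alpha>) (ob G (p t))" using \<alpha> e q_eq[OF tQ] by (simp add: hom_def)
  have "cartesian_lifting elements A el_base \<alpha> t (pull \<alpha> t, c \<alpha> (p t), t)"
    using el_lift_cartesian[OF tQ \<alpha>h] c_lift(3)[OF p_Obj[OF tQ] \<alpha>h]
    unfolding cartesian_lifting_def by simp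
  then show "\<exists>f. cartesian_lifting elements A el_base \<alpha> t f" by (rule exI)
qed

text \<open>An arbitrary cartesian arrow is compared with the one of \<open>el_lift_cartesian\<close> at its target,
  whose projection is a chosen lifting and thus cartesian.\<close>

lemma el_proj_1cell: "fib_1cell A elements el_base M G el_proj"
  unfolding fib_1cell_def
proof (intro conjI ballI allI impI)
  show o: "ob G (ob el_proj s) = ob el_base s" if "s \<in> Obj elements" for s
    using that q_eq by simp
  show a: "ar G (ar el_proj f) = ar el_base f" if "f \<in> Arr elements" for f
    by (cases f) simp
  fix f assume f: "cartesian elements A el_base f"
  have fA: "f \<in> Arr elements" using f by (simp add: cartesian_def)
  obtain s \<mu> t where \<mu>: "f = (s, \<mu>, t)" by (cases f)
  have ar: "el_arr s \<mu> t" using fA by (simp add: \<mu>)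
  note t = el_arrD(2)[OF ar] and h = G.ar_hom[OF el_arrD(3)[OF ar]]
  note l = c_lift[OF p_Obj[OF t] h]
  show "cartesian M A G (ar el_proj f)"
  proof (rule cartesian_image_transfer[OF el_base.is_functor_axioms G.is_functor_axioms
        el_proj.is_functor_axioms o a f _ el_lift_cartesian[OF t h]])
    show "f \<in> hom elements s t" using ar by (simp add: \<mu>)
    show "(pull (ar G \<mu>) t, c (ar G \<mu>) (p t), t) \<in> hom elements (pull (ar G \<mu>) t) t"
      using el_arr_pull[OF t h] by simp
    show "ar el_base (pull (ar G \<mu>) t, c (ar G \<mu>) (p t), t) = ar el_base f"
      using l(3) by (simp add: \<mu>)
    show "cartesian M A G (ar el_proj (pull (ar G \<mu>) t, c (ar G \<mu>) (p t), t))"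
      using l(1) by simp
  qed
qed (rule el_base_fibration G_fib el_proj.is_functor_axioms)+

sublocale el_discrete: fiberwise_discrete A elements el_base M G el_proj
proof
  show "fib_1cell A elements el_base M G el_proj" by (rule el_proj_1cell)
  fix s \<beta> m
  assume s: "s \<in> Obj elements" and b: "\<beta> \<in> hom M (ob el_proj s) m"
    "ar G \<beta> = Id A (ob el_base s)"
  have sQ: "s \<in> Q" using s by simp
  have \<beta>: "\<beta> \<in> vhom (p s) m" using b q_eq[OF sQ] by (simp add: vhom_def)
  note iff = el_arr_vertical_iff[OF sQ \<beta>]
  show "\<exists>!\<nu>. \<nu> \<in> Arr elements \<and> Dom elements \<nu> = s \<and> ar el_base \<nu> = Id A (ob el_base s) \<and>
      ar el_proj \<nu> = \<beta>"
  proof (rule ex1I[of _ "(s, \<beta>, push \<beta> s)"])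
    show "(s, \<beta>, push \<beta> s) \<in> Arr elements \<and> Dom elements (s, \<beta>, push \<beta> s) = s \<and>
        ar el_base (s, \<beta>, push \<beta> s) = Id A (ob el_base s) \<and> ar el_proj (s, \<beta>, push \<beta> s) = \<beta>"
      using iff b by simp
    fix \<nu> assume "\<nu> \<in> Arr elements \<and> Dom elements \<nu> = s \<and> ar el_base \<nu> = Id A (ob el_base s) \<and>
        ar el_proj \<nu> = \<beta>"
    then show "\<nu> = (s, \<beta>, push \<beta> s)" using iff by (cases \<nu>) simp
  qed
qed

end

section \<open>The quotient by vertical zig-zags\<close>

locale zigzag_quotient = split_base A M G cG
  for A :: "('oa, 'aa) category" and M :: "('om, 'am) category"
    and G :: "('om, 'am, 'oa, 'aa) func" and cG :: "'aa \<Rightarrow> 'om \<Rightarrow> 'am" +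
  fixes X :: "('ox, 'ax) category" and F :: "('ox, 'ax, 'oa, 'aa) func"
    and P :: "('ox, 'ax, 'om, 'am) func"
    and cF :: "'aa \<Rightarrow> 'ox \<Rightarrow> 'ax" and cP :: "'am \<Rightarrow> 'ox \<Rightarrow> 'ax"
  assumes P_fibre: "fiberwise_opfibration A X F M G P"
    and cF_compatible: "compatible_cleavage A X F P cG cF"
    and cP_opcleavage: "fiberwise_opcleavage A X F M G P cP"

sublocale zigzag_quotient \<subseteq> F: is_functor X A F
  using P_fibre by (simp add: fiberwise_opfibration_def fib_1cell_def fibration_def)
sublocale zigzag_quotient \<subseteq> P: is_functor X M P
  using P_fibre by (simp add: fiberwise_opfibration_def fib_1cell_def)

context zigzag_quotient
begin

lemma GPo: "x \<in> Obj X \<Longrightarrow> ob G (ob P x) = ob F x"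
  and GPa: "f \<in> Arr X \<Longrightarrow> ar G (ar P f) = ar F f"
  using P_fibre by (auto simp: fiberwise_opfibration_def fib_1cell_def)

abbreviation "cls \<equiv> bar_class X M P"
abbreviation "Q \<equiv> Obj X // zigzag X M P"

lemma zigzag_equiv: "equiv (Obj X) (zigzag X M P)"
proof (rule equivI)
  let ?R = "vertical_step X M P \<union> (vertical_step X M P)\<inverse>"
  show "zigzag X M P \<subseteq> Obj X \<times> Obj X" by (auto simp: zigzag_def)
  show "refl_on (Obj X) (zigzag X M P)" by (auto simp: zigzag_def refl_on_def)
  have "sym (?R\<^sup>*)" by (rule sym_rtrancl) (auto simp: sym_def)
  then show "sym (zigzag X M P)" by (auto simp: zigzag_def sym_def)
  show "trans (zigzag X M P)" unfolding zigzag_def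
    by (rule transI) (auto intro: rtrancl_trans)
qed

lemma cls_eq_iff: "x \<in> Obj X \<Longrightarrow> y \<in> Obj X \<Longrightarrow> cls x = cls y \<longleftrightarrow> (x, y) \<in> zigzag X M P"
  unfolding bar_class_def by (rule eq_equiv_class_iff[OF zigzag_equiv])

lemma cls_Q: "x \<in> Obj X \<Longrightarrow> cls x \<in> Q"
  unfolding bar_class_def by (rule quotientI)

lemma Q_cases:
  assumes "s \<in> Q"
  obtains x where "x \<in> Obj X" "s = cls x"
  using assms unfolding bar_class_def by (auto elim: quotientE)

lemma vertical_cls:
  assumes f: "f \<in> hom X x y" and P: "ar P f = Id M (ob P x)"
  shows "cls x = cls y"
proof -
  note xy = F.dom.hom_Obj[OF f]
  have "(x, y) \<in> vertical_step X M P"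
    using homD[OF f] P P.ob_Obj[OF xy(1)] unfolding vertical_step_def by blast
  then show ?thesis using xy by (auto simp: cls_eq_iff zigzag_def)
qed

lemma vertical_step_cases:
  assumes "(x, y) \<in> vertical_step X M P"
  obtains f where "f \<in> hom X x y" "ar P f = Id M (ob P x)" "ob P y = ob P x"
proof -
  obtain f m where f: "f \<in> hom X x y" and m: "m \<in> Obj M" "ar P f = Id M m"
    using assms unfolding vertical_step_def hom_def by blast
  have "ob P x = m" "ob P y = m"
    using P.ar_hom[OF f] G.dom.Id_hom[OF m(1)] m(2) by (auto simp: hom_def)
  then show ?thesis using that f m by simp
qed

text \<open>Induction along the zig-zag. All its objects have the same image under \<open>P\<close>, so the hypothesis
  is only required for arrows over the identity of \<open>P x\<close>. This restriction matters below, as the chosen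
  liftings \<open>cP \<beta> u\<close> and \<open>cF \<alpha> u\<close> are meaningful only if \<open>\<beta>\<close> starts at \<open>P u\<close> and \<open>\<alpha>\<close> ends at
  \<open>F u\<close>.\<close>

lemma cls_invariant:
  assumes x: "x \<in> Obj X"
    and inv: "\<And>f u v. \<lbrakk>f \<in> hom X u v; ar P f = Id M (ob P u); ob P u = ob P x\<rbrakk> \<Longrightarrow> \<phi> u = \<phi> v"
    and y: "y \<in> cls x"
  shows "ob P y = ob P x \<and> \<phi> y = \<phi> x"
proof -
  have "(x, y) \<in> (vertical_step X M P \<union> (vertical_step X M P)\<inverse>)\<^sup>*"
    using y by (auto simp: bar_class_def zigzag_def)
  then show ?thesis
  proof (induction rule: rtrancl_induct)
    case base
    show ?case by simp
  next
    case (step u v)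
    from step(2) show ?case
    proof
      assume "(u, v) \<in> vertical_step X M P"
      then obtain f where "f \<in> hom X u v" "ar P f = Id M (ob P u)" "ob P v = ob P u"
        by (rule vertical_step_cases)
      then show ?case using step.IH inv[of f u v] by simp
    next
      assume "(u, v) \<in> (vertical_step X M P)\<inverse>"
      then have "(v, u) \<in> vertical_step X M P" by simp
      then obtain f where f: "f \<in> hom X v u" "ar P f = Id M (ob P v)" "ob P u = ob P v"
        by (rule vertical_step_cases)
      have v: "ob P v = ob P x" using step.IH f(3) by simp
      have "\<phi> v = \<phi> u" by (rule inv[OF f(1,2) v])
      then show ?case using step.IH v by simp
    qed
  qed
qed

lemma the_elem_cls:
  assumes x: "x \<in> Obj X"
    and inv: "\<And>f u v. \<lbrakk>f \<in> hom X u v; ar P f = Id M (ob P u); ob P u = ob P x\<rbrakk> \<Longrightarrow> \<phi> u = \<phi> v"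
  shows "the_elem (\<phi> ` cls x) = \<phi> x"
proof (rule the_elem_image_unique)
  show "cls x \<noteq> {}" using x by (auto simp: bar_class_def zigzag_def)
  show "\<phi> y = \<phi> x" if "y \<in> cls x" for y
    by (rule conjunct2[OF cls_invariant[where \<phi> = \<phi>, OF x _ that]]) (rule inv)
qed

definition p :: "'ox set \<Rightarrow> 'om" where "p s = the_elem (ob P ` s)"
definition q :: "'ox set \<Rightarrow> 'oa" where "q s = the_elem (ob F ` s)"

definition push :: "'am \<Rightarrow> 'ox set \<Rightarrow> 'ox set" where
  "push \<beta> s = the_elem ((\<lambda>x. cls (Cod X (cP \<beta> x))) ` s)"

definition pull :: "'aa \<Rightarrow> 'ox set \<Rightarrow> 'ox set" where
  "pull \<alpha> s = the_elem ((\<lambda>x. cls (Dom X (cF \<alpha> x))) ` s)"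

lemma P_vertical_same_objects:
  assumes f: "f \<in> hom X u v" and P: "ar P f = Id M (ob P u)"
  shows "ob P v = ob P u" "ob F v = ob F u" "ar F f = Id A (ob F u)"
proof -
  note uv = F.dom.hom_Obj[OF f]
  show e: "ob P v = ob P u"
    using P.ar_hom[OF f] P G.dom.Id_hom[OF P.ob_Obj[OF uv(1)]] by (simp add: hom_def)
  show "ob F v = ob F u" using e GPo[OF uv(1)] GPo[OF uv(2)] by simp
  show "ar F f = Id A (ob F u)"
    using GPa[OF homD(1)[OF f]] P G.ar_Id[OF P.ob_Obj[OF uv(1)]] GPo[OF uv(1)] by simp
qed

lemma p_cls: "x \<in> Obj X \<Longrightarrow> p (cls x) = ob P x"
  unfolding p_def by (rule the_elem_cls) (auto dest: P_vertical_same_objects)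

lemma q_cls: "x \<in> Obj X \<Longrightarrow> q (cls x) = ob F x"
  unfolding q_def by (rule the_elem_cls) (auto dest: P_vertical_same_objects)

lemma cF_lift:
  assumes x: "x \<in> Obj X" and \<alpha>: "\<alpha> \<in> hom A a (ob F x)"
  shows "cartesian X A F (cF \<alpha> x)" "cF \<alpha> x \<in> hom X (Dom X (cF \<alpha> x)) x" "ar F (cF \<alpha> x) = \<alpha>"
    "ar P (cF \<alpha> x) = cG \<alpha> (ob P x)" "Dom X (cF \<alpha> x) \<in> Obj X" "ob F (Dom X (cF \<alpha> x)) = a"
    "ob P (Dom X (cF \<alpha> x)) = src \<alpha> (ob P x)"
proof -
  have "cartesian_lifting X A F \<alpha> x (cF \<alpha> x)" and 4: "ar P (cF \<alpha> x) = cG \<alpha> (ob P x)"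
    using cF_compatible x homD[OF \<alpha>] unfolding compatible_cleavage_def cleavage_def by blast+
  then show 1: "cartesian X A F (cF \<alpha> x)" "ar F (cF \<alpha> x) = \<alpha>"
    and 2: "cF \<alpha> x \<in> hom X (Dom X (cF \<alpha> x)) x"
    by (auto simp: cartesian_lifting_def cartesian_def hom_def)
  show "ar P (cF \<alpha> x) = cG \<alpha> (ob P x)" by (rule 4)
  show "Dom X (cF \<alpha> x) \<in> Obj X" using F.dom.hom_Obj[OF 2] by blast
  show "ob F (Dom X (cF \<alpha> x)) = a" using F.ar_hom[OF 2] 1(2) \<alpha> by (simp add: hom_def)
  show "ob P (Dom X (cF \<alpha> x)) = src \<alpha> (ob P x)"
    using homD(2)[OF P.ar_hom[OF 2]] 4 by (simp add: src_def)
qed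

lemma cP_lift:
  assumes x: "x \<in> Obj X" and \<beta>: "\<beta> \<in> vhom (ob P x) m"
  shows "cP \<beta> x \<in> hom X x (Cod X (cP \<beta> x))" "ar F (cP \<beta> x) = Id A (ob F x)" "ar P (cP \<beta> x) = \<beta>"
    "Cod X (cP \<beta> x) \<in> Obj X" "ob P (Cod X (cP \<beta> x)) = m"
    "opcartesian (fiber X A F (ob F x)) (fiber M A G (ob F x)) P (cP \<beta> x)"
proof -
  note h = vhom_hom[OF \<beta>]
  have lift: "opcartesian_lifting (fiber X A F (ob F x)) (fiber M A G (ob F x)) P \<beta> x (cP \<beta> x)"
    using cP_opcleavage x homD[OF h] vhom_G[OF \<beta>] GPo[OF x]
    unfolding fiberwise_opcleavage_def by auto
  then show oc: "opcartesian (fiber X A F (ob F x)) (fiber M A G (ob F x)) P (cP \<beta> x)"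
    and 1: "ar P (cP \<beta> x) = \<beta>"
    by (simp_all add: opcartesian_lifting_def fiber_def)
  have d: "Dom X (cP \<beta> x) = x" using lift by (simp add: opcartesian_lifting_def fiber_def)
  have "cP \<beta> x \<in> Arr (fiber X A F (ob F x))" using oc unfolding opcartesian_def by blast
  then show 2: "cP \<beta> x \<in> hom X x (Cod X (cP \<beta> x))" and "ar F (cP \<beta> x) = Id A (ob F x)"
    using d by (simp_all add: fiber_def hom_def)
  show "Cod X (cP \<beta> x) \<in> Obj X" using F.dom.hom_Obj[OF 2] by blast
  show "ob P (Cod X (cP \<beta> x)) = m" using homD(3)[OF P.ar_hom[OF 2]] homD(3)[OF h] 1 by simp
qed

lemma F_vertical_vhom:
  assumes f: "f \<in> hom X x y" and F: "ar F f = Id A (ob F x)"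
  shows "ar P f \<in> vhom (ob P x) (ob P y)"
  using P.ar_hom[OF f] GPa[OF homD(1)[OF f]] F GPo[OF F.dom.hom_Obj(1)[OF f]]
  by (simp add: vhom_def)

text \<open>Up to zig-zags the target of any \<open>F\<close>-vertical arrow \<open>f\<close> is the pushforward along \<open>P f\<close>,
  even if \<open>f\<close> is not opcartesian: \<open>f\<close> factors through the opcartesian lifting of \<open>P f\<close> by an arrow
  over an identity of \<open>M\<close>. All laws for \<open>push\<close>, including Beck--Chevalley, follow from this by
  finding a suitable \<open>f\<close>.\<close>

lemma vertical_target_cls:
  assumes f: "f \<in> hom X x y" and F: "ar F f = Id A (ob F x)"
  shows "cls (Cod X (cP (ar P f) x)) = cls y"
proof -
  let ?a = "ob F x" and ?e = "cP (ar P f) x"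
  let ?z = "Cod X ?e"
  note xy = F.dom.hom_Obj[OF f]
  note \<beta> = F_vertical_vhom[OF f F]
  note e = cP_lift[OF xy(1) \<beta>]
  have Fy: "ob F y = ?a"
    using vhom_same_object[OF \<beta>] GPo[OF xy(1)] GPo[OF xy(2)] by simp
  have f_fib: "f \<in> Arr (fiber X A F ?a)" using homD[OF f] F Fy by (simp add: fiber_def)
  have Py: "ob P y \<in> Obj M" by (rule P.ob_Obj[OF xy(2)])
  have "ar G (Id M (ob P y)) = Id A ?a" using G.ar_Id[OF Py] GPo[OF xy(2)] Fy by simp
  then have I: "Id M (ob P y) \<in> hom (fiber M A G ?a) (ob P ?z) (ob P (Cod X f))"
    using G.dom.Id_hom[OF Py] e(5) homD(3)[OF f] GPo[OF xy(2)] Fy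
    by (simp add: fiber_def hom_def)
  have "Id M (ob P y) \<cdot>\<^bsub>M\<^esub> ar P ?e = ar P f" using G.dom.Id_left[OF vhom_hom[OF \<beta>]] e(3) by simp
  moreover have "Dom X f = Dom X ?e" using homD(2)[OF f] homD(2)[OF e(1)] by simp
  ultimately have "\<exists>!k. k \<in> hom (fiber X A F ?a) ?z (Cod X f) \<and> k \<cdot>\<^bsub>X\<^esub> ?e = f \<and>
      ar P k = Id M (ob P y)"
    using e(6) f_fib I unfolding opcartesian_def by (simp add: fiber_def)
  then obtain k where k: "k \<in> hom (fiber X A F ?a) ?z (Cod X f)" "ar P k = Id M (ob P y)" by blast
  have "k \<in> hom X ?z y" using k(1) homD(3)[OF f] by (simp add: fiber_def hom_def)
  then show ?thesis using k(2) e(5) by (intro vertical_cls) simp_all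
qed

text \<open>The dual of the previous lemma: an arrow \<open>f\<close> over a chosen lifting in \<open>M\<close> factors through
  \<open>cF (F f) x\<close> by an arrow that \<open>P\<close> sends to an identity, the vertical part of \<open>P f\<close> being trivial.\<close>

lemma cartesian_source_cls:
  assumes f: "f \<in> hom X y x" and P: "ar P f = cG (ar F f) (ob P x)"
  shows "cls (Dom X (cF (ar F f) x)) = cls y"
proof -
  note yx = F.dom.hom_Obj[OF f] and \<alpha> = F.ar_hom[OF f]
  note l = cF_lift[OF yx(2) \<alpha>]
  let ?c = "cF (ar F f) x"
  let ?I = "Id A (ob F y)"
  have Fy: "ob F y \<in> Obj A" by (rule F.ob_Obj[OF yx(1)])
  have I: "?I \<in> hom A (ob F y) (ob F (Dom X ?c))" using G.cod.Id_hom[OF Fy] l(6) by simp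
  obtain k where k: "k \<in> hom X y (Dom X ?c)" "?c \<cdot>\<^bsub>X\<^esub> k = f" "ar F k = ?I"
    by (rule cartesian_factor[OF l(1,2) f I]) (use l(3) G.cod.Id_right[OF \<alpha>] in simp_all)
  have \<alpha>G: "ar F f \<in> hom A (ob F y) (ob G (ob P x))" using \<alpha> GPo[OF yx(2)] by simp
  note m = P.ob_Obj[OF yx(2)]
  have Py: "ob P y = src (ar F f) (ob P x)"
    using homD(2)[OF P.ar_hom[OF f]] P by (simp add: src_def)
  have "ar P k = Id M (ob P y)"
  proof (rule vertical_part_unique[OF m \<alpha>G])
    show "ar P k \<in> vhom (ob P y) (src (ar F f) (ob P x))"
      using F_vertical_vhom[OF k(1,3)] l(7) by simp
    show "Id M (ob P y) \<in> vhom (ob P y) (src (ar F f) (ob P x))"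
      using vhom_Id[OF P.ob_Obj[OF yx(1)]] Py by simp
    show "cG (ar F f) (ob P x) \<cdot>\<^bsub>M\<^esub> ar P k = cG (ar F f) (ob P x) \<cdot>\<^bsub>M\<^esub> Id M (ob P y)"
      using P.ar_Comp[OF k(1) l(2)] k(2) l(4) P G.dom.Id_right[OF P.ar_hom[OF f]] by simp
  qed
  then show ?thesis using vertical_cls[OF k(1)] by simp
qed

lemma push_cls:
  assumes x: "x \<in> Obj X" and \<beta>: "\<beta> \<in> vhom (ob P x) m"
  shows "push \<beta> (cls x) = cls (Cod X (cP \<beta> x))"
  unfolding push_def
proof (rule the_elem_cls[OF x])
  fix f u v assume f: "f \<in> hom X u v" and P: "ar P f = Id M (ob P u)" and u: "ob P u = ob P x"
  note uv = F.dom.hom_Obj[OF f] and o = P_vertical_same_objects[OF f P]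
  have \<beta>v: "\<beta> \<in> vhom (ob P v) m" using \<beta> u o by simp
  note e = cP_lift[OF uv(2) \<beta>v]
  have "ar F (cP \<beta> v \<cdot>\<^bsub>X\<^esub> f) = Id A (ob F u)"
    using F.ar_Comp[OF f e(1)] e(2) o G.cod.Id_left[OF G.cod.Id_hom[OF F.ob_Obj[OF uv(1)]]] by simp
  moreover have "ar P (cP \<beta> v \<cdot>\<^bsub>X\<^esub> f) = \<beta>"
    using P.ar_Comp[OF f e(1)] e(3) P G.dom.Id_right[OF vhom_hom[OF \<beta>v]] o by simp
  ultimately show "cls (Cod X (cP \<beta> u)) = cls (Cod X (cP \<beta> v))"
    using vertical_target_cls[OF F.dom.Comp_hom[OF f e(1)]] by simp
qed

lemma pull_cls:
  assumes x: "x \<in> Obj X" and \<alpha>: "\<alpha> \<in> hom A a (ob F x)"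
  shows "pull \<alpha> (cls x) = cls (Dom X (cF \<alpha> x))"
  unfolding pull_def
proof (rule the_elem_cls[OF x])
  fix f u v assume f: "f \<in> hom X u v" and P: "ar P f = Id M (ob P u)" and u: "ob P u = ob P x"
  note uv = F.dom.hom_Obj[OF f] and o = P_vertical_same_objects[OF f P]
  have "ob F u = ob F x" using GPo[OF uv(1)] GPo[OF x] u by simp
  then have \<alpha>u: "\<alpha> \<in> hom A a (ob F u)" using \<alpha> by simp
  note e = cF_lift[OF uv(1) \<alpha>u]
  have F: "ar F (f \<cdot>\<^bsub>X\<^esub> cF \<alpha> u) = \<alpha>"
    using F.ar_Comp[OF e(2) f] e(3) o G.cod.Id_left[OF \<alpha>u] by simp
  have "ar P (f \<cdot>\<^bsub>X\<^esub> cF \<alpha> u) = cG \<alpha> (ob P v)"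
    using P.ar_Comp[OF e(2) f] e(4) P o G.dom.Id_left[OF P.ar_hom[OF e(2)]] by simp
  then show "cls (Dom X (cF \<alpha> u)) = cls (Dom X (cF \<alpha> v))"
    using cartesian_source_cls[OF F.dom.Comp_hom[OF e(2) f]] F by simp
qed

lemma push_eqI:
  assumes "f \<in> hom X x y" "ar F f = Id A (ob F x)"
  shows "push (ar P f) (cls x) = cls y"
  using push_cls[OF F.dom.hom_Obj(1)[OF assms(1)] F_vertical_vhom[OF assms]]
    vertical_target_cls[OF assms] by simp

lemma pull_eqI:
  assumes "f \<in> hom X y x" "ar P f = cG (ar F f) (ob P x)"
  shows "pull (ar F f) (cls x) = cls y"
  using pull_cls[OF F.dom.hom_Obj(2)[OF assms(1)] F.ar_hom[OF assms(1)]]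
    cartesian_source_cls[OF assms] by simp

text \<open>Reindexing the opcartesian arrow \<open>x \<rightarrow> \<beta>\<^sub>*x\<close> along \<open>\<alpha>\<close> gives an \<open>F\<close>-vertical arrow
  \<open>k : \<alpha>\<^sup>*x \<rightarrow> \<alpha>\<^sup>*(\<beta>\<^sub>*x)\<close> over \<open>\<gamma> = \<alpha>\<^sup>*\<beta>\<close>. It need not be opcartesian, so \<open>\<alpha>\<^sup>*(\<beta>\<^sub>*x)\<close> and
  \<open>\<gamma>\<^sub>*(\<alpha>\<^sup>*x)\<close> may differ, but they are in the same class. This is why a fiberwise opfibration is
  enough.\<close>

lemma pull_push_cls:
  assumes x: "x \<in> Obj X" and \<beta>: "\<beta> \<in> vhom (ob P x) m" and \<alpha>: "\<alpha> \<in> hom A a (ob F x)"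
    and \<gamma>: "\<gamma> \<in> vhom (src \<alpha> (ob P x)) (src \<alpha> m)"
      "cG \<alpha> m \<cdot>\<^bsub>M\<^esub> \<gamma> = \<beta> \<cdot>\<^bsub>M\<^esub> cG \<alpha> (ob P x)"
  shows "pull \<alpha> (push \<beta> (cls x)) = push \<gamma> (pull \<alpha> (cls x))"
proof -
  note e = cP_lift[OF x \<beta>] and c = cF_lift[OF x \<alpha>]
  let ?z = "Cod X (cP \<beta> x)" and ?y = "Dom X (cF \<alpha> x)"
  have Fz: "ob F ?z = ob F x"
    using vhom_same_object[OF \<beta>] GPo[OF x] GPo[OF e(4)] e(5) by simp
  have \<alpha>z: "\<alpha> \<in> hom A a (ob F ?z)" using \<alpha> Fz by simp
  note d = cF_lift[OF e(4) \<alpha>z]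
  note g = F.dom.Comp_hom[OF c(2) e(1)]
  have Fg: "ar F (cP \<beta> x \<cdot>\<^bsub>X\<^esub> cF \<alpha> x) = \<alpha>"
    using F.ar_Comp[OF c(2) e(1)] c(3) e(2) G.cod.Id_left[OF \<alpha>] by simp
  have a: "a \<in> Obj A" using G.cod.hom_Obj[OF \<alpha>] by simp
  have I: "Id A a \<in> hom A (ob F ?y) (ob F (Dom X (cF \<alpha> ?z)))"
    using G.cod.Id_hom[OF a] c(6) d(6) by simp
  obtain k where k: "k \<in> hom X ?y (Dom X (cF \<alpha> ?z))" "cF \<alpha> ?z \<cdot>\<^bsub>X\<^esub> k = cP \<beta> x \<cdot>\<^bsub>X\<^esub> cF \<alpha> x"
    "ar F k = Id A a"
    by (rule cartesian_factor[OF d(1,2) g I]) (use Fg d(3) G.cod.Id_right[OF \<alpha>] in simp_all)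
  have kF: "ar F k = Id A (ob F ?y)" using k(3) c(6) by simp
  have m: "m \<in> Obj M" using G.dom.hom_Obj(2)[OF vhom_hom[OF \<beta>]] .
  have \<alpha>m: "\<alpha> \<in> hom A a (ob G m)" using \<alpha> vhom_same_object[OF \<beta>] GPo[OF x] by simp
  have "ar P k = \<gamma>"
  proof (rule vertical_part_unique[OF m \<alpha>m])
    show "ar P k \<in> vhom (src \<alpha> (ob P x)) (src \<alpha> m)"
      using F_vertical_vhom[OF k(1) kF] c(7) d(7) e(5) by simp
    show "\<gamma> \<in> vhom (src \<alpha> (ob P x)) (src \<alpha> m)" by (rule \<gamma>(1))
    have "cG \<alpha> m \<cdot>\<^bsub>M\<^esub> ar P k = ar P (cF \<alpha> ?z \<cdot>\<^bsub>X\<^esub> k)"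
      using P.ar_Comp[OF k(1) d(2)] d(4) e(5) by simp
    also have "\<dots> = cG \<alpha> m \<cdot>\<^bsub>M\<^esub> \<gamma>"
      using k(2) P.ar_Comp[OF c(2) e(1)] e(3) c(4) \<gamma>(2) by simp
    finally show "cG \<alpha> m \<cdot>\<^bsub>M\<^esub> ar P k = cG \<alpha> m \<cdot>\<^bsub>M\<^esub> \<gamma>" .
  qed
  then have "push \<gamma> (cls ?y) = cls (Dom X (cF \<alpha> ?z))"
    using push_eqI[OF k(1) kF] by simp
  then show ?thesis
    using push_cls[OF x \<beta>] pull_cls[OF e(4) \<alpha>z] pull_cls[OF x \<alpha>] by simp
qed

text \<open>Each law follows by exhibiting one arrow of \<open>X\<close>: an identity for the unit laws, a composite of
  two chosen liftings for the composition laws. For \<open>pull\<close> the composite lies over a chosen lifting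
  because the cleavage of \<open>G\<close> is functorial.\<close>

sublocale bar: push_pull_family A M G cG Q p q push pull
proof
  fix s assume "s \<in> Q"
  then obtain x where x: "x \<in> Obj X" and s: "s = cls x" by (rule Q_cases)
  note ps = p_cls[OF x] and Gs = GPo[OF x]
  show "p s \<in> Obj M" using P.ob_Obj[OF x] ps s by simp
  show "q s = ob G (p s)" using q_cls[OF x] Gs ps s by simp
  have Ix: "Id X x \<in> hom X x x" "ar F (Id X x) = Id A (ob F x)" "ar P (Id X x) = Id M (ob P x)"
    using F.dom.Id_hom[OF x] F.ar_Id[OF x] P.ar_Id[OF x] by auto
  show "push (Id M (p s)) s = s" using push_eqI[OF Ix(1,2)] Ix(3) ps s by simp
  show "pull (Id A (ob G (p s))) s = s"
    using pull_eqI[OF Ix(1)] Ix(2,3) c_Id(1)[OF P.ob_Obj[OF x]] ps Gs s by simp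
  {
    fix \<beta> m assume "\<beta> \<in> vhom (p s) m"
    then have \<beta>: "\<beta> \<in> vhom (ob P x) m" using ps s by simp
    note e = cP_lift[OF x \<beta>] and psh = push_cls[OF x \<beta>]
    show "push \<beta> s \<in> Q" using cls_Q[OF e(4)] psh s by simp
    show "p (push \<beta> s) = m" using p_cls[OF e(4)] e(5) psh s by simp
    {
      fix \<beta>' n assume \<beta>': "\<beta>' \<in> vhom m n"
      have \<beta>'z: "\<beta>' \<in> vhom (ob P (Cod X (cP \<beta> x))) n" using \<beta>' e(5) by simp
      note e' = cP_lift[OF e(4) \<beta>'z]
      let ?f = "cP \<beta>' (Cod X (cP \<beta> x)) \<cdot>\<^bsub>X\<^esub> cP \<beta> x"
      have Fz: "ob F (Cod X (cP \<beta> x)) = ob F x"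
        using vhom_same_object[OF \<beta>] GPo[OF x] GPo[OF e(4)] e(5) by simp
      have "ar F ?f = Id A (ob F x)"
        using F.ar_Comp[OF e(1) e'(1)] e(2) e'(2) Fz
          G.cod.Id_left[OF G.cod.Id_hom[OF F.ob_Obj[OF x]]] by simp
      moreover have "ar P ?f = \<beta>' \<cdot>\<^bsub>M\<^esub> \<beta>" using P.ar_Comp[OF e(1) e'(1)] e(3) e'(3) by simp
      ultimately show "push (\<beta>' \<cdot>\<^bsub>M\<^esub> \<beta>) s = push \<beta>' (push \<beta> s)"
        using push_eqI[OF F.dom.Comp_hom[OF e(1) e'(1)]] psh push_cls[OF e(4) \<beta>'z] s by simp
    }
    {
      fix \<alpha> a \<gamma> assume "\<alpha> \<in> hom A a (ob G (p s))" "\<gamma> \<in> vhom (src \<alpha> (p s)) (src \<alpha> m)"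
        "cG \<alpha> m \<cdot>\<^bsub>M\<^esub> \<gamma> = \<beta> \<cdot>\<^bsub>M\<^esub> cG \<alpha> (p s)"
      then show "pull \<alpha> (push \<beta> s) = push \<gamma> (pull \<alpha> s)"
        using pull_push_cls[OF x \<beta>] ps Gs s by simp
    }
  }
  {
    fix \<alpha> a assume "\<alpha> \<in> hom A a (ob G (p s))"
    then have \<alpha>: "\<alpha> \<in> hom A a (ob F x)" using ps Gs s by simp
    note l = cF_lift[OF x \<alpha>] and pl = pull_cls[OF x \<alpha>]
    show "pull \<alpha> s \<in> Q" using cls_Q[OF l(5)] pl s by simp
    show "p (pull \<alpha> s) = src \<alpha> (p s)" using p_cls[OF l(5)] l(7) pl ps s by simp
    fix \<alpha>' b assume \<alpha>': "\<alpha>' \<in> hom A b a"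
    have \<alpha>'y: "\<alpha>' \<in> hom A b (ob F (Dom X (cF \<alpha> x)))" using \<alpha>' l(6) by simp
    note l' = cF_lift[OF l(5) \<alpha>'y]
    let ?f = "cF \<alpha> x \<cdot>\<^bsub>X\<^esub> cF \<alpha>' (Dom X (cF \<alpha> x))"
    have \<alpha>G: "\<alpha> \<in> hom A a (ob G (ob P x))" using \<alpha> Gs by simp
    have "ar F ?f = \<alpha> \<cdot>\<^bsub>A\<^esub> \<alpha>'" using F.ar_Comp[OF l'(2) l(2)] l(3) l'(3) by simp
    moreover have "ar P ?f = cG (\<alpha> \<cdot>\<^bsub>A\<^esub> \<alpha>') (ob P x)"
      using P.ar_Comp[OF l'(2) l(2)] l(4,7) l'(4) c_Comp(1)[OF P.ob_Obj[OF x] \<alpha>G \<alpha>'] by simp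
    ultimately show "pull (\<alpha> \<cdot>\<^bsub>A\<^esub> \<alpha>') s = pull \<alpha>' (pull \<alpha> s)"
      using pull_eqI[OF F.dom.Comp_hom[OF l'(2) l(2)]] pl pull_cls[OF l(5) \<alpha>'y] s by simp
  }
qed

text \<open>The description of an arrow by representatives is independent of them, since both sides of
  its condition are the well-defined \<open>push\<close> and \<open>pull\<close> of classes.\<close>

lemma bar_arr_iff:
  assumes x: "x \<in> Obj X" and y: "y \<in> Obj X"
  shows "bar_arr A X F M G P cF cP x \<mu> y \<longleftrightarrow> bar.el_arr (cls x) \<mu> (cls y)"
proof (cases "\<mu> \<in> hom M (ob P x) (ob P y)")
  case False
  then show ?thesis using p_cls x y by (simp add: bar_arr_def bar.el_arr_def)
next
  case \<mu>: True
  define \<alpha> where "\<alpha> = ar G \<mu>"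
  have \<alpha>G: "\<alpha> \<in> hom A (ob G (ob P x)) (ob G (ob P y))" using G.ar_hom[OF \<mu>] by (simp add: \<alpha>_def)
  then have \<alpha>: "\<alpha> \<in> hom A (ob F x) (ob F y)" using GPo x y by simp
  note l = cF_lift[OF y \<alpha>] and Py = P.ob_Obj[OF y]
  obtain \<beta> where \<beta>: "\<beta> \<in> vhom (ob P x) (src \<alpha> (ob P y))" "cG \<alpha> (ob P y) \<cdot>\<^bsub>M\<^esub> \<beta> = \<mu>"
    using vertical_part[OF \<mu> Py] unfolding \<alpha>_def by blast
  have uniq: "\<beta>' = \<beta>"
    if "\<beta>' \<in> vhom (ob P x) (src \<alpha> (ob P y))" "cG \<alpha> (ob P y) \<cdot>\<^bsub>M\<^esub> \<beta>' = \<mu>" for \<beta>'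
    by (rule vertical_part_unique[OF Py \<alpha>G that(1) \<beta>(1)]) (simp add: that(2) \<beta>(2))
  have "(THE \<beta>. \<beta> \<in> hom M (ob P x) (ob P (Dom X (cF \<alpha> y))) \<and>
          ar P (cF \<alpha> y) \<cdot>\<^bsub>M\<^esub> \<beta> = \<mu> \<and> ar G \<beta> = Id A (ob F x)) = \<beta>"
  proof (rule the_equality)
    fix \<beta>' assume "\<beta>' \<in> hom M (ob P x) (ob P (Dom X (cF \<alpha> y))) \<and>
          ar P (cF \<alpha> y) \<cdot>\<^bsub>M\<^esub> \<beta>' = \<mu> \<and> ar G \<beta>' = Id A (ob F x)"
    then show "\<beta>' = \<beta>"
      unfolding l(4,7) GPo[OF x, symmetric] by (intro uniq) (simp_all add: vhom_def)
  qed (use \<beta> l(4,7) GPo[OF x] in \<open>simp add: vhom_def\<close>)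
  then have "bar_arr A X F M G P cF cP x \<mu> y \<longleftrightarrow>
      cls (Cod X (cP \<beta> x)) = cls (Dom X (cF \<alpha> y))"
    using \<mu> unfolding bar_arr_def Let_def \<alpha>_def by simp
  also have "\<dots> \<longleftrightarrow> push \<beta> (cls x) = pull \<alpha> (cls y)"
    unfolding push_cls[OF x \<beta>(1)] pull_cls[OF y \<alpha>] ..
  also have "\<dots> \<longleftrightarrow> bar.el_arr (cls x) \<mu> (cls y)"
  proof
    assume "push \<beta> (cls x) = pull \<alpha> (cls y)"
    then show "bar.el_arr (cls x) \<mu> (cls y)"
      using \<mu> \<beta> cls_Q[OF x] cls_Q[OF y]
      unfolding bar.el_arr_def p_cls[OF x] p_cls[OF y] \<alpha>_def by blast
  next
    assume "bar.el_arr (cls x) \<mu> (cls y)"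
    then obtain \<beta>' where \<beta>': "\<beta>' \<in> vhom (ob P x) (src \<alpha> (ob P y))"
      "cG \<alpha> (ob P y) \<cdot>\<^bsub>M\<^esub> \<beta>' = \<mu>" "push \<beta>' (cls x) = pull \<alpha> (cls y)"
      unfolding bar.el_arr_def p_cls[OF x] p_cls[OF y] \<alpha>_def by blast
    show "push \<beta> (cls x) = pull \<alpha> (cls y)" using \<beta>'(3) unfolding uniq[OF \<beta>'(1,2)] .
  qed
  finally show ?thesis .
qed

lemma bar_cat_eq: "bar_cat A X F M G P cF cP = bar.elements"
proof -
  have "{(cls x, \<mu>, cls y) | x \<mu> y. x \<in> Obj X \<and> y \<in> Obj X \<and> bar_arr A X F M G P cF cP x \<mu> y}
      = {(s, \<mu>, t) | s \<mu> t. bar.el_arr s \<mu> t}" (is "?L = ?R")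
  proof
    show "?L \<subseteq> ?R" using bar_arr_iff by blast
    show "?R \<subseteq> ?L"
    proof
      fix u assume "u \<in> ?R"
      then obtain s \<mu> t where u: "u = (s, \<mu>, t)" and a: "bar.el_arr s \<mu> t" by blast
      obtain x where x: "x \<in> Obj X" "s = cls x" using bar.el_arrD(1)[OF a] by (rule Q_cases)
      obtain y where y: "y \<in> Obj X" "t = cls y" using bar.el_arrD(2)[OF a] by (rule Q_cases)
      show "u \<in> ?L" using a x y bar_arr_iff[OF x(1) y(1)] by (auto simp: u)
    qed
  qed
  then show ?thesis by (simp add: bar_cat_def bar.elements_def p_def)
qed

lemma bar_F_eq: "bar_F F G = bar.el_base"
  and bar_P_eq: "bar_P P = bar.el_proj"
  by (simp_all add: bar_F_def bar_P_def bar.el_base_def bar.el_proj_def p_def q_def fun_eq_iff)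

end

theorem proposition3p9:
  fixes A :: "('oa, 'aa) category"
    and X :: "('ox, 'ax) category"
    and M :: "('om, 'am) category"
    and F :: "('ox, 'ax, 'oa, 'aa) func"
    and G :: "('om, 'am, 'oa, 'aa) func"
    and P :: "('ox, 'ax, 'om, 'am) func"
    and cG :: "'aa \<Rightarrow> 'om \<Rightarrow> 'am"
    and cF :: "'aa \<Rightarrow> 'ox \<Rightarrow> 'ax"
    and cP :: "'am \<Rightarrow> 'ox \<Rightarrow> 'ax"
  assumes "fiberwise_opfibration A X F M G P"
    and "split_fibration M A G"
    and "functorial_cleavage M A G cG"
    and "compatible_cleavage A X F P cG cF"
    and "fiberwise_opcleavage A X F M G P cP"
  shows "discrete_opfibration_in_Fib A
           (bar_cat A X F M G P cF cP) (bar_F F G) M G (bar_P P)"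
proof -
  interpret zigzag_quotient A M G cG X F P cF cP
    using assms by unfold_locales (simp_all add: split_fibration_def)
  show ?thesis
    unfolding bar_cat_eq bar_F_eq bar_P_eq by (rule bar.el_discrete.discrete_opfibration)
qed

end
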